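(* Let $u\in\mathfrak{S}_k(M)$ and suppose that $0\in\Gamma_\kappa^{(k)}(u)$ for $\kappa\le k$. There exist $r_M>0$ and $C_M\ge0$ (depending on $M$) such that $$W_\kappa(r,u)=\frac{1}{r^{n-2+2\kappa}}\int_{B_r}|\nabla u|^2-\frac{\kappa}{r^{n-1+2\kappa}}\int_{\partial B_r}u^2$$ satisfies $$\frac{d}{dr}W_\kappa(r,u)\ge -C_M\qquad\text{for }0<r<r_M.$$
   Context: Notation: $n\ge 2$, $k\in\mathbb{N}=\{1,2,\dots\}$, $M>0$, $x=(x',x_n)\in\mathbb{R}^{n-1}\times\mathbb{R}$; $B_r$ is the open ball of radius $r$ about $0$ in $\mathbb{R}^n$; $B_1^+=B_1\cap\{x_n>0\}$; $B_1'=B_1\cap(\mathbb{R}^{n-1}\times\{0\})$. On $\{x_n=0\}$, $\partial_{x_n}u$ denotes the limit from inside $\{x_n>0\}$. Class $\mathfrak{S}_k(M)$: functions $u\in C^{1,\alpha}(B_1^+\cup B_1')$, for some $\alpha\in(0,1)$, such that $|\Delta u|\le M|x'|^{k-1}$ in $B_1^+$ (weak sense); $u\ge0$, $-\partial_{x_n}u\ge0$, $u\,\partial_{x_n}u=0$ on $B_1'$; $0\in\Gamma(u)$, the boundary of $\{u(\cdot,0)=0\}$ in the relative topology of $B_1'$; and $\|u\|_{C^1}\le M$. Every such $u$ is extended to $B_1$ by $u(x',-x_n)=u(x',x_n)$. Frequency: with $H(r)=\int_{\partial B_r}u^2$, let $\Phi_k(r,u)=(r+Cr^2)\frac{d}{dr}\log\max\{H(r),r^{n-1+2k}\}$,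 where $C>0$ is a constant depending on $M$ chosen so that $\Phi_k(\cdot,u)$ is nondecreasing (up to a null set) for small $r$; such $C$ exists, and $\Phi_k(0+,u)=\lim_{r\to0+}\Phi_k(r,u)$ does not depend on its choice. The condition $0\in\Gamma_\kappa^{(k)}(u)$ means $\Phi_k(0+,u)=n-1+2\kappa$. *)

theory Defs
  imports "HOL-Analysis.Analysis"
begin

text \<open>
  The space \<open>\<real>\<^sup>n = \<real>\<^sup>n\<^sup>-\<^sup>1 \<times> \<real>\<close> with points \<open>x = (x', x\<^sub>n)\<close> is the type \<open>'m space\<close>, where
  \<open>CARD('m) = n - 1\<close> and \<open>DIM('m space) = n\<close>; thus \<open>n \<ge> 2\<close> holds automatically.
\<close>

type_synonym 'm space = "(real, 'm) vec \<times> real"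

definition upper :: "('m::finite) space set" where
  "upper = {x. 0 < snd x}"

definition half_ball :: "('m::finite) space set" where
  "half_ball = ball 0 1 \<inter> upper"

definition thin_ball :: "('m::finite) space set" where
  "thin_ball = ball 0 1 \<inter> (UNIV \<times> {0})"


section \<open>Gradients and \<open>C\<^sup>1\<^sup>,\<^sup>\<alpha>\<close> regularity up to the thin ball\<close>

definition gradient :: "('a::euclidean_space \<Rightarrow> real) \<Rightarrow> 'a \<Rightarrow> 'a" where
  "gradient f x = (SOME D. GDERIV f x :> D)"

definition upper_gradient :: "(('m::finite) space \<Rightarrow> real) \<Rightarrow> 'm space \<Rightarrow> 'm space" where
  "upper_gradient u x =
     (if x \<in> upper then gradient u x else Lim (at x within upper) (gradient u))"

text \<open>
  Functions in \<open>C\<^sup>1\<^sup>,\<^sup>\<alpha>(B\<^sub>1\<^sup>+ \<union> B\<^sub>1')\<close>: as the set is not closed, the Hoelder condition is local, i.e.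
  imposed on compact subsets.  Continuity of \<^const>\<open>upper_gradient\<close> on the union forces the
  limits in its definition to exist at the points of the thin ball.
\<close>

definition C1_Hoelder :: "real \<Rightarrow> (('m::finite) space \<Rightarrow> real) \<Rightarrow> bool" where
  "C1_Hoelder \<alpha> u \<longleftrightarrow>
     continuous_on (half_ball \<union> thin_ball) u \<and>
     (\<forall>x\<in>half_ball. u differentiable (at x)) \<and>
     continuous_on (half_ball \<union> thin_ball) (upper_gradient u) \<and>
     (\<forall>K. compact K \<and> K \<subseteq> half_ball \<union> thin_ball \<longrightarrow>
        (\<exists>L. \<forall>x\<in>K. \<forall>y\<in>K.
           norm (upper_gradient u x - upper_gradient u y) \<le> L * dist x y powr \<alpha>))"

definition C1_norm :: "(('m::finite) space \<Rightarrow> real) \<Rightarrow> ennreal" where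
  "C1_norm u =
     (SUP x\<in>half_ball \<union> thin_ball. ennreal \<bar>u x\<bar>) +
     (SUP x\<in>half_ball \<union> thin_ball. ennreal (norm (upper_gradient u x)))"


section \<open>Weak Laplacian\<close>

text \<open>Test functions of class \<open>C\<^sup>1\<close> with compact support, as is usual for weak solutions.\<close>

definition test_functions :: "'a::euclidean_space set \<Rightarrow> ('a \<Rightarrow> real) set" where
  "test_functions \<Omega> = {\<phi>.
     (\<forall>x. \<phi> differentiable (at x)) \<and> continuous_on UNIV (gradient \<phi>) \<and>
     compact (closure {x. \<phi> x \<noteq> 0}) \<and> closure {x. \<phi> x \<noteq> 0} \<subseteq> \<Omega>}"

definition weak_laplacian ::
    "'a::euclidean_space set \<Rightarrow> ('a \<Rightarrow> real) \<Rightarrow> ('a \<Rightarrow> real) \<Rightarrow> bool" where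
  "weak_laplacian \<Omega> u f \<longleftrightarrow>
     (\<forall>K. compact K \<and> K \<subseteq> \<Omega> \<longrightarrow> set_integrable lebesgue K f) \<and>
     (\<forall>\<phi>\<in>test_functions \<Omega>.
        (LINT x:\<Omega>|lebesgue. gradient u x \<bullet> gradient \<phi> x) = - (LINT x:\<Omega>|lebesgue. f x * \<phi> x))"


section \<open>The class of solutions\<close>

definition normal_deriv :: "(('m::finite) space \<Rightarrow> real) \<Rightarrow> 'm space \<Rightarrow> real" where
  "normal_deriv u x = snd (upper_gradient u x)"

definition free_boundary :: "(('m::finite) space \<Rightarrow> real) \<Rightarrow> 'm space set" where
  "free_boundary u = (top_of_set thin_ball) frontier_of {x \<in> thin_ball. u x = 0}"

text \<open>
  The class \<open>S\<^sub>k(M)\<close>.  Membership only depends on the values of \<open>u\<close> on \<open>B\<^sub>1\<^sup>+ \<union> B\<^sub>1'\<close>; the even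
  extension to \<open>B\<^sub>1\<close> is \<open>even_ext u\<close> below.
\<close>

definition solution_class :: "nat \<Rightarrow> real \<Rightarrow> (('m::finite) space \<Rightarrow> real) set" where
  "solution_class k M = {u.
     (\<exists>\<alpha>. 0 < \<alpha> \<and> \<alpha> < 1 \<and> C1_Hoelder \<alpha> u) \<and>
     (\<exists>f. weak_laplacian half_ball u f \<and>
          (AE x in lebesgue. x \<in> half_ball \<longrightarrow> \<bar>f x\<bar> \<le> M * norm (fst x) ^ (k - 1))) \<and>
     (\<forall>x\<in>thin_ball. 0 \<le> u x \<and> 0 \<le> - normal_deriv u x \<and> u x * normal_deriv u x = 0) \<and>
     0 \<in> free_boundary u \<and>
     C1_norm u \<le> ennreal M}"

definition even_ext :: "(('m::finite) space \<Rightarrow> real) \<Rightarrow> 'm space \<Rightarrow> real" where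
  "even_ext u x = u (fst x, \<bar>snd x\<bar>)"


section \<open>Integrals over spheres\<close>

text \<open>
  Surface measure on the unit sphere, \<open>\<sigma>(E) = n \<cdot> vol {t \<omega> | 0 < t < 1, \<omega> \<in> E}\<close>, written as the
  image of \<open>n\<close> times Lebesgue measure on the unit ball under \<open>x \<mapsto> x / |x|\<close>.  This is the measure
  for which integration in polar coordinates holds with density \<open>r\<^sup>n\<^sup>-\<^sup>1\<close>.
\<close>

definition surface_measure :: "'a::euclidean_space measure" where
  "surface_measure =
     distr (density lborel (\<lambda>x. ennreal (real DIM('a)) * indicator (ball 0 1) x)) borel sgn"

definition sphere_integral :: "real \<Rightarrow> ('a::euclidean_space \<Rightarrow> real) \<Rightarrow> real" where
  "sphere_integral r f =
     r ^ (DIM('a) - 1) * (LINT \<omega>:sphere 0 1|surface_measure. f (r *\<^sub>R \<omega>))"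


section \<open>Frequency\<close>

definition height :: "(('m::finite) space \<Rightarrow> real) \<Rightarrow> real \<Rightarrow> real" where
  "height u r = sphere_integral r (\<lambda>x. (even_ext u x)\<^sup>2)"

definition frequency :: "nat \<Rightarrow> real \<Rightarrow> (('m::finite) space \<Rightarrow> real) \<Rightarrow> real \<Rightarrow> real" where
  "frequency k C u r =
     (r + C * r\<^sup>2) * deriv (\<lambda>s. ln (max (height u s) (s ^ (DIM('m space) - 1 + 2 * k)))) r"

text \<open>
  The logarithmic derivative need only exist for almost every radius, so monotonicity and the
  limit at \<open>0+\<close> are taken off a null set.
\<close>

definition ess_mono_on :: "real set \<Rightarrow> (real \<Rightarrow> real) \<Rightarrow> bool" where
  "ess_mono_on I f \<longleftrightarrow> (\<exists>N. negligible N \<and> mono_on (I - N) f)"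

definition ess_right_limit :: "(real \<Rightarrow> real) \<Rightarrow> real \<Rightarrow> real \<Rightarrow> bool" where
  "ess_right_limit f a l \<longleftrightarrow> (\<exists>N. negligible N \<and> (f \<longlongrightarrow> l) (at a within ({a<..} - N)))"

text \<open>
  \<open>0 \<in> \<Gamma>\<^sub>\<kappa>\<^sup>(\<^sup>k\<^sup>)(u)\<close>.  The limit does not depend on \<open>C\<close>, so any \<open>C\<close> making the frequency of \<open>u\<close>
  monotone near \<open>0\<close> is allowed, in particular one depending only on the bound \<open>M\<close>.
\<close>

definition origin_in_Gamma :: "nat \<Rightarrow> real \<Rightarrow> (('m::finite) space \<Rightarrow> real) \<Rightarrow> bool" where
  "origin_in_Gamma k \<kappa> u \<longleftrightarrow>
     (\<exists>C>0. (\<exists>r\<^sub>0>0. ess_mono_on {0<..<r\<^sub>0} (frequency k C u)) \<and>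
        ess_right_limit (frequency k C u) 0 (real DIM('m space) - 1 + 2 * \<kappa>))"


section \<open>Weiss functional\<close>

definition weiss :: "real \<Rightarrow> (('m::finite) space \<Rightarrow> real) \<Rightarrow> real \<Rightarrow> real" where
  "weiss \<kappa> u r =
     1 / r powr (real DIM('m space) - 2 + 2 * \<kappa>) *
       (LINT x:ball 0 r|lebesgue. (norm (gradient (even_ext u) x))\<^sup>2) -
     \<kappa> / r powr (real DIM('m space) - 1 + 2 * \<kappa>) *
       sphere_integral r (\<lambda>x. (even_ext u x)\<^sup>2)"

end

theory Submission
  imports Defs
begin

text \<open>
  Write \<open>D\<close>, \<open>h\<close> for the Dirichlet energy on \<open>B\<^sub>r\<close> and the mean square of \<open>u\<close> on its boundary. Two relations are
  needed: \<open>D + \<integral> u \<Delta>u = \<integral> u u\<^sub>\<nu>\<close>, and the Rellich inequality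
  \<open>r D' \<ge> (n - 2) D + 2 r \<integral> u\<^sub>\<nu>\<^sup>2 - 2 \<integral> (x \<bullet> \<nabla>u) \<Delta>u\<close>. Both follow by testing the equation with a cutoff times
  \<open>u\<close>, respectively times \<open>u (l x) - u x\<close> for \<open>l \<down> 1\<close>; the boundary term on the thin ball has the right sign because
  \<open>u \<ge> 0\<close> and \<open>- \<partial>\<^sub>n u \<ge> 0\<close>. They give
  \<open>W' \<ge> 2 r\<^sup>-\<^sup>(\<^sup>n\<^sup>-\<^sup>2\<^sup>+\<^sup>2\<^sup>\<kappa>\<^sup>) (\<integral> (u\<^sub>\<nu> - \<kappa> u / r)\<^sup>2 - r\<^sup>-\<^sup>1 \<integral> (x \<bullet> \<nabla>u - \<kappa> u) \<Delta>u)\<close>,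
  and since \<open>|\<Delta>u| \<le> M r\<^sup>k\<^sup>-\<^sup>1\<close> it remains to bound \<open>h\<close> and \<open>r\<^sup>2\<^sup>-\<^sup>n D\<close> by \<open>C r\<^sup>2\<^sup>\<kappa>\<close> with \<open>C\<close> depending on \<open>M\<close> only. The
  constant in the definition of the frequency may depend on \<open>u\<close>, so only the limit \<open>\<kappa>\<close> is taken from it: the
  quotient \<open>N = r\<^sup>2\<^sup>-\<^sup>n D / h\<close> satisfies \<open>N' \<ge> - C (1 + N)\<close> wherever \<open>h > r\<^sup>2\<^sup>k\<close>, whence \<open>N \<ge> \<kappa> - C r\<close> there, and
  integrating \<open>r h' / h \<approx> 2 N\<close> gives the bound on \<open>h\<close>.
\<close>

section \<open>The differential inequalities for the frequency\<close>

text \<open>Two features shape the argument. The gradient of \<open>u\<close> is continuous up to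
  the thin ball, so ball and sphere averages are differentiable at every positive radius;
  exceptional null sets enter only when the limit of the frequency is read off. And every constant
  has to serve the whole class: the part about differential inequalities is therefore an abstract
  system with a single constant \<open>c\<close>, for which the equation supplies a value made of
  the dimension and \<open>M\<close>. The source term is at first bounded by the supremum of
  \<open>h\<close> over smaller radii, not by \<open>h\<close> at the radius itself. Since
  \<open>d\<close> is nonnegative, \<open>h\<close> can fall only slowly as the radius grows, which
  turns the supremum into \<open>h s + s ^ (2 * k)\<close>. Where \<open>h\<close> dominates
  \<open>s ^ (2 * k)\<close>, the errors are then relative ones of size \<open>s\<close>; where it
  does not, the bound wanted for \<open>h\<close> is immediate from \<open>\<kappa> \<le> k\<close>.
  The growth of \<open>d\<close> comes from that of \<open>h\<close> by a mean value argument,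
  without an upper bound on \<open>d / h\<close>.\<close>

text \<open>
  Scale invariant quantities on the spheres of radius \<open>s\<close>: up to the factors that make them invariant, \<open>h\<close> is
  the height, \<open>d\<close> the Dirichlet energy, \<open>e\<close> the integral of \<open>u \<Delta>u\<close> over the ball, and \<open>a\<close> the integral of the
  squared radial derivative over the sphere. The frequency is \<open>d / h\<close>, up to the error \<open>e / h\<close>; the last
  assumption is all that is used of the condition on its limit at \<open>0+\<close>.
\<close>

locale frequency_system =
  fixes h d d' e a :: "real \<Rightarrow> real" and k :: nat and c \<kappa> :: real
  assumes c: "1 \<le> c"
    and h_cont: "continuous_on {0..<1} h" and h_0: "h 0 = 0"
    and h_nonneg: "\<And>s. 0 \<le> s \<Longrightarrow> s < 1 \<Longrightarrow> 0 \<le> h s"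
    and h_le: "\<And>s. 0 \<le> s \<Longrightarrow> s < 1 \<Longrightarrow> h s \<le> c"
    and DERIV_h: "\<And>s. 0 < s \<Longrightarrow> s < 1 \<Longrightarrow> (h has_real_derivative 2 * (d s + e s) / s) (at s)"
    and DERIV_d: "\<And>s. 0 < s \<Longrightarrow> s < 1 \<Longrightarrow> (d has_real_derivative d' s) (at s)"
    and d_nonneg: "\<And>s. 0 < s \<Longrightarrow> s < 1 \<Longrightarrow> 0 \<le> d s"
    and d'_ge: "\<And>s. 0 < s \<Longrightarrow> s < 1 \<Longrightarrow> 2 * a s - c * s * (s ^ (2 * k) + d s) \<le> s * d' s"
    and e_le: "\<And>s m. 0 < s \<Longrightarrow> s < 1 \<Longrightarrow> (\<And>t. 0 < t \<Longrightarrow> t \<le> s \<Longrightarrow> h t \<le> m) \<Longrightarrow>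
        \<bar>e s\<bar> \<le> c * s * (m + s ^ (2 * k))"
    and quad: "\<And>s y. 0 < s \<Longrightarrow> s < 1 \<Longrightarrow> 0 \<le> a s - 2 * y * (d s + e s) + y\<^sup>2 * h s"
    and d_doubling: "\<And>r s. 0 < r \<Longrightarrow> r \<le> s \<Longrightarrow> s \<le> 2 * r \<Longrightarrow> s < 1 \<Longrightarrow> d r \<le> c * d s"
    and \<kappa>_le: "\<kappa> \<le> real k"
    and freq: "\<And>\<eta> \<rho>. 0 < \<eta> \<Longrightarrow> 0 < \<rho> \<Longrightarrow>
        (\<exists>s. 0 < s \<and> s < \<rho> \<and> s ^ (2 * k) < h s \<and> \<bar>(d s + e s) / h s - \<kappa>\<bar> \<le> \<eta>) \<or>
        (\<kappa> = real k \<and> (\<exists>s. 0 < s \<and> s < \<rho> \<and> h s \<le> s ^ (2 * k)))"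
begin

section \<open>Absorbing the error term; almost monotonicity of the quotient d / h\<close>

definition r1 :: real where "r1 = 1 / (4 * c)"

text \<open>The factor 4 makes the error cost at most half of the maximum of \<open>h\<close> in
  \<open>h_le_max\<close>, and keeps \<open>\<bar>e s\<bar> / h s\<close> below 1 in
  \<open>freq_mono\<close>.\<close>

lemma r1: "0 < r1" "r1 < 1" "0 \<le> s \<Longrightarrow> s \<le> r1 \<Longrightarrow> 4 * c * s \<le> 1"
  using c by (auto simp: r1_def field_simps)

text \<open>Let \<open>h\<close> attain its maximum over \<open>[0, s]\<close> at \<open>u\<close>.
  From \<open>u\<close> to \<open>s\<close> it can drop only through \<open>e\<close>, because
  \<open>d\<close> is nonnegative, and at a rate of at most
  \<open>2 * c * (h u + s ^ (2 * k))\<close>; over a length at most \<open>r1\<close> this loses at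
  most half of \<open>h u + s ^ (2 * k)\<close>.\<close>

lemma h_le_max:
  assumes "0 < s" "s \<le> r1" "0 \<le> t" "t \<le> s"
  shows "h t \<le> 2 * h s + s ^ (2 * k)"
proof -
  have "continuous_on {0..s} h" by (rule continuous_on_subset[OF h_cont]) (use assms r1 in auto)
  then obtain u where u: "0 \<le> u" "u \<le> s" and max: "\<And>t. 0 \<le> t \<Longrightarrow> t \<le> s \<Longrightarrow> h t \<le> h u"
    using continuous_attains_sup[of "{0..s}" h] assms by auto
  have cs: "4 * c * s \<le> 1" using assms r1 by auto
  have "h u \<le> 2 * h s + s ^ (2 * k)"
  proof (cases "u = s")
    case True
    then show ?thesis using h_nonneg[of s] assms r1 by auto
  next
    case False
    then have us: "u < s" using u by simp
    have "\<exists>\<xi>>u. \<xi> < s \<and> h s - h u = (s - u) * (2 * (d \<xi> + e \<xi>) / \<xi>)"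
    \<comment> \<open>At 0 \<open>h\<close> is only continuous, so the form of the mean value
      theorem that asks for derivatives on the closed interval does not apply there.\<close>
    proof (cases "u = 0")
      case True
      have "\<exists>l z. u < z \<and> z < s \<and> (h has_real_derivative l) (at z) \<and> h s - h u = (s - u) * l"
      proof (rule MVT[OF us])
        show "continuous_on {u..s} h" by (rule continuous_on_subset[OF h_cont]) (use assms u r1 in auto)
        show "h differentiable at x" if "u < x" "x < s" for x
          using DERIV_h[of x] that u assms r1 by (auto simp: real_differentiable_def)
      qed
      then obtain l z where z: "u < z" "z < s" "(h has_real_derivative l) (at z)" "h s - h u = (s - u) * l"
        by auto
      moreover have "l = 2 * (d z + e z) / z"
        by (rule DERIV_unique[OF z(3) DERIV_h]) (use z u assms r1 in auto)
      ultimately show ?thesis by auto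
    next
      case False
      then show ?thesis using MVT2[OF us, of h "\<lambda>x. 2 * (d x + e x) / x"] DERIV_h u assms r1 by force
    qed
    then obtain \<xi> where \<xi>: "u < \<xi>" "\<xi> < s" "h s - h u = (s - u) * (2 * (d \<xi> + e \<xi>) / \<xi>)" by auto
    have hu: "0 \<le> h u" using h_nonneg u assms r1 by auto
    have "\<bar>e \<xi>\<bar> \<le> c * \<xi> * (h u + \<xi> ^ (2 * k))"
      by (rule e_le) (use \<xi> u assms r1 in \<open>auto intro: max\<close>)
    also have "\<dots> \<le> c * \<xi> * (h u + s ^ (2 * k))"
      using \<xi> u c by (intro mult_left_mono add_left_mono power_mono) auto
    finally have e\<xi>: "\<bar>e \<xi>\<bar> \<le> c * \<xi> * (h u + s ^ (2 * k))" .
    have "- (c * \<xi> * (h u + s ^ (2 * k))) \<le> d \<xi> + e \<xi>"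
      using e\<xi> d_nonneg[of \<xi>] \<xi> u assms r1 by auto
    then have "- (c * (h u + s ^ (2 * k))) \<le> (d \<xi> + e \<xi>) / \<xi>"
      using \<xi> u by (simp add: field_simps)
    then have "2 * - (c * (h u + s ^ (2 * k))) \<le> 2 * (d \<xi> + e \<xi>) / \<xi>"
      unfolding times_divide_eq_right[symmetric] by (intro mult_left_mono) auto
    then have "(s - u) * (2 * - (c * (h u + s ^ (2 * k)))) \<le> h s - h u"
      unfolding \<xi>(3) using us by (intro mult_left_mono) auto
    moreover have "(s - u) * (2 * - (c * (h u + s ^ (2 * k)))) =
        u * (2 * (c * (h u + s ^ (2 * k)))) - 2 * (c * s * (h u + s ^ (2 * k)))"
      by (simp add: algebra_simps)
    moreover have "0 \<le> u * (2 * (c * (h u + s ^ (2 * k))))" using u hu c assms by auto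
    moreover have "4 * (c * s * (h u + s ^ (2 * k))) \<le> h u + s ^ (2 * k)"
      using mult_right_mono[OF cs, of "h u + s ^ (2 * k)"] hu assms by (simp add: mult.assoc)
    ultimately show ?thesis by linarith
  qed
  then show ?thesis using max[OF assms(3,4)] by simp
qed

text \<open>Trades the supremum of \<open>h\<close> in \<open>e_le\<close> for the value at
  \<open>s\<close> itself, as the differential inequality for \<open>d / h\<close> requires.\<close>

lemma e_le_h:
  assumes "0 < s" "s \<le> r1"
  shows "\<bar>e s\<bar> \<le> 2 * c * s * (h s + s ^ (2 * k))"
proof -
  have "\<bar>e s\<bar> \<le> c * s * ((2 * h s + s ^ (2 * k)) + s ^ (2 * k))"
    by (rule e_le) (use assms r1 in \<open>auto intro!: h_le_max\<close>)
  then show ?thesis by (simp add: algebra_simps)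
qed

lemma e_le_h':
  assumes "0 < s" "s \<le> r1" "s ^ (2 * k) \<le> h s"
  shows "\<bar>e s\<bar> / h s \<le> 4 * c * s" "0 < h s"
proof -
  show h: "0 < h s" using assms by (smt (verit) zero_less_power)
  have "2 * c * s * (h s + s ^ (2 * k)) \<le> 2 * c * s * (h s + h s)"
    using assms c by (intro mult_left_mono) auto
  then show "\<bar>e s\<bar> / h s \<le> 4 * c * s"
    using e_le_h[OF assms(1,2)] h by (simp add: field_simps)
qed

text \<open>With \<open>N = d / h\<close> and \<open>\<epsilon> = e / h\<close> one gets \<open>s *
  N' \<ge> 2 * (N + \<epsilon>)^2 - 2 * N * (N + \<epsilon>) - c * s * (1 + N)\<close>. The
  quadratic terms cancel up to \<open>2 * \<epsilon> * (N + \<epsilon>)\<close>, which is of order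
  \<open>s * (1 + N)\<close>; hence \<open>N' \<ge> - 9 * c * (1 + N)\<close>, and the exponential
  is the integrating factor.\<close>

lemma freq_mono:
  assumes pq: "0 < p" "p \<le> q" "q \<le> r1" and H: "\<And>s. p \<le> s \<Longrightarrow> s \<le> q \<Longrightarrow> s ^ (2 * k) \<le> h s"
  shows "(1 + d p / h p) * exp (9 * c * p) \<le> (1 + d q / h q) * exp (9 * c * q)"
proof (rule DERIV_nonneg_imp_nondecreasing[OF pq(2)])
  fix s assume s: "p \<le> s" "s \<le> q"
  have s0: "0 < s" "s < 1" "s \<le> r1" using s pq r1 by auto
  note eh = e_le_h'[OF s0(1,3) H[OF s]]
  define N where "N = d s / h s"
  define \<epsilon> where "\<epsilon> = e s / h s"
  have N: "0 \<le> N" using d_nonneg s0 eh by (simp add: N_def)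
  have "\<bar>e s\<bar> / h s \<le> 1" using eh(1) r1(3)[of s] s0 by linarith
  then have \<epsilon>: "\<bar>\<epsilon>\<bar> \<le> 4 * c * s" "\<bar>\<epsilon>\<bar> \<le> 1"
    using eh by (simp_all add: \<epsilon>_def abs_divide)
  have ds: "d s = N * h s" "e s = \<epsilon> * h s" using eh by (auto simp: N_def \<epsilon>_def)
  define D where "D = (d' s * h s - d s * (2 * (d s + e s) / s)) / (h s * h s)"
  have 1: "((\<lambda>s. d s / h s) has_real_derivative D) (at s)"
    unfolding D_def using DERIV_d[OF s0(1,2)] DERIV_h[OF s0(1,2)] eh by (intro DERIV_divide) auto
  \<comment> \<open>The value \<open>N + \<epsilon>\<close> minimises the quadratic in
    \<open>y\<close>, so this is the Cauchy-Schwarz inequality on the sphere.\<close>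
  have a: "(N + \<epsilon>)\<^sup>2 * h s \<le> a s"
    using quad[of s "N + \<epsilon>"] s0 unfolding ds by (simp add: algebra_simps power2_eq_square)
  have "2 * (N + \<epsilon>)\<^sup>2 * h s - c * s * (h s + N * h s) \<le> 2 * a s - c * s * (s ^ (2 * k) + d s)"
    unfolding ds using H[OF s] c s0 a by (auto intro!: diff_mono mult_left_mono)
  also have "\<dots> \<le> s * d' s" by (rule d'_ge) (use s0 in auto)
  finally have d': "2 * (N + \<epsilon>)\<^sup>2 - c * s * (1 + N) \<le> s * d' s / h s"
    using eh by (simp add: field_simps)
  have "s * D = s * d' s / h s - 2 * N * (N + \<epsilon>)"
    unfolding D_def ds using eh s0 by (simp add: field_simps power2_eq_square)
  then have "2 * \<epsilon> * (N + \<epsilon>) - c * s * (1 + N) \<le> s * D"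
    using d' by (simp add: algebra_simps power2_eq_square)
  \<comment> \<open>The outer \<open>\<epsilon>\<close> is bounded by \<open>4 * c * s\<close>, the
    inner one by 1; the resulting 8 and the \<open>c\<close> from \<open>d'_ge\<close> make the
    9.\<close>
  moreover have "- (8 * c * s * (1 + N)) \<le> 2 * \<epsilon> * (N + \<epsilon>)"
  proof -
    have "\<bar>\<epsilon> * (N + \<epsilon>)\<bar> \<le> (4 * c * s) * (N + 1)"
      unfolding abs_mult using \<epsilon> N c s0 by (intro mult_mono) auto
    then show ?thesis by (simp add: algebra_simps abs_le_iff)
  qed
  ultimately have "s * (- 9 * c * (1 + N)) \<le> s * D" by (simp add: algebra_simps)
  then have "- 9 * c * (1 + N) \<le> D" using s0(1) by (rule mult_left_le_imp_le)
  then have "0 \<le> (D + 9 * c * (1 + N)) * exp (9 * c * s)" by simp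
  moreover have "((\<lambda>s. (1 + d s / h s) * exp (9 * c * s)) has_real_derivative
      (D + 9 * c * (1 + N)) * exp (9 * c * s)) (at s)"
    by (rule derivative_eq_intros 1 refl)+ (simp add: N_def algebra_simps)
  ultimately show "\<exists>y. ((\<lambda>s. (1 + d s / h s) * exp (9 * c * s)) has_real_derivative y) (at s) \<and> 0 \<le> y"
    by blast
qed

text \<open>Where the quotient is close to \<open>\<kappa>\<close> it is at least
  \<open>- \<bar>e s\<bar> / h s\<close>, which tends to 0 with \<open>s\<close>; in the other
  alternative \<open>\<kappa>\<close> is the natural number \<open>k\<close>.\<close>

lemma \<kappa>_nonneg: "0 \<le> \<kappa>"
proof (rule field_le_epsilon)
  fix \<eta> :: real assume \<eta>: "0 < \<eta>"
  define \<rho> where "\<rho> = min r1 (\<eta> / (8 * c))"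
  have \<rho>: "0 < \<rho>" using r1 \<eta> c by (simp add: \<rho>_def)
  from freq[of "\<eta> / 2" \<rho>] \<eta> \<rho>
  consider s where "0 < s" "s < \<rho>" "s ^ (2 * k) < h s" "\<bar>(d s + e s) / h s - \<kappa>\<bar> \<le> \<eta> / 2" | "\<kappa> = real k"
    by auto
  then show "0 \<le> \<kappa> + \<eta>"
  proof cases
    case (1 s)
    have eh: "\<bar>e s\<bar> / h s \<le> 4 * c * s" "0 < h s" using e_le_h'[of s] 1 by (auto simp: \<rho>_def)
    have "4 * c * s \<le> \<eta> / 2" using 1 c by (simp add: \<rho>_def field_simps)
    moreover have "- (\<bar>e s\<bar> / h s) \<le> (d s + e s) / h s"
      using eh d_nonneg[of s] 1 r1 by (simp add: field_simps \<rho>_def)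
    ultimately show ?thesis using eh(1) 1(4) by linarith
  qed (use \<eta> in auto)
qed

text \<open>
  The set where \<open>h s > s ^ (2 * k)\<close> either reaches \<open>0\<close>, where the frequency tends to \<open>\<kappa>\<close>, or has a left end
  point \<open>p > 0\<close>, where the graphs of \<open>h\<close> and \<open>s ^ (2 * k)\<close> cross and the frequency is about \<open>k \<ge> \<kappa>\<close>.
\<close>

lemma freq_lower:
  assumes r: "0 < r" "r \<le> r1" and hr: "r ^ (2 * k) < h r"
  shows "1 + \<kappa> - 4 * c * r \<le> (1 + d r / h r) * exp (9 * c * r)"
proof (cases "\<exists>s. 0 < s \<and> s \<le> r \<and> h s \<le> s ^ (2 * k)")
  case False
  have "1 + \<kappa> \<le> (1 + d r / h r) * exp (9 * c * r)"
  proof (rule field_le_epsilon)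
    fix \<eta> :: real assume \<eta>: "0 < \<eta>"
    define \<rho> where "\<rho> = min r (\<eta> / (8 * c))"
    have \<rho>: "0 < \<rho>" using r \<eta> c by (simp add: \<rho>_def)
    obtain s where s: "0 < s" "s < \<rho>" "s ^ (2 * k) < h s" "\<bar>(d s + e s) / h s - \<kappa>\<bar> \<le> \<eta> / 2"
      using freq[of "\<eta> / 2" \<rho>] \<eta> \<rho> False by (auto simp: \<rho>_def)
    have eh: "\<bar>e s\<bar> / h s \<le> 4 * c * s" "0 < h s" using e_le_h'[of s] s r by (auto simp: \<rho>_def)
    have "4 * c * s \<le> \<eta> / 2" using s c by (simp add: \<rho>_def field_simps)
    moreover have "(d s + e s) / h s \<le> d s / h s + \<bar>e s\<bar> / h s"
      using eh by (simp add: field_simps)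
    ultimately have "1 + \<kappa> \<le> (1 + d s / h s) + \<eta>" using s(4) eh by linarith
    also have "1 + d s / h s \<le> (1 + d s / h s) * exp (9 * c * s)"
      using mult_left_mono[of 1 "exp (9 * c * s)" "1 + d s / h s"] eh d_nonneg[of s] s r r1 c
      by (simp add: \<rho>_def)
    also have "\<dots> \<le> (1 + d r / h r) * exp (9 * c * r)"
    proof (rule freq_mono)
      show "t ^ (2 * k) \<le> h t" if "s \<le> t" "t \<le> r" for t
        using False that s by (smt (verit))
    qed (use s r in \<open>auto simp: \<rho>_def\<close>)
    finally show "1 + \<kappa> \<le> (1 + d r / h r) * exp (9 * c * r) + \<eta>" by simp
  qed
  then show ?thesis using r c by (smt (verit) mult_nonneg_nonneg)
next
  case True
  \<comment> \<open>The left end point is the maximum of this compact set. The assumption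
    \<open>hr\<close> keeps it away from \<open>r\<close>, and the case assumption keeps it away
    from 0, which always belongs to \<open>S\<close>.\<close>
  define S where "S = {s \<in> {0..r}. h s \<le> s ^ (2 * k)}"
  have "continuous_on {0..r} h" by (rule continuous_on_subset[OF h_cont]) (use r r1 in auto)
  then have "closed S" unfolding S_def
    by (intro continuous_on_closed_Collect_le continuous_intros) auto
  then have "compact S"
    by (rule compact_Int_closed[of "{0..r}", THEN back_subst[of compact], rotated]) (auto simp: S_def)
  moreover obtain s0 where s0: "0 < s0" "s0 \<in> S" using True by (auto simp: S_def)
  ultimately obtain p where p: "p \<in> S" and pmax: "\<And>s. s \<in> S \<Longrightarrow> s \<le> p"
    using compact_attains_sup[of S] by auto
  have p0: "0 < p" "p < r" "h p \<le> p ^ (2 * k)"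
    using p pmax[OF s0(2)] s0 hr by (auto simp: S_def order_le_less)
  have above: "s ^ (2 * k) < h s" if "p < s" "s \<le> r" for s
  proof (rule ccontr)
    assume "\<not> s ^ (2 * k) < h s"
    then have "s \<in> S" using that p0 by (auto simp: S_def)
    then show False using pmax[of s] that by auto
  qed
  define \<psi> where "\<psi> = (\<lambda>s. h s - s ^ (2 * k))"
  define l where "l = 2 * (d p + e p) / p - real (2 * k) * p ^ (2 * k - 1)"
  have D\<psi>: "(\<psi> has_real_derivative l) (at p)"
    unfolding \<psi>_def l_def
    by (rule derivative_eq_intros DERIV_h refl | use p0 r r1 in simp)+
  have \<psi>p: "\<psi> p = 0"
  proof (rule ccontr)
    assume "\<psi> p \<noteq> 0"
    then have "\<psi> p < 0" using p0 by (simp add: \<psi>_def)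
    moreover have "(\<psi> \<longlongrightarrow> \<psi> p) (at_right p)"
      using DERIV_isCont[OF D\<psi>] by (auto simp: isCont_def intro: tendsto_within_subset)
    ultimately have "\<forall>\<^sub>F s in at_right p. \<psi> s < 0" by (rule order_tendstoD(2)[rotated])
    moreover have "\<forall>\<^sub>F s in at_right p. p < s \<and> s < r"
      using p0 by (auto simp: eventually_at_right)
    ultimately have "\<forall>\<^sub>F s in at_right p. False"
      by eventually_elim (use above in \<open>force simp: \<psi>_def\<close>)
    then show False by simp
  qed
  \<comment> \<open>\<open>\<psi>\<close> vanishes at \<open>p\<close> and is positive to the right
    of it, so its slope there is nonnegative. At \<open>h p = p ^ (2 * k)\<close> this says that
    \<open>(d p + e p) / h p\<close> is at least \<open>k\<close>.\<close>
  have "0 \<le> l"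
  proof (rule ccontr)
    assume "\<not> 0 \<le> l"
    then obtain \<delta> where \<delta>: "0 < \<delta>" "\<And>t. 0 < t \<Longrightarrow> t < \<delta> \<Longrightarrow> \<psi> (p + t) < \<psi> p"
      using DERIV_neg_dec_right[OF D\<psi>] by force
    define t where "t = min (\<delta> / 2) (r - p)"
    have "\<psi> (p + t) < 0" "0 < \<psi> (p + t)"
      using \<delta>(2)[of t] above[of "p + t"] p0 \<delta>(1) \<psi>p by (auto simp: t_def \<psi>_def)
    then show False by simp
  qed
  then have "p * (real (2 * k) * p ^ (2 * k - 1)) \<le> 2 * (d p + e p)"
    using p0 by (simp add: l_def field_simps)
  \<comment> \<open>For \<open>k = 0\<close> the exponent \<open>2 * k - 1\<close> is truncated to
    0, which is harmless next to the factor \<open>2 * k = 0\<close>.\<close>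
  moreover have "p * (real (2 * k) * p ^ (2 * k - 1)) = 2 * (real k * p ^ (2 * k))"
    by (cases k) auto
  ultimately have "2 * (real k * p ^ (2 * k)) \<le> 2 * (d p + e p)" by (simp only:)
  then have "real k * p ^ (2 * k) \<le> d p + e p" by (rule mult_left_le_imp_le) simp
  moreover have hp: "h p = p ^ (2 * k)" using \<psi>p by (simp add: \<psi>_def)
  ultimately have "real k \<le> (d p + e p) / h p" using p0 by (simp add: field_simps)
  moreover have eh: "\<bar>e p\<bar> / h p \<le> 4 * c * p" "0 < h p" using e_le_h'[of p] p0 r hp by auto
  moreover have "(d p + e p) / h p \<le> d p / h p + \<bar>e p\<bar> / h p"
    using eh by (simp add: field_simps)
  ultimately have "real k \<le> d p / h p + 4 * c * p" by linarith
  moreover have "4 * c * p \<le> 4 * c * r" using p0 c by simp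
  ultimately have "1 + \<kappa> - 4 * c * r \<le> 1 + d p / h p" using \<kappa>_le by linarith
  also have "\<dots> \<le> (1 + d p / h p) * exp (9 * c * p)"
    using mult_left_mono[of 1 "exp (9 * c * p)" "1 + d p / h p"] eh d_nonneg[of p] p0 r r1 c
    by simp
  also have "\<dots> \<le> (1 + d r / h r) * exp (9 * c * r)"
  proof (rule freq_mono)
    show "t ^ (2 * k) \<le> h t" if "p \<le> t" "t \<le> r" for t
      using above[of t] that hp by (cases "t = p") auto
  qed (use p0 r in auto)
  finally show ?thesis .
qed

section \<open>Growth of h and d at the origin\<close>

definition C1 :: real where "C1 = (17 + 9 * real k) * c"

text \<open>Divided by \<open>h r\<close> this bounds half the derivative of \<open>ln h\<close>
  with respect to \<open>ln r\<close> from below. In \<open>C1\<close>, \<open>4 * c\<close> comes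
  from \<open>freq_lower\<close>, \<open>9 * c * (1 + k)\<close> from replacing
  \<open>exp (- (9 * c * r))\<close> by its tangent at 0, and another \<open>4 * c\<close> from
  \<open>e / h\<close>.\<close>

lemma log_derivative_lower:
  assumes r: "0 < r" "r \<le> r1" and hr: "r ^ (2 * k) < h r"
  shows "(\<kappa> - C1 * r) * h r \<le> d r + e r"
proof -
  define N where "N = d r / h r"
  have eh: "\<bar>e r\<bar> / h r \<le> 4 * c * r" "0 < h r" using e_le_h'[of r] r hr by auto
  have cr: "0 \<le> 4 * c * r" "4 * c * r \<le> 1" using c r r1 by auto
  define A where "A = 1 + \<kappa> - 4 * c * r"
  have A: "0 \<le> A" "A \<le> 1 + real k" using cr \<kappa>_nonneg \<kappa>_le by (auto simp: A_def)
  have "A * (1 - 9 * c * r) \<le> A * exp (- (9 * c * r))"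
    using exp_ge_add_one_self[of "- (9 * c * r)"] A by (intro mult_left_mono) auto
  also have "\<dots> \<le> ((1 + N) * exp (9 * c * r)) * exp (- (9 * c * r))"
    using freq_lower[OF assms] by (intro mult_right_mono) (auto simp: A_def N_def)
  also have "\<dots> = 1 + N" by (simp add: exp_minus)
  finally have "A - A * (9 * c * r) \<le> 1 + N" by (simp add: algebra_simps)
  moreover have "A * (9 * c * r) \<le> (1 + real k) * (9 * c * r)"
    using A cr by (intro mult_right_mono) auto
  ultimately have "\<kappa> - 4 * c * r - (1 + real k) * (9 * c * r) \<le> N" by (simp add: A_def)
  moreover have "- (4 * c * r) \<le> e r / h r"
    using eh by (smt (verit) abs_divide abs_if)
  ultimately have "\<kappa> - C1 * r \<le> N + e r / h r" by (simp add: C1_def algebra_simps)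
  then show ?thesis using eh(2) by (simp add: N_def field_simps)
qed

text \<open>The bracket covers both kinds of end point in \<open>h_growth\<close>: the 1 serves
  where \<open>h q \<le> q ^ (2 * k)\<close>, and \<open>c * r1 powr (- 2 * real k)\<close> serves
  at \<open>q = r1\<close>, where the bound is \<open>h \<le> c\<close>. The exponential is the
  integrating factor over radii below 1.\<close>

definition C2 :: real where "C2 = exp (2 * C1) * (1 + c * r1 powr (- 2 * real k))"

lemma C1_nonneg: "0 \<le> C1" using c by (simp add: C1_def)

lemma C2_ge: "1 \<le> C2"
proof -
  have "1 * 1 \<le> C2" unfolding C2_def
    by (rule mult_mono) (use C1_nonneg c in auto)
  then show ?thesis by simp
qed

text \<open>This is how \<open>\<kappa> \<le> k\<close> enters the growth bounds: the threshold
  \<open>s ^ (2 * k)\<close> does not exceed the order to be proved.\<close>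

lemma pow_le_powr: "0 < s \<Longrightarrow> s < 1 \<Longrightarrow> s ^ (2 * k) \<le> s powr (2 * \<kappa>)"
  using powr_mono'[of "2 * \<kappa>" "2 * real k" s] \<kappa>_le powr_realpow[of s "2 * k"] by simp

text \<open>A lower bound on the frequency, integrated inwards, bounds \<open>h\<close> from above:
  \<open>h s * s powr (- 2 * \<kappa>) * exp (2 * C1 * s)\<close> is nondecreasing as long as
  \<open>h\<close> stays above the threshold. So its value at \<open>r\<close> is at most that at
  the first \<open>q > r\<close> where \<open>h\<close> falls to the threshold, or at
  \<open>r1\<close> if there is none.\<close>

lemma h_growth:
  assumes r: "0 < r" "r < r1"
  shows "h r \<le> C2 * r powr (2 * \<kappa>)"
proof (cases "r ^ (2 * k) < h r")
  case False
  then have "h r \<le> 1 * r powr (2 * \<kappa>)" using pow_le_powr[of r] r r1 by simp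
  also have "\<dots> \<le> C2 * r powr (2 * \<kappa>)" using C2_ge by (intro mult_right_mono) auto
  finally show ?thesis .
next
  case True
  have "\<exists>q. r < q \<and> q \<le> r1 \<and> (\<forall>s. r < s \<and> s < q \<longrightarrow> s ^ (2 * k) < h s) \<and>
      h q \<le> (1 + c * r1 powr (- 2 * real k)) * q powr (2 * \<kappa>)"
  proof (cases "\<exists>s. r \<le> s \<and> s \<le> r1 \<and> h s \<le> s ^ (2 * k)")
    case False
    have "h r1 \<le> c" using h_le[of r1] r1 by simp
    also have "c \<le> c * (r1 powr (- 2 * real k) * r1 powr (2 * \<kappa>))"
      using r1 c \<kappa>_le powr_mono'[of "2 * \<kappa> - 2 * real k" 0 r1] by (simp add: powr_add[symmetric])
    also have "\<dots> \<le> (1 + c * r1 powr (- 2 * real k)) * r1 powr (2 * \<kappa>)"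
      by (simp add: algebra_simps)
    finally have hr1: "h r1 \<le> (1 + c * r1 powr (- 2 * real k)) * r1 powr (2 * \<kappa>)" .
    have "s ^ (2 * k) < h s" if "r < s" "s < r1" for s
      using False that by (meson less_imp_le not_le)
    with hr1 show ?thesis using r by blast
  next
    case ex: True
    define S where "S = {s \<in> {r..r1}. h s \<le> s ^ (2 * k)}"
    have "continuous_on {r..r1} h" by (rule continuous_on_subset[OF h_cont]) (use r r1 in auto)
    then have "closed S" unfolding S_def
      by (intro continuous_on_closed_Collect_le continuous_intros) auto
    then have "compact S"
      by (rule compact_Int_closed[of "{r..r1}", THEN back_subst[of compact], rotated]) (auto simp: S_def)
    moreover have "S \<noteq> {}" using ex by (auto simp: S_def)
    ultimately obtain q where q: "q \<in> S" and qmin: "\<And>s. s \<in> S \<Longrightarrow> q \<le> s"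
      using compact_attains_inf[of S] by auto
    have "r \<noteq> q" using q True by (auto simp: S_def)
    then have q0: "r < q" "q \<le> r1" "h q \<le> q ^ (2 * k)" using q by (auto simp: S_def)
    have "h q \<le> 1 * q powr (2 * \<kappa>)" using q0 pow_le_powr[of q] r r1 by simp
    also have "\<dots> \<le> (1 + c * r1 powr (- 2 * real k)) * q powr (2 * \<kappa>)"
      using c by (intro mult_right_mono) auto
    finally have hq: "h q \<le> (1 + c * r1 powr (- 2 * real k)) * q powr (2 * \<kappa>)" .
    have "s ^ (2 * k) < h s" if "r < s" "s < q" for s
    proof (rule ccontr)
      assume "\<not> s ^ (2 * k) < h s"
      then have "s \<in> S" using that q0 by (auto simp: S_def)
      then show False using qmin[of s] that by auto
    qed
    with hq q0 show ?thesis by blast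
  qed
  then obtain q where q: "r < q" "q \<le> r1" and above: "\<And>s. r < s \<Longrightarrow> s < q \<Longrightarrow> s ^ (2 * k) < h s"
    and hq: "h q \<le> (1 + c * r1 powr (- 2 * real k)) * q powr (2 * \<kappa>)" by blast
  define Z where "Z = (\<lambda>s. h s * s powr (- 2 * \<kappa>) * exp (2 * C1 * s))"
  define Z' where "Z' s = (2 * (d s + e s) / s - 2 * \<kappa> * h s / s + 2 * C1 * h s)
      * s powr (- 2 * \<kappa>) * exp (2 * C1 * s)" for s
  have DZ: "(Z has_real_derivative Z' s) (at s)" if "0 < s" "s < 1" for s
  proof -
    have "((\<lambda>s. s powr (- 2 * \<kappa>)) has_real_derivative - 2 * \<kappa> * s powr (- 2 * \<kappa> - 1)) (at s)"
      using that by (auto intro!: derivative_eq_intros)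
    moreover have "s powr (- 2 * \<kappa> - 1) = s powr (- 2 * \<kappa>) / s"
      using that by (simp add: powr_diff)
    ultimately have "((\<lambda>s. s powr (- 2 * \<kappa>)) has_real_derivative - 2 * \<kappa> * (s powr (- 2 * \<kappa>) / s)) (at s)"
      by simp
    from DERIV_mult[OF DERIV_mult[OF DERIV_h[OF that] this]
        DERIV_fun_exp[OF DERIV_cmult_Id[of "2 * C1"]]]
    show ?thesis unfolding Z_def Z'_def
      by (rule DERIV_cong) (use that in \<open>simp add: field_simps\<close>)
  qed
  have "Z r \<le> Z q"
  proof (rule DERIV_nonneg_imp_increasing_open[of r q Z])
    show "\<exists>y. (Z has_real_derivative y) (at s) \<and> 0 \<le> y" if s: "r < s" "s < q" for s
    proof -
      have s0: "0 < s" "s < 1" using s q r r1 by auto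
      have "(\<kappa> - C1 * s) * h s \<le> d s + e s"
        by (rule log_derivative_lower) (use s q r above in auto)
      then have "0 \<le> (2 / s) * (d s + e s - (\<kappa> - C1 * s) * h s)" using s0 by simp
      also have "\<dots> = 2 * (d s + e s) / s - 2 * \<kappa> * h s / s + 2 * C1 * h s"
        using s0 by (simp add: field_simps)
      finally have "0 \<le> Z' s" by (simp add: Z'_def)
      then show ?thesis using DZ[OF s0] by blast
    qed
    show "continuous_on {r..q} Z"
      using r q r1 by (intro DERIV_atLeastAtMost_imp_continuous_on) (force intro: DZ)
  qed (use q in simp)
  also have "Z q \<le> ((1 + c * r1 powr (- 2 * real k)) * q powr (2 * \<kappa>)) * q powr (- 2 * \<kappa>) * exp (2 * C1)"
    unfolding Z_def using hq c C1_nonneg q r r1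
    by (intro mult_mono) (auto intro: mult_left_le)
  also have "\<dots> = C2" using q r by (simp add: C2_def powr_add[symmetric])
  finally have "h r * r powr (- 2 * \<kappa>) * exp (2 * C1 * r) \<le> C2" by (simp add: Z_def)
  moreover have "h r * r powr (- 2 * \<kappa>) * 1 \<le> h r * r powr (- 2 * \<kappa>) * exp (2 * C1 * r)"
    using h_nonneg[of r] r r1 C1_nonneg by (intro mult_left_mono) auto
  ultimately have "h r * r powr (- 2 * \<kappa>) \<le> C2" by simp
  then have "h r * r powr (- 2 * \<kappa>) * r powr (2 * \<kappa>) \<le> C2 * r powr (2 * \<kappa>)"
    by (rule mult_right_mono) simp
  then show ?thesis using r by (simp add: mult.assoc powr_add[symmetric])
qed

text \<open>The 3 counts the contributions of \<open>h (2 * r)\<close>, \<open>h \<xi>\<close> and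
  \<open>\<xi> ^ (2 * k)\<close> in \<open>d_growth\<close>; the power of 2 pays for passing from
  \<open>2 * r\<close> to \<open>r\<close>, and \<open>c\<close> for
  \<open>d_doubling\<close>.\<close>

definition C3 :: real where "C3 = 3 * c * C2 * 2 powr (2 * real k)"

text \<open>The increment of \<open>h\<close> over \<open>[r, 2 * r]\<close> is
  \<open>2 * r * (d \<xi> + e \<xi>) / \<xi>\<close> for some \<open>\<xi>\<close> in between, so
  \<open>d \<xi>\<close> is controlled by the growth of \<open>h\<close>; \<open>d_doubling\<close>
  carries this down to \<open>r\<close>.\<close>

lemma d_growth:
  assumes r: "0 < r" "r < r1 / 2"
  shows "d r \<le> C3 * r powr (2 * \<kappa>)"
proof -
  have "\<exists>\<xi>>r. \<xi> < 2 * r \<and> h (2 * r) - h r = (2 * r - r) * (2 * (d \<xi> + e \<xi>) / \<xi>)"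
  proof (rule MVT2)
    show "(h has_real_derivative 2 * (d x + e x) / x) (at x)" if "r \<le> x" "x \<le> 2 * r" for x
      by (rule DERIV_h) (use that r r1 in auto)
  qed (use r in simp)
  then obtain \<xi> where \<xi>: "r < \<xi>" "\<xi> < 2 * r" "h (2 * r) - h r = r * (2 * (d \<xi> + e \<xi>) / \<xi>)" by auto
  define X where "X = (2 * r) powr (2 * \<kappa>)"
  have X: "0 \<le> X" by (simp add: X_def)
  have "d \<xi> + e \<xi> = (h (2 * r) - h r) * (\<xi> / (2 * r))"
    using \<xi> r by (simp add: field_simps)
  also have "\<dots> \<le> h (2 * r) * (\<xi> / (2 * r))"
    using h_nonneg[of r] \<xi> r r1 by (intro mult_right_mono) auto
  also have "\<dots> \<le> h (2 * r) * 1"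
    using h_nonneg[of "2 * r"] \<xi> r r1 by (intro mult_left_mono) auto
  finally have 1: "d \<xi> \<le> h (2 * r) + \<bar>e \<xi>\<bar>" by simp
  have h1: "h (2 * r) \<le> C2 * X" unfolding X_def by (rule h_growth) (use r in auto)
  have mono: "\<xi> powr (2 * \<kappa>) \<le> X" unfolding X_def
    using \<kappa>_nonneg \<xi> r by (intro powr_mono2) auto
  have h2: "h \<xi> \<le> C2 * X"
  proof -
    have "h \<xi> \<le> C2 * \<xi> powr (2 * \<kappa>)" by (rule h_growth) (use \<xi> r in auto)
    also have "\<dots> \<le> C2 * X" using C2_ge mono by (intro mult_left_mono) auto
    finally show ?thesis .
  qed
  have h3: "\<xi> ^ (2 * k) \<le> X" using pow_le_powr[of \<xi>] mono \<xi> r r1 by simp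
  have "\<bar>e \<xi>\<bar> \<le> 2 * c * \<xi> * (h \<xi> + \<xi> ^ (2 * k))" by (rule e_le_h) (use \<xi> r in auto)
  also have "\<dots> \<le> 1 * (h \<xi> + \<xi> ^ (2 * k))"
  proof (rule mult_right_mono)
    have "4 * c * \<xi> \<le> 1" by (rule r1(3)) (use \<xi> r in auto)
    moreover have "0 \<le> c * \<xi>" using c \<xi> r by simp
    ultimately show "2 * c * \<xi> \<le> 1" by simp
  qed (use \<xi> r r1 h_nonneg[of \<xi>] in auto)
  also have "\<dots> \<le> C2 * X + X" using h2 h3 by simp
  finally have "d \<xi> \<le> C2 * X + C2 * X + X" using 1 h1 by linarith
  also have "\<dots> \<le> C2 * X + C2 * X + C2 * X" using mult_right_mono[OF C2_ge X] by linarith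
  also have "\<dots> = 3 * C2 * X" by simp
  finally have "d \<xi> \<le> 3 * C2 * X" .
  moreover have "X \<le> 2 powr (2 * real k) * r powr (2 * \<kappa>)"
    unfolding X_def using r \<kappa>_le by (simp add: powr_mult)
  then have "3 * C2 * X \<le> 3 * C2 * (2 powr (2 * real k) * r powr (2 * \<kappa>))"
    using C2_ge by (intro mult_left_mono) auto
  ultimately have "d \<xi> \<le> 3 * C2 * (2 powr (2 * real k) * r powr (2 * \<kappa>))" by linarith
  then have "c * d \<xi> \<le> c * (3 * C2 * (2 powr (2 * real k) * r powr (2 * \<kappa>)))"
    using c by (intro mult_left_mono) auto
  moreover have "d r \<le> c * d \<xi>" by (rule d_doubling) (use \<xi> r r1 in auto)
  ultimately show ?thesis by (simp add: C3_def mult_ac)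
qed

text \<open>The first summand is the error in the Rellich inequality. The second bounds
  \<open>2 * \<kappa> * e r\<close>, where \<open>\<bar>e r\<bar>\<close> is at most
  \<open>2 * c * (C2 + 1)\<close> times \<open>r * r powr (2 * \<kappa>)\<close> and
  \<open>\<kappa> \<le> k\<close>.\<close>

definition C4 :: real where "C4 = c * (1 + C3) + 4 * real k * c * (C2 + 1)"

text \<open>After \<open>d'_ge\<close>, \<open>Q\<close> contains the square
  \<open>2 * (a - 2 * \<kappa> * (d + e) + \<kappa>^2 * h)\<close>, nonnegative by
  \<open>quad\<close> at \<open>y = \<kappa>\<close>. By the growth bounds the rest is of order
  \<open>r * r powr (2 * \<kappa>)\<close>, which the weight
  \<open>r powr (- 2 * \<kappa>) / r\<close> cancels exactly.\<close>

theorem weiss_derivative: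
  assumes r: "0 < r" "r < r1 / 2"
  shows "\<exists>D. ((\<lambda>r. r powr (- 2 * \<kappa>) * (d r - \<kappa> * h r)) has_real_derivative D) (at r) \<and> - C4 \<le> D"
proof -
  have r0: "r < 1" "r \<le> r1" "r < r1" using r r1 by auto
  define Q where "Q = r * d' r - 4 * \<kappa> * (d r + e r) + 2 * \<kappa>\<^sup>2 * h r + 2 * \<kappa> * e r"
  define Y where "Y = r powr (- 2 * \<kappa>)"
  have "((\<lambda>s. s powr (- 2 * \<kappa>)) has_real_derivative - 2 * \<kappa> * r powr (- 2 * \<kappa> - 1)) (at r)"
    using r by (auto intro!: derivative_eq_intros)
  moreover have "r powr (- 2 * \<kappa> - 1) = Y / r"
    using r by (simp add: powr_diff Y_def)
  ultimately have "((\<lambda>s. s powr (- 2 * \<kappa>)) has_real_derivative - 2 * \<kappa> * (Y / r)) (at r)" by simp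
  from DERIV_mult[OF this DERIV_diff[OF DERIV_d[OF r(1) r0(1)] DERIV_cmult[OF DERIV_h[OF r(1) r0(1)], of \<kappa>]]]
  have "((\<lambda>r. r powr (- 2 * \<kappa>) * (d r - \<kappa> * h r)) has_real_derivative
      r powr (- 2 * \<kappa>) / r * Q) (at r)"
    unfolding Q_def Y_def[symmetric]
    by (rule DERIV_cong) (use r in \<open>simp add: field_simps power2_eq_square\<close>)
  moreover have "- C4 \<le> r powr (- 2 * \<kappa>) / r * Q"
  proof -
    define X where "X = r powr (2 * \<kappa>)"
    have X: "0 < X" using r by (simp add: X_def)
    have b: "h r \<le> C2 * X" "d r \<le> C3 * X" "r ^ (2 * k) \<le> X"
      unfolding X_def using h_growth[of r] d_growth[of r] pow_le_powr[of r] r r0 by auto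
    have "\<bar>e r\<bar> \<le> 2 * c * r * (h r + r ^ (2 * k))" by (rule e_le_h) (use r r0 in auto)
    also have "\<dots> \<le> 2 * c * r * (C2 * X + X)"
      using b c r by (intro mult_left_mono add_mono) auto
    finally have e: "\<bar>e r\<bar> \<le> 2 * c * r * (C2 * X + X)" .
    have "\<bar>\<kappa> * e r\<bar> \<le> real k * (2 * c * r * (C2 * X + X))"
      unfolding abs_mult using \<kappa>_nonneg \<kappa>_le e by (intro mult_mono) auto
    then have 1: "- (4 * real k * c * (C2 + 1) * (r * X)) \<le> 2 * \<kappa> * e r"
      by (simp add: algebra_simps abs_le_iff)
    have "c * r * (r ^ (2 * k) + d r) \<le> c * r * (X + C3 * X)"
      using b c r by (intro mult_left_mono add_mono) auto
    then have 2: "2 * a r - c * (1 + C3) * (r * X) \<le> r * d' r"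
      using d'_ge[of r] r r0 by (simp add: algebra_simps)
    have 3: "0 \<le> 2 * a r - 4 * \<kappa> * (d r + e r) + 2 * \<kappa>\<^sup>2 * h r"
      using quad[of r \<kappa>] r r0 by simp
    have "- C4 * (r * X) \<le> Q"
      using 1 2 3 unfolding Q_def C4_def by (simp add: algebra_simps)
    then have "(1 / (r * X)) * (- C4 * (r * X)) \<le> (1 / (r * X)) * Q"
      using r X by (intro mult_left_mono) auto
    moreover have "(1 / (r * X)) * (- C4 * (r * X)) = - C4" using r X by simp
    moreover have "r powr (- 2 * \<kappa>) / r = 1 / (r * X)"
      using r by (simp add: X_def powr_minus_divide)
    ultimately show ?thesis by simp
  qed
  ultimately show ?thesis by blast
qed

end

section \<open>Integration over balls and spheres\<close>

lemma measurable_ball_sphere [measurable]: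
  fixes a :: "'a::euclidean_space"
  shows "ball a r \<in> sets borel" "sphere a r \<in> sets borel"
  by auto

text \<open>Used for difference quotients in a real parameter. The bound holds only eventually, so
  each approximating sequence is shifted past its first \<open>N\<close> terms.\<close>

lemma dominated_convergence_at_within:
  fixes s :: "real \<Rightarrow> 'a \<Rightarrow> real"
  assumes "f \<in> borel_measurable M" "\<And>t. s t \<in> borel_measurable M" "integrable M w"
    and lim: "AE x in M. ((\<lambda>t. s t x) \<longlongrightarrow> f x) (at a within T)"
    and bound: "\<forall>\<^sub>F t in at a within T. AE x in M. norm (s t x) \<le> w x"
  shows "((\<lambda>t. integral\<^sup>L M (s t)) \<longlongrightarrow> integral\<^sup>L M f) (at a within T)"
  unfolding tendsto_at_iff_sequentially
proof (intro allI impI)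
  fix X :: "nat \<Rightarrow> real" assume X: "\<forall>i. X i \<in> T - {a}" "X \<longlonglongrightarrow> a"
  have fl: "filterlim X (at a within T) sequentially"
    using X by (auto simp: filterlim_at)
  then have "\<forall>\<^sub>F n in sequentially. AE x in M. norm (s (X n) x) \<le> w x"
    using bound by (rule filterlim_iff[THEN iffD1, rule_format])
  then obtain N where N: "\<And>n. n \<ge> N \<Longrightarrow> AE x in M. norm (s (X n) x) \<le> w x"
    by (auto simp: eventually_sequentially)
  show "((\<lambda>t. integral\<^sup>L M (s t)) \<circ> X) \<longlonglongrightarrow> integral\<^sup>L M f"
    unfolding o_def
  proof (rule LIMSEQ_offset, rule integral_dominated_convergence[where w=w])
    show "AE x in M. (\<lambda>n. s (X (n + N)) x) \<longlonglongrightarrow> f x"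
      using lim
    proof eventually_elim
      case (elim x)
      show ?case by (rule LIMSEQ_ignore_initial_segment) (rule filterlim_compose[OF elim fl])
    qed
  qed (use assms N in auto)
qed

lemma lborel_integral_scaleR:
  fixes F :: "'a::euclidean_space \<Rightarrow> real"
  assumes [measurable]: "F \<in> borel_measurable borel" and "0 < c"
  shows "integral\<^sup>L lborel F = c ^ DIM('a) * (\<integral>x. F (c *\<^sub>R x) \<partial>lborel)"
proof -
  have "integral\<^sup>L lborel F =
      integral\<^sup>L (density (distr lborel borel (\<lambda>x::'a. 0 + c *\<^sub>R x)) (\<lambda>_. ennreal (\<bar>c\<bar> ^ DIM('a)))) F"
    using lborel_affine[of c "0::'a"] assms by simp
  also have "\<dots> = c ^ DIM('a) * (\<integral>x. F (c *\<^sub>R x) \<partial>lborel)"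
    using assms by (subst integral_density) (auto simp: integral_distr)
  finally show ?thesis .
qed

section \<open>Reflection in the thin hyperplane and null sets\<close>

definition mirror :: "('m::finite) space \<Rightarrow> 'm space" where
  "mirror x = (fst x, - snd x)"

lemma measurable_mirror [measurable]: "mirror \<in> borel_measurable borel"
  unfolding mirror_def by (intro borel_measurable_continuous_onI continuous_intros)

lemma lborel_distr_mirror: "distr lborel borel mirror = (lborel :: ('m::finite) space measure)"
proof -
  define c :: "'m space \<Rightarrow> real" where "c = (\<lambda>j. if j = (0,1) then -1 else 1)"
  have b: "(0,1) \<in> (Basis :: 'm space set)" by (auto simp: Basis_prod_def)
  have T: "(\<Sum>j\<in>Basis. (c j * (x \<bullet> j)) *\<^sub>R j) = mirror x" for x :: "'m space"
  proof -
    have "(\<Sum>j\<in>Basis. (c j * (x \<bullet> j)) *\<^sub>R j) =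
        (\<Sum>j\<in>Basis. (x \<bullet> j) *\<^sub>R j - (if j = (0,1) then (2 * snd x) *\<^sub>R (0,1) else 0))"
      by (rule sum.cong) (auto simp: c_def inner_prod_def)
    also have "\<dots> = x - (2 * snd x) *\<^sub>R (0,1)"
      unfolding sum_subtractf using b by (simp add: euclidean_representation)
    finally show ?thesis by (auto simp: mirror_def prod_eq_iff)
  qed
  have p: "(\<Prod>j\<in>Basis. \<bar>c j\<bar>) = 1"
    by (rule prod.neutral) (auto simp: c_def)
  have "lborel = density (distr lborel borel (\<lambda>x. 0 + (\<Sum>j\<in>Basis. (c j * (x \<bullet> j)) *\<^sub>R j)))
      (\<lambda>_. (\<Prod>j\<in>Basis. \<bar>c j\<bar>))"
    by (rule lborel_affine_euclidean) (auto simp: c_def)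
  then show ?thesis unfolding T p by (simp add: density_1)
qed

lemma lborel_integral_mirror:
  fixes F :: "('m::finite) space \<Rightarrow> real"
  assumes [measurable]: "F \<in> borel_measurable borel"
  shows "(\<integral>x. F (mirror x) \<partial>lborel) = integral\<^sup>L lborel F"
    and "integrable lborel (\<lambda>x. F (mirror x)) \<longleftrightarrow> integrable lborel F"
proof -
  show "(\<integral>x. F (mirror x) \<partial>lborel) = integral\<^sup>L lborel F"
    using integral_distr[of mirror lborel borel F] by (simp add: lborel_distr_mirror)
  show "integrable lborel (\<lambda>x. F (mirror x)) \<longleftrightarrow> integrable lborel F"
    using integrable_distr_eq[of mirror lborel borel F] by (simp add: lborel_distr_mirror)
qed

lemma AE_lborel_not_in:
  fixes N :: "'a::euclidean_space set"
  assumes "negligible N"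
  shows "AE x in lborel. x \<notin> N"
proof -
  have "AE x in lebesgue. x \<notin> N"
    using assms by (intro AE_not_in) (auto simp: negligible_iff_null_sets)
  then show ?thesis by (simp add: AE_completion_iff)
qed

lemma AE_snd_neq_0: "AE x::('m::finite) space in lborel. snd x \<noteq> 0"
proof -
  have "negligible {x :: 'm space. (0,1) \<bullet> x = 0}"
    by (rule negligible_hyperplane) (auto simp: zero_prod_def)
  then show ?thesis
    using AE_lborel_not_in by (force simp: inner_prod_def)
qed

lemma AE_neq_0: "AE x::'a::euclidean_space in lborel. x \<noteq> 0"
  using AE_lborel_not_in[of "{0}"] by auto

lemma measurable_sgn [measurable]: "(sgn :: 'a::euclidean_space \<Rightarrow> 'a) \<in> borel_measurable borel"
  unfolding sgn_div_norm[abs_def] by measurable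

lemma integrable_on_ball:
  fixes F :: "'a::euclidean_space \<Rightarrow> real"
  assumes [measurable]: "F \<in> borel_measurable borel"
    and "\<And>x. x \<in> ball 0 r \<Longrightarrow> \<bar>F x\<bar> \<le> B"
  shows "integrable lborel (\<lambda>x. indicator (ball 0 r) x * F x)"
proof (rule Bochner_Integration.integrable_bound)
  have "emeasure lborel (ball (0::'a) r) < \<infinity>"
    by (rule emeasure_bounded_finite) simp
  then show "integrable lborel (\<lambda>x::'a. indicat_real (ball 0 r) x * B)"
    by (intro integrable_mult_left integrable_real_indicator) auto
  have "norm (indicat_real (ball 0 r) x * F x) \<le> norm (indicat_real (ball 0 r) x * B)" for x
    using assms(2)[of x] by (cases "x \<in> ball 0 r") auto
  then show "AE x in lborel. norm (indicat_real (ball 0 r) x * F x) \<le> norm (indicat_real (ball 0 r) x * B)"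
    by (intro always_eventually allI)
qed measurable

text \<open>\<open>sph s F\<close> is the integral of \<open>\<omega> \<mapsto> F (s \<omega>)\<close> against the surface measure of the unit sphere; being a
  volume integral over the unit ball, it also makes sense for \<open>s = 0\<close>.\<close>

definition ball_int :: "real \<Rightarrow> ('a::euclidean_space \<Rightarrow> real) \<Rightarrow> real" where
  "ball_int r F = (\<integral>x. indicator (ball 0 r) x * F x \<partial>lborel)"

definition sph :: "real \<Rightarrow> ('a::euclidean_space \<Rightarrow> real) \<Rightarrow> real" where
  "sph s F = DIM('a) * (\<integral>x. indicator (ball 0 1) x * F (s *\<^sub>R sgn x) \<partial>lborel)"

text \<open>Pulled back along \<open>sgn\<close>, the surface integral becomes a volume integral;
  the indicator of the sphere disappears because \<open>sgn x\<close> has norm 1 except at the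
  origin.\<close>

lemma sphere_integral_eq_sph:
  fixes F :: "'a::euclidean_space \<Rightarrow> real"
  assumes F: "continuous_on (sphere 0 r) F" and r: "0 \<le> r"
  shows "sphere_integral r F = r ^ (DIM('a) - 1) * sph r F"
proof -
  have m[measurable]: "(\<lambda>\<omega>. indicator (sphere 0 1) \<omega> *\<^sub>R F (r *\<^sub>R \<omega>)) \<in> borel_measurable borel"
    by (rule borel_measurable_continuous_on_indicator)
      (use r in \<open>auto intro!: continuous_on_compose2[OF F] continuous_intros\<close>)
  have "(LINT \<omega>:sphere 0 1|surface_measure. F (r *\<^sub>R \<omega>)) =
     (\<integral>x. (real DIM('a) * indicat_real (ball 0 1) x) * (indicator (sphere 0 1) (sgn x) * F (r *\<^sub>R sgn x)) \<partial>lborel)"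
    unfolding surface_measure_def set_lebesgue_integral_def
  proof (subst integral_distr, goal_cases)
    case 3
    have e: "ennreal (DIM('a)) * indicator (ball 0 1) x = ennreal (real DIM('a) * indicat_real (ball 0 1) x)" for x :: 'a
      by (auto simp: indicator_def)
    show ?case unfolding e
    proof (subst integral_density, goal_cases)
      case 1
      have "(\<lambda>x. (\<lambda>\<omega>. indicator (sphere 0 1) \<omega> *\<^sub>R F (r *\<^sub>R \<omega>)) (sgn x)) \<in> borel_measurable borel"
        by (rule measurable_compose[OF measurable_sgn m])
      then show ?case by simp
    qed measurable
  qed (use m in simp_all)
  also have "\<dots> = (\<integral>x. DIM('a) * (indicator (ball 0 1) x * F (r *\<^sub>R sgn x)) \<partial>lborel)"
  proof (rule Bochner_Integration.integral_cong_AE)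
    have m2: "(\<lambda>x. (\<lambda>\<omega>. indicator (sphere 0 1) \<omega> *\<^sub>R F (r *\<^sub>R \<omega>)) (sgn x)) \<in> borel_measurable borel"
      by (rule measurable_compose[OF measurable_sgn m])
    then show m3: "(\<lambda>x. real DIM('a) * indicat_real (ball 0 1) x *
          (indicat_real (sphere 0 1) (sgn x) * F (r *\<^sub>R sgn x))) \<in> borel_measurable lborel" by simp
    have ae: "x \<noteq> 0 \<Longrightarrow> real DIM('a) * indicat_real (ball 0 1) x *
          (indicat_real (sphere 0 1) (sgn x) * F (r *\<^sub>R sgn x)) =
          real DIM('a) * (indicat_real (ball 0 1) x * F (r *\<^sub>R sgn x))" for x :: 'a
      by (auto simp: indicator_def norm_sgn)
    show "AE x in lborel. real DIM('a) * indicat_real (ball 0 1) x *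
          (indicat_real (sphere 0 1) (sgn x) * F (r *\<^sub>R sgn x)) =
          real DIM('a) * (indicat_real (ball 0 1) x * F (r *\<^sub>R sgn x))"
      using AE_neq_0 by eventually_elim (rule ae)
    \<comment> \<open>\<open>F\<close> is continuous on the sphere only, so measurability is
      inherited from the version with the indicator, corrected at the single point where
      \<open>sgn\<close> vanishes.\<close>
    have "(\<lambda>x. if x = 0 then real DIM('a) * F 0 else real DIM('a) * indicat_real (ball 0 1) x *
          (indicat_real (sphere 0 1) (sgn x) * F (r *\<^sub>R sgn x))) \<in> borel_measurable lborel"
      using m3 by measurable
    also have "(\<lambda>x. if x = 0 then real DIM('a) * F 0 else real DIM('a) * indicat_real (ball 0 1) x *
          (indicat_real (sphere 0 1) (sgn x) * F (r *\<^sub>R sgn x))) =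
          (\<lambda>x. real DIM('a) * (indicat_real (ball 0 1) x * F (r *\<^sub>R sgn x)))"
      by (rule ext) (use ae in \<open>auto simp: \<close>)
    finally show "(\<lambda>x. real DIM('a) * (indicat_real (ball 0 1) x * F (r *\<^sub>R sgn x)))
        \<in> borel_measurable lborel" .
  qed
  finally show ?thesis by (simp add: sphere_integral_def sph_def)
qed

lemma ball_int_scale:
  fixes F :: "'a::euclidean_space \<Rightarrow> real"
  assumes [measurable]: "F \<in> borel_measurable borel" and "0 < c"
  shows "ball_int (c * r) F = c ^ DIM('a) * ball_int r (\<lambda>x. F (c *\<^sub>R x))"
proof -
  have "indicat_real (ball 0 (c * r)) (c *\<^sub>R x) = indicator (ball 0 r) x" for x :: 'a
    using assms(2) by (auto simp: indicator_def)
  then show ?thesis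
    unfolding ball_int_def using assms by (subst lborel_integral_scaleR[of _ c]) auto
qed

lemma ball_int_sgn:
  fixes F :: "'a::euclidean_space \<Rightarrow> real"
  assumes "F \<in> borel_measurable borel" and "0 < r"
  shows "ball_int r (\<lambda>x. F (sgn x)) = r ^ DIM('a) * ball_int 1 (\<lambda>x. F (sgn x))"
  using ball_int_scale[OF measurable_compose[OF measurable_sgn assms(1)] assms(2), of 1] assms(2)
  by (simp add: sgn_scaleR)

lemma ball_int_diff_le:
  fixes g :: "'a::euclidean_space \<Rightarrow> real"
  assumes [measurable]: "g \<in> borel_measurable borel" and "r \<le> s"
    and b: "\<And>x. norm x < s \<Longrightarrow> \<bar>g x\<bar> \<le> B"
    and g: "\<And>x. r \<le> norm x \<Longrightarrow> norm x < s \<Longrightarrow> \<bar>g x\<bar> \<le> \<epsilon>"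
  shows "\<bar>ball_int s g - ball_int r g\<bar> \<le> \<epsilon> * (ball_int s (\<lambda>x::'a. 1) - ball_int r (\<lambda>x::'a. 1))"
proof -
  have i: "integrable lborel (\<lambda>x. indicator (ball 0 s) x * g x)"
    by (rule integrable_on_ball[where B=B]) (use b in auto)
  have i2: "integrable lborel (\<lambda>x. indicator (ball 0 r) x * g x)"
    by (rule integrable_on_ball[where B=B]) (use b \<open>r \<le> s\<close> in auto)
  have j: "integrable lborel (\<lambda>x::'a. indicator (ball 0 t) x * (1::real))" for t
    by (rule integrable_on_ball[where B=1]) auto
  have "\<bar>ball_int s g - ball_int r g\<bar> =
     \<bar>\<integral>x. indicator (ball 0 s) x * g x - indicator (ball 0 r) x * g x \<partial>lborel\<bar>"
    unfolding ball_int_def by (subst Bochner_Integration.integral_diff[OF i i2]) simp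
  also have "\<dots> \<le> (\<integral>x. \<bar>indicator (ball 0 s) x * g x - indicator (ball 0 r) x * g x\<bar> \<partial>lborel)"
    by (rule integral_abs_bound)
  also have "\<dots> \<le> (\<integral>x. \<epsilon> * (indicator (ball 0 s) x * 1 - indicator (ball 0 r) (x::'a) * 1) \<partial>lborel)"
    by (rule integral_mono)
      (use i i2 j \<open>r \<le> s\<close> in \<open>auto intro!: integrable_mult_right integrable_abs Bochner_Integration.integrable_diff
        simp: indicator_def not_less intro: g\<close>)
  also have "\<dots> = \<epsilon> * (ball_int s (\<lambda>x::'a. 1) - ball_int r (\<lambda>x::'a. 1))"
    unfolding ball_int_def using j by (subst integral_mult_right_zero, subst Bochner_Integration.integral_diff) auto
  finally show ?thesis .
qed

text \<open>This is how integration in polar coordinates enters. Continuity of \<open>F\<close>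
  gives the derivative at every radius instead of almost every one, as the monotonicity argument for
  \<open>d / h\<close> requires.\<close>

lemma DERIV_ball_int:
  fixes F :: "'a::euclidean_space \<Rightarrow> real"
  assumes [measurable]: "F \<in> borel_measurable borel"
    and F: "continuous_on (ball 0 R) F" and s: "0 < s" "s < R"
  shows "((\<lambda>r. ball_int r F) has_real_derivative s ^ (DIM('a) - 1) * sph s F) (at s)"
proof -
  define \<phi> where "\<phi> = (\<lambda>x. F (s *\<^sub>R sgn x))"
  \<comment> \<open>The angular part \<open>\<phi>\<close> is homogeneous of degree 0, so its ball integrals are explicit; the rest is
    small near the sphere of radius \<open>s\<close>.\<close>
  define g where "g = (\<lambda>x. F x - \<phi> x)"
  define v where "v r = ball_int r (\<lambda>x::'a. 1)" for r
  have [measurable]: "\<phi> \<in> borel_measurable borel" "g \<in> borel_measurable borel"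
    unfolding g_def \<phi>_def by measurable
  define b where "b = (s + R) / 2"
  have b: "s < b" "b < R" using s by (auto simp: b_def)
  have cF: "continuous_on (cball 0 b) F" by (rule continuous_on_subset[OF F]) (use b in auto)
  have "compact (F ` cball 0 b)" by (rule compact_continuous_image[OF cF]) simp
  then obtain B where B: "\<And>x. norm x \<le> b \<Longrightarrow> \<bar>F x\<bar> \<le> B"
    by (force dest: compact_imp_bounded simp: bounded_iff)
  have nsgn: "norm (s *\<^sub>R sgn x) \<le> s" for x :: 'a using s by (auto simp: norm_sgn)
  have B\<phi>: "\<bar>\<phi> x\<bar> \<le> B" for x
    unfolding \<phi>_def by (rule B) (use nsgn[of x] b in auto)
  have Bg: "\<bar>g x\<bar> \<le> 2 * B" if "norm x \<le> b" for x
    using B[OF that] B\<phi>[of x] by (auto simp: g_def)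
  have vr: "v r = r ^ DIM('a) * v 1" if "0 < r" for r
    using ball_int_sgn[of "\<lambda>_. 1" r] that by (simp add: v_def)
  have v0: "0 \<le> v r" for r unfolding v_def ball_int_def by (rule Bochner_Integration.integral_nonneg) simp
  have ev: "\<forall>\<^sub>F r in nhds s. 0 < r \<and> r < b"
    by (intro eventually_conj order_tendstoD[OF filterlim_ident]) (use s b in auto)
  have pd: "((\<lambda>r. r ^ DIM('a) * c) has_real_derivative real DIM('a) * s ^ (DIM('a) - 1) * c) (at s)" for c
    by (auto intro!: derivative_eq_intros)
  have "((\<lambda>r. r ^ DIM('a) * ball_int 1 \<phi>) has_real_derivative s ^ (DIM('a) - 1) * sph s F) (at s)"
    using pd[of "ball_int 1 \<phi>"] by (simp add: sph_def ball_int_def \<phi>_def mult_ac)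
  then have 1: "((\<lambda>r. ball_int r \<phi>) has_real_derivative s ^ (DIM('a) - 1) * sph s F) (at s)"
  proof (rule DERIV_cong_ev[THEN iffD2, rotated -1])
    show "\<forall>\<^sub>F r in nhds s. ball_int r \<phi> = r ^ DIM('a) * ball_int 1 \<phi>"
      using ev unfolding \<phi>_def
      by eventually_elim (subst ball_int_sgn[of "\<lambda>x. F (s *\<^sub>R x)"], auto)
  qed auto
  define K where "K = real DIM('a) * s ^ (DIM('a) - 1) * v 1"
  have K: "0 \<le> K" unfolding K_def
    by (intro mult_nonneg_nonneg v0 zero_le_power of_nat_0_le_iff) (use s in auto)
  have dv: "(v has_real_derivative K) (at s)"
    using pd[of "v 1"] unfolding K_def
  proof (rule DERIV_cong_ev[THEN iffD2, rotated -1])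
    show "\<forall>\<^sub>F r in nhds s. v r = r ^ DIM('a) * v 1"
      using ev by eventually_elim (rule vr, auto)
  qed auto
  have "((\<lambda>r. ball_int r g) has_real_derivative 0) (at s)"
    unfolding has_field_derivative_iff
  proof (rule tendstoI)
    fix e :: real assume e: "0 < e"
    \<comment> \<open>The difference quotient of \<open>v\<close> is eventually within 1 of its
      limit \<open>K\<close>, hence at most \<open>K + 1\<close>; dividing by \<open>K + 2\<close>
      makes the final estimate strict.\<close>
    define \<epsilon> where "\<epsilon> = e / (K + 2)"
    have \<epsilon>: "0 < \<epsilon>" using e K by (auto simp: \<epsilon>_def)
    have "uniformly_continuous_on (cball 0 b) F"
      by (rule compact_uniformly_continuous[OF cF]) simp
    then obtain \<delta> where \<delta>: "0 < \<delta>" "\<And>x y. norm x \<le> b \<Longrightarrow> norm y \<le> b \<Longrightarrow> dist y x < \<delta> \<Longrightarrow> dist (F y) (F x) < \<epsilon>"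
      using \<epsilon> by (force simp: uniformly_continuous_on_def)
    have small: "\<bar>g x\<bar> \<le> \<epsilon>" if "\<bar>norm x - s\<bar> < \<delta>" "norm x \<le> b" "x \<noteq> 0" for x
    proof -
      have "x - s *\<^sub>R sgn x = (norm x - s) *\<^sub>R sgn x"
        using that by (simp add: algebra_simps sgn_div_norm)
      then have "dist x (s *\<^sub>R sgn x) < \<delta>"
        using that by (simp add: dist_norm norm_sgn)
      then have "dist (F x) (F (s *\<^sub>R sgn x)) < \<epsilon>"
        by (intro \<delta>) (use that nsgn[of x] b in auto)
      then show ?thesis by (simp add: g_def \<phi>_def dist_norm)
    qed
    have "\<forall>\<^sub>F r in at s. \<bar>(v r - v s) / (r - s) - K\<bar> < 1"
      using dv unfolding has_field_derivative_iff
      by (auto dest!: tendstoD[where e=1] simp: dist_norm)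
    moreover have "\<forall>\<^sub>F r in at s. 0 < r \<and> r < b" using ev by (auto simp: eventually_at_filter elim: eventually_mono)
    moreover have "\<forall>\<^sub>F r in at s. \<bar>r - s\<bar> < \<delta>"
      using \<delta>(1) by (auto simp: eventually_at dist_norm)
    moreover have "\<forall>\<^sub>F r in at s. r \<noteq> s" by (simp add: eventually_at_filter)
    ultimately show "\<forall>\<^sub>F r in at s. dist ((ball_int r g - ball_int s g) / (r - s)) 0 < e"
    proof eventually_elim
      case (elim r)
      have "\<bar>ball_int r g - ball_int s g\<bar> \<le> \<epsilon> * \<bar>v r - v s\<bar>"
      proof (cases "r \<le> s")
        case True
        have "\<bar>ball_int s g - ball_int r g\<bar> \<le> \<epsilon> * (v s - v r)" unfolding v_def
          by (rule ball_int_diff_le[where B="2*B"]) (use True elim b s in \<open>auto intro!: Bg small\<close>)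
        then show ?thesis using \<epsilon> by (smt (verit) mult_left_mono)
      next
        case False
        have "\<bar>ball_int r g - ball_int s g\<bar> \<le> \<epsilon> * (v r - v s)" unfolding v_def
          by (rule ball_int_diff_le[where B="2*B"]) (use False elim b s in \<open>auto intro!: Bg small\<close>)
        then show ?thesis using \<epsilon> by (smt (verit) mult_left_mono)
      qed
      then have "\<bar>(ball_int r g - ball_int s g) / (r - s)\<bar> \<le> \<epsilon> * \<bar>(v r - v s) / (r - s)\<bar>"
        by (simp add: abs_divide divide_right_mono)
      also have "\<dots> \<le> \<epsilon> * (K + 1)"
      proof (rule mult_left_mono)
        show "\<bar>(v r - v s) / (r - s)\<bar> \<le> K + 1" using elim(1) K by linarith
      qed (use \<epsilon> in simp)
      also have "\<dots> < e" using e K by (simp add: \<epsilon>_def field_simps)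
      finally show ?case by simp
    qed
  qed
  from DERIV_add[OF 1 this]
  have "((\<lambda>r. ball_int r \<phi> + ball_int r g) has_real_derivative s ^ (DIM('a) - 1) * sph s F) (at s)"
    by simp
  then show ?thesis
  proof (rule DERIV_cong_ev[THEN iffD2, rotated -1])
    show "\<forall>\<^sub>F r in nhds s. ball_int r F = ball_int r \<phi> + ball_int r g"
      using ev
    proof eventually_elim
      case (elim r)
      have "integrable lborel (\<lambda>x. indicator (ball 0 r) x * \<phi> x)"
        by (rule integrable_on_ball[where B=B]) (use B\<phi> in auto)
      moreover have "integrable lborel (\<lambda>x. indicator (ball 0 r) x * g x)"
        by (rule integrable_on_ball[where B="2*B"]) (use Bg elim in auto)
      ultimately show ?case
        unfolding ball_int_def by (subst Bochner_Integration.integral_add[symmetric]) (auto simp: g_def algebra_simps)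
    qed
  qed auto
qed

section \<open>Cutoff functions and reflection\<close>

text \<open>A \<open>C\<^sup>1\<close> approximation of \<open>t \<mapsto> max 0 t\<close>; test functions have to be \<open>C\<^sup>1\<close>, but the identities below come
  from piecewise linear cutoffs.\<close>

definition cramp :: "nat \<Rightarrow> real \<Rightarrow> real" where
  "cramp j t = real (Suc j) * ((max 0 t)\<^sup>2 / 2 - (max 0 (t - 1 / Suc j))\<^sup>2 / 2)"

text \<open>A linear ramp from 0 to 1 across an interval of length \<open>1 / Suc j\<close>; it
  approximates the indicator of the positive numbers.\<close>

definition cramp' :: "nat \<Rightarrow> real \<Rightarrow> real" where
  "cramp' j t = real (Suc j) * (max 0 t - max 0 (t - 1 / Suc j))"

lemma DERIV_max_0_sq: "((\<lambda>t::real. (max 0 (t - b))\<^sup>2 / 2) has_real_derivative max 0 (t - b)) (at t)"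
proof -
  consider "t < b" | "t > b" | "t = b" by linarith
  then show ?thesis
  proof cases
    case 1
    have "((\<lambda>t::real. 0) has_real_derivative max 0 (t - b)) (at t)" using 1 by simp
    then show ?thesis
      by (rule DERIV_cong_ev[THEN iffD2, OF refl _ refl, rotated])
        (use 1 in \<open>auto intro!: eventually_mono[OF order_tendstoD(2)[OF filterlim_ident, of t b]]\<close>)
  next
    case 2
    have "((\<lambda>t::real. (t - b)\<^sup>2 / 2) has_real_derivative max 0 (t - b)) (at t)"
      using 2 by (auto intro!: derivative_eq_intros)
    then show ?thesis
      by (rule DERIV_cong_ev[THEN iffD2, OF refl _ refl, rotated])
        (use 2 in \<open>auto intro!: eventually_mono[OF order_tendstoD(1)[OF filterlim_ident, of b t]]\<close>)
  next
    case 3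
    have "((\<lambda>t. (max 0 (t - b))\<^sup>2 / 2 / (t - b)) \<longlongrightarrow> 0) (at b)"
    proof (rule Lim_null_comparison)
      show "\<forall>\<^sub>F t in at b. norm ((max 0 (t - b))\<^sup>2 / 2 / (t - b)) \<le> \<bar>t - b\<bar>"
        unfolding eventually_at_filter
        by (rule always_eventually) (auto simp: max_def power2_eq_square abs_mult divide_simps)
      show "((\<lambda>t. \<bar>t - b\<bar>) \<longlongrightarrow> 0) (at b)"
        by (auto intro!: tendsto_eq_intros)
    qed
    then show ?thesis using 3 by (simp add: has_field_derivative_iff)
  qed
qed

lemma DERIV_cramp: "(cramp j has_real_derivative cramp' j t) (at t)"
proof -
  have "((\<lambda>t::real. (max 0 t)\<^sup>2 / 2) has_real_derivative max 0 t) (at t)"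
    using DERIV_max_0_sq[of 0 t] by simp
  from DERIV_cmult[OF DERIV_diff[OF this DERIV_max_0_sq[of "1 / Suc j" t]], of "real (Suc j)"]
  show ?thesis unfolding cramp_def cramp'_def .
qed

lemma continuous_on_cramp' [continuous_intros]:
  "continuous_on A g \<Longrightarrow> continuous_on A (\<lambda>x. cramp' j (g x))"
  unfolding cramp'_def by (intro continuous_intros)

lemma continuous_on_cramp [continuous_intros]:
  "continuous_on A g \<Longrightarrow> continuous_on A (\<lambda>x. cramp j (g x))"
  unfolding cramp_def by (intro continuous_intros) auto

lemma cramp'_bounds: "0 \<le> cramp' j t" "cramp' j t \<le> 1"
proof -
  have "0 \<le> 1 / real (Suc j)" by simp
  then have "0 \<le> max 0 t - max 0 (t - 1 / Suc j)" by linarith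
  then show "0 \<le> cramp' j t" unfolding cramp'_def by (rule mult_nonneg_nonneg[rotated]) simp
  have "real (Suc j) * (max 0 t - max 0 (t - 1 / Suc j)) \<le> real (Suc j) * (1 / Suc j)"
  proof (rule mult_left_mono)
    have "0 \<le> 1 / real (Suc j)" by simp
    then show "max 0 t - max 0 (t - 1 / Suc j) \<le> 1 / Suc j" by linarith
  qed simp
  then show "cramp' j t \<le> 1" by (simp add: cramp'_def)
qed

lemma cramp_nonpos: "t \<le> 0 \<Longrightarrow> cramp j t = 0" "t \<le> 0 \<Longrightarrow> cramp' j t = 0"
proof -
  assume t: "t \<le> 0"
  then have "t - 1 / Suc j \<le> 0" by (smt (verit) divide_nonneg_nonneg of_nat_0_le_iff)
  then show "cramp j t = 0" "cramp' j t = 0" using t by (auto simp: cramp_def cramp'_def max_def)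
qed

lemma cramp_ge:
  assumes "1 / Suc j \<le> t"
  shows "cramp j t = t - 1 / Suc j / 2" "cramp' j t = 1"
proof -
  define b where "b = 1 / real (Suc j)"
  have b: "real (Suc j) * b = 1" "0 \<le> b" "b \<le> t" using assms by (auto simp: b_def)
  have "cramp j t = real (Suc j) * (t\<^sup>2 / 2 - (t - b)\<^sup>2 / 2)"
    unfolding cramp_def b_def[symmetric] using b by (simp add: max_def)
  also have "\<dots> = real (Suc j) * b * (t - b / 2)"
    by (simp add: power2_eq_square field_simps)
  finally show "cramp j t = t - 1 / Suc j / 2" using b by (simp add: b_def)
  have "cramp' j t = real (Suc j) * b"
    unfolding cramp'_def b_def[symmetric] using b by (simp add: max_def)
  then show "cramp' j t = 1" using b by simp
qed

lemma cramp_mono: "s \<le> t \<Longrightarrow> cramp j s \<le> cramp j t"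
  by (rule DERIV_nonneg_imp_nondecreasing) (auto intro: DERIV_cramp cramp'_bounds)

lemma cramp_lipschitz: "s \<le> t \<Longrightarrow> cramp j t - cramp j s \<le> t - s"
proof -
  assume st: "s \<le> t"
  have "((\<lambda>t. cramp j t - t) has_real_derivative cramp' j x - 1) (at x)" for x
    by (rule DERIV_diff[OF DERIV_cramp DERIV_ident])
  then have "\<exists>y. ((\<lambda>t. cramp j t - t) has_real_derivative y) (at x) \<and> y \<le> 0" for x
    using cramp'_bounds(2)[of j x] by (metis diff_le_0_iff_le)
  then have "cramp j t - t \<le> cramp j s - s"
    using DERIV_nonpos_imp_nonincreasing[OF st, of "\<lambda>t. cramp j t - t"] by blast
  then show ?thesis by simp
qed

lemma cramp_tendsto:
  "(\<lambda>j. cramp j t) \<longlonglongrightarrow> max 0 t" "(\<lambda>j. cramp' j t) \<longlonglongrightarrow> (if 0 < t then 1 else 0)"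
proof -
  have ev: "\<forall>\<^sub>F j in sequentially. 1 / Suc j \<le> t" if "0 < t"
    using order_tendstoD(2)[OF LIMSEQ_inverse_real_of_nat that]
    by eventually_elim (simp add: inverse_eq_divide)
  show "(\<lambda>j. cramp' j t) \<longlonglongrightarrow> (if 0 < t then 1 else 0)"
  proof (cases "0 < t")
    case True
    show ?thesis by (rule tendsto_eventually) (use ev[OF True] True in \<open>auto elim!: eventually_mono simp: cramp_ge\<close>)
  qed (simp add: cramp_nonpos)
  show "(\<lambda>j. cramp j t) \<longlonglongrightarrow> max 0 t"
  proof (cases "0 < t")
    case True
    have "(\<lambda>j. t - inverse (real (Suc j)) / 2) \<longlonglongrightarrow> t - 0 / 2"
      by (intro tendsto_intros LIMSEQ_inverse_real_of_nat) auto
    moreover have "\<forall>\<^sub>F j in sequentially. t - inverse (real (Suc j)) / 2 = cramp j t"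
      using ev[OF True] by eventually_elim (simp add: cramp_ge inverse_eq_divide)
    ultimately show ?thesis using True by (simp add: tendsto_cong)
  qed (simp add: cramp_nonpos)
qed

section \<open>Folding the ball onto its upper half\<close>

definition up :: "('m::finite) space \<Rightarrow> 'm space" where
  "up x = (fst x, \<bar>snd x\<bar>)"

lemma norm_up [simp]: "norm (up x) = norm x"
  by (simp add: up_def norm_prod_def)

lemma up_inner_up [simp]: "up x \<bullet> up x = x \<bullet> x"
  by (simp add: dot_square_norm)

lemma continuous_on_up [continuous_intros]: "continuous_on A g \<Longrightarrow> continuous_on A (\<lambda>x. up (g x))"
  unfolding up_def by (intro continuous_intros)

lemma measurable_up [measurable]: "up \<in> borel_measurable borel"
  by (intro borel_measurable_continuous_onI continuous_intros)

definition closed_half :: "real \<Rightarrow> ('m::finite) space set" where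
  "closed_half r = ball 0 r \<inter> {x. 0 \<le> snd x}"

lemma closed_half_1: "closed_half 1 = half_ball \<union> thin_ball"
  by (auto simp: closed_half_def half_ball_def thin_ball_def upper_def)

lemma up_in_closed_half: "x \<in> ball 0 r \<Longrightarrow> up x \<in> closed_half r"
  using norm_up[of x] by (simp add: closed_half_def) (simp add: up_def)

lemma closed_half_mono: "r \<le> s \<Longrightarrow> closed_half r \<subseteq> closed_half s"
  by (auto simp: closed_half_def)

lemma open_upper: "open (upper :: ('m::finite) space set)"
  unfolding upper_def by (intro open_Collect_less continuous_intros)

text \<open>Off the hyperplane \<open>F'\<close> is the sum of \<open>F\<close> and its reflection,
  since \<open>F\<close> vanishes in the lower half. This transfers relations obtained in the half
  ball to the full ball.\<close>

lemma half_ball_integral: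
  fixes F :: "('m::finite) space \<Rightarrow> real"
  assumes [measurable]: "F \<in> borel_measurable borel"
    and int: "integrable lborel F" and supp: "\<And>x. x \<notin> upper \<Longrightarrow> F x = 0"
    and F': "F' \<in> borel_measurable borel" "\<And>x. snd x \<noteq> 0 \<Longrightarrow> F' x = F (up x)"
  shows "(\<integral>x. F' x \<partial>lborel) = 2 * (\<integral>x. F x \<partial>lborel)"
proof -
  have int': "integrable lborel (\<lambda>x. F (mirror x))"
    using int by (simp add: lborel_integral_mirror)
  have "F' x = F x + F (mirror x)" if "snd x \<noteq> 0" for x
  proof (cases "0 < snd x")
    case True
    then have "up x = x" "mirror x \<notin> upper" by (auto simp: up_def mirror_def upper_def)
    then show ?thesis using F'(2)[OF that] supp by simp
  next
    case False
    then have "up x = mirror x" "x \<notin> upper" using that by (auto simp: up_def mirror_def upper_def)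
    then show ?thesis using F'(2)[OF that] supp by simp
  qed
  then have "AE x in lborel. F' x = F x + F (mirror x)"
    using AE_snd_neq_0 by (auto elim: eventually_mono)
  then have "(\<integral>x. F' x \<partial>lborel) = (\<integral>x. F x + F (mirror x) \<partial>lborel)"
    using F'(1) by (intro Bochner_Integration.integral_cong_AE) auto
  also have "\<dots> = 2 * (\<integral>x. F x \<partial>lborel)"
    using int int' by (simp add: lborel_integral_mirror)
  finally show ?thesis .
qed

section \<open>Green's inequality\<close>

text \<open>\<open>G\<close> is the gradient of \<open>u\<close>, continuous up to the thin ball, and \<open>f\<close> is a Borel version of the Laplacian.\<close>

locale weak_solution =
  fixes u f :: "('m::finite) space \<Rightarrow> real" and G :: "'m space \<Rightarrow> 'm space" and k :: nat and M :: real
  assumes M: "0 \<le> M"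
    and cont_u: "continuous_on (closed_half 1) u" and cont_G: "continuous_on (closed_half 1) G"
    and GDERIV_u: "\<And>x. x \<in> half_ball \<Longrightarrow> GDERIV u x :> G x"
    and weak: "\<And>\<phi> g K. (\<And>x. GDERIV \<phi> x :> g x) \<Longrightarrow> continuous_on UNIV g \<Longrightarrow> compact K \<Longrightarrow>
        K \<subseteq> half_ball \<Longrightarrow> (\<And>x. x \<notin> K \<Longrightarrow> \<phi> x = 0) \<Longrightarrow>
        (\<integral>x. indicator half_ball x * (G x \<bullet> g x + f x * \<phi> x) \<partial>lborel) = 0"
    and f_borel [measurable]: "f \<in> borel_measurable borel"
    and f_le: "\<And>x. \<bar>f x\<bar> \<le> M * norm x ^ (k - 1)"
    and u_le: "\<And>x. x \<in> closed_half 1 \<Longrightarrow> \<bar>u x\<bar> \<le> M"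
    and G_le: "\<And>x. x \<in> closed_half 1 \<Longrightarrow> norm (G x) \<le> M"
    and u_thin: "\<And>x. x \<in> thin_ball \<Longrightarrow> 0 \<le> u x"
    and G_thin: "\<And>x. x \<in> thin_ball \<Longrightarrow> snd (G x) \<le> 0"
    and uG_thin: "\<And>x. x \<in> thin_ball \<Longrightarrow> u x * snd (G x) = 0"
    and u_0: "u 0 = 0"

text \<open>
  For \<open>w\<close> with \<open>w * snd (G x) \<le> 0\<close> on the thin ball, Green's formula loses its boundary term there and becomes
  an inequality; this admits both \<open>w = \<plusminus>u\<close> and the dilation differences \<open>u (l x) - u x\<close>.
\<close>

locale comparison = weak_solution u f G k M
  for u f :: "('m::finite) space \<Rightarrow> real" and G k M +
  fixes w :: "'m space \<Rightarrow> real" and W :: "'m space \<Rightarrow> 'm space" and R :: real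
  assumes R: "0 < R" "R \<le> 1"
    and cont_w: "continuous_on (closed_half R) w" and cont_W: "continuous_on (closed_half R) W"
    and GDERIV_w: "\<And>x. x \<in> ball 0 R \<Longrightarrow> x \<in> upper \<Longrightarrow> GDERIV w x :> W x"
    and w_thin: "\<And>x. x \<in> thin_ball \<Longrightarrow> x \<in> ball 0 R \<Longrightarrow> w x * snd (G x) \<le> 0"
begin

definition H :: "'m space set" where "H = ball 0 R \<inter> upper"

lemma H: "open H" "H \<subseteq> closed_half R" "H \<subseteq> half_ball" "H \<in> sets borel"
proof -
  show "open H" using open_upper unfolding H_def by (intro open_Int) auto
  then show "H \<in> sets borel" by (rule borel_open)
qed (use R in \<open>auto simp: H_def closed_half_def half_ball_def upper_def\<close>)

lemma closed_half_R: "closed_half R \<subseteq> closed_half 1"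
  by (rule closed_half_mono) (use R in simp)

lemma measurable_H [measurable]:
  "(\<lambda>x. indicator H x * w x) \<in> borel_measurable borel"
  "(\<lambda>x. indicator H x *\<^sub>R W x) \<in> borel_measurable borel"
  "(\<lambda>x. indicator H x *\<^sub>R G x) \<in> borel_measurable borel"
proof -
  have c: "continuous_on H w" "continuous_on H W" "continuous_on H G"
    using H closed_half_R by (auto intro: continuous_on_subset[OF cont_w]
      continuous_on_subset[OF cont_W] continuous_on_subset[OF cont_G])
  show "(\<lambda>x. indicator H x * w x) \<in> borel_measurable borel"
    using borel_measurable_continuous_on_indicator[OF H(4) c(1)] by simp
  show "(\<lambda>x. indicator H x *\<^sub>R W x) \<in> borel_measurable borel"
    by (rule borel_measurable_continuous_on_indicator[OF H(4) c(2)])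
  show "(\<lambda>x. indicator H x *\<^sub>R G x) \<in> borel_measurable borel"
    by (rule borel_measurable_continuous_on_indicator[OF H(4) c(3)])
qed

text \<open>This is the integrand of the weak equation for the function
  \<open>P (x \<bullet> x) * w x\<close>. Taking the radial cutoff as a function of the squared norm
  keeps it differentiable at the origin, with gradient \<open>2 * P' (x \<bullet> x)\<close> times
  \<open>x\<close>.\<close>

definition energy :: "(real \<Rightarrow> real) \<Rightarrow> (real \<Rightarrow> real) \<Rightarrow> 'm space \<Rightarrow> real" where
  "energy P P' x = P (x \<bullet> x) * (G x \<bullet> W x + f x * w x) + 2 * P' (x \<bullet> x) * (w x * (G x \<bullet> x))"

text \<open>A test function has to stay away from the thin ball, which the extra factor
  \<open>\<zeta> (snd x)\<close> ensures. The term with \<open>\<zeta>'\<close> is what becomes the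
  boundary term on the thin ball once this cutoff is removed.\<close>

lemma weak_cutoff:
  assumes P: "\<And>t. (P has_real_derivative P' t) (at t)" "continuous_on UNIV P'"
      "\<And>t. \<beta> \<le> t \<Longrightarrow> P t = 0" "\<And>t. \<beta> \<le> t \<Longrightarrow> P' t = 0" "\<beta> < R\<^sup>2"
    and \<zeta>: "\<And>t. (\<zeta> has_real_derivative \<zeta>' t) (at t)" "continuous_on UNIV \<zeta>'"
      "\<And>t. t \<le> \<delta> \<Longrightarrow> \<zeta> t = 0" "\<And>t. t \<le> \<delta> \<Longrightarrow> \<zeta>' t = 0" "0 < \<delta>"
  shows "(\<integral>x. indicator H x * (\<zeta> (snd x) * energy P P' x
      + \<zeta>' (snd x) * (P (x \<bullet> x) * (w x * snd (G x)))) \<partial>lborel) = 0"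
proof -
  define K :: "'m space set" where "K = {x. x \<bullet> x \<le> \<beta> \<and> \<delta> \<le> snd x}"
  define g0 where "g0 x = w x *\<^sub>R (P (x \<bullet> x) *\<^sub>R (\<zeta>' (snd x) *\<^sub>R (0, 1))
      + \<zeta> (snd x) *\<^sub>R (P' (x \<bullet> x) *\<^sub>R (2 *\<^sub>R x))) + (P (x \<bullet> x) * \<zeta> (snd x)) *\<^sub>R W x" for x
  \<comment> \<open>\<open>w\<close> and \<open>W\<close> are controlled only up to radius
    \<open>R\<close> in the upper half. Truncating at the boundary of \<open>H\<close> preserves
    smoothness because the product already vanishes on \<open>H\<close> outside the compact set
    \<open>K\<close>.\<close>
  define \<phi> where "\<phi> x = (if x \<in> H then w x * (P (x \<bullet> x) * \<zeta> (snd x)) else 0)" for x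
  define g where "g x = (if x \<in> H then g0 x else 0)" for x
  have norm_less: "norm x < R" if "x \<bullet> x \<le> \<beta>" for x :: "'m space"
  proof -
    have "(norm x)\<^sup>2 < R\<^sup>2" using that P(5) by (simp add: dot_square_norm)
    then show ?thesis using R by (simp add: power2_less_imp_less)
  qed
  have KH: "K \<subseteq> H" using norm_less \<zeta>(5) by (auto simp: K_def H_def upper_def)
  have "closed K" unfolding K_def
    by (intro closed_Collect_conj closed_Collect_le continuous_intros)
  moreover have "bounded K" by (rule bounded_subset[of "ball 0 R"]) (use KH in \<open>auto simp: H_def\<close>)
  ultimately have K: "compact K" by (simp add: compact_eq_bounded_closed)
  have offK: "\<phi> x = 0" "g x = 0" if "x \<notin> K" for x
  proof -
    have "\<beta> \<le> x \<bullet> x \<or> snd x \<le> \<delta>" using that by (auto simp: K_def)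
    then show "\<phi> x = 0" "g x = 0" using P(3,4) \<zeta>(3,4) by (auto simp: \<phi>_def g_def g0_def zero_prod_def)
  qed
  have d\<phi>: "GDERIV \<phi> x :> g x" for x
  proof (cases "x \<in> H")
    case True
    have 1: "GDERIV w x :> W x" using GDERIV_w True by (simp add: H_def)
    have 2: "GDERIV (\<lambda>x. P (x \<bullet> x)) x :> P' (x \<bullet> x) *\<^sub>R (2 *\<^sub>R x)"
      by (rule GDERIV_DERIV_compose[OF _ P(1)])
        (auto simp: gderiv_def inner_commute intro!: derivative_eq_intros)
    have 3: "GDERIV (\<lambda>x. \<zeta> (snd x)) x :> \<zeta>' (snd x) *\<^sub>R (0, 1)"
      by (rule GDERIV_DERIV_compose[OF _ \<zeta>(1)])
        (auto simp: gderiv_def inner_prod_def intro!: derivative_eq_intros)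
    have "GDERIV (\<lambda>x. w x * (P (x \<bullet> x) * \<zeta> (snd x))) x :> g0 x"
      unfolding g0_def by (rule GDERIV_mult[OF 1 GDERIV_mult[OF 2 3]])
    then have "FDERIV \<phi> x :> (\<lambda>h. h \<bullet> g0 x)"
      unfolding gderiv_def
      by (rule has_derivative_transform_within_open[OF _ H(1) True]) (simp add: \<phi>_def)
    then show ?thesis using True by (simp add: gderiv_def g_def)
  next
    case False
    then have "x \<in> - K" using KH by auto
    moreover have "FDERIV (\<lambda>x. 0::real) x :> (\<lambda>h. h \<bullet> g x)"
      using False by (simp add: g_def)
    ultimately show ?thesis
      unfolding gderiv_def
      using compact_imp_closed[OF K] offK
      by (intro has_derivative_transform_within_open[of "\<lambda>x. 0::real" _ x UNIV "- K" \<phi>]) auto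
  qed
  have cP: "continuous_on UNIV P" "continuous_on UNIV \<zeta>"
    using P(1) \<zeta>(1) by (auto intro!: DERIV_isCont continuous_at_imp_continuous_on)
  have "continuous_on H g0"
    unfolding g0_def
    by (intro continuous_intros continuous_on_subset[OF cont_w H(2)] continuous_on_subset[OF cont_W H(2)]
        continuous_on_compose2[OF cP(1)] continuous_on_compose2[OF cP(2)]
        continuous_on_compose2[OF P(2)] continuous_on_compose2[OF \<zeta>(2)]) auto
  then have "continuous_on H g" by (rule continuous_on_eq) (simp add: g_def)
  moreover have "continuous_on (- K) g"
    by (rule continuous_on_eq[of _ "\<lambda>_. 0"]) (use offK in auto)
  ultimately have "continuous_on (H \<union> - K) g"
    using H(1) compact_imp_closed[OF K] by (intro continuous_on_open_Un) auto
  moreover have "H \<union> - K = UNIV" using KH by auto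
  ultimately have cg: "continuous_on UNIV g" by simp
  have "(\<integral>x. indicator half_ball x * (G x \<bullet> g x + f x * \<phi> x) \<partial>lborel) = 0"
    by (rule weak[OF d\<phi> cg K _ offK(1)]) (use KH H in auto)
  moreover have "indicator half_ball x * (G x \<bullet> g x + f x * \<phi> x) =
      indicator H x * (\<zeta> (snd x) * energy P P' x + \<zeta>' (snd x) * (P (x \<bullet> x) * (w x * snd (G x))))" for x
  proof (cases "x \<in> H")
    case True
    then have "x \<in> half_ball" using H by auto
    moreover have "G x \<bullet> (0, 1) = snd (G x)" by (simp add: inner_prod_def)
    ultimately show ?thesis using True
      by (simp add: g_def g0_def \<phi>_def energy_def inner_add_right algebra_simps del: scaleR_Pair)
  qed (simp add: g_def \<phi>_def)
  ultimately show ?thesis by simp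
qed

lemma measurable_energy:
  assumes "continuous_on UNIV P" "continuous_on UNIV P'"
  shows "(\<lambda>x. indicator H x * energy P P' x) \<in> borel_measurable borel"
proof -
  have [measurable]: "P \<in> borel_measurable borel" "P' \<in> borel_measurable borel"
    using assms by (auto intro: borel_measurable_continuous_onI)
  have "(\<lambda>x. P (x \<bullet> x) * ((indicator H x *\<^sub>R G x) \<bullet> (indicator H x *\<^sub>R W x) + f x * (indicator H x * w x))
      + 2 * P' (x \<bullet> x) * ((indicator H x * w x) * ((indicator H x *\<^sub>R G x) \<bullet> x))) \<in> borel_measurable borel"
    by measurable
  also have "(\<lambda>x. P (x \<bullet> x) * ((indicator H x *\<^sub>R G x) \<bullet> (indicator H x *\<^sub>R W x) + f x * (indicator H x * w x))
      + 2 * P' (x \<bullet> x) * ((indicator H x * w x) * ((indicator H x *\<^sub>R G x) \<bullet> x))) =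
      (\<lambda>x. indicator H x * energy P P' x)"
    by (auto simp: energy_def indicator_def)
  finally show ?thesis .
qed

text \<open>\<open>w\<close> and \<open>W\<close> need not be bounded near the sphere of radius
  \<open>R\<close>; the estimates are made on this slice, which contains the part of the support of
  the radial cutoffs in the upper half space.\<close>

lemma compact_slice:
  assumes "\<beta> < R\<^sup>2"
  shows "compact {x :: 'm space. x \<bullet> x \<le> \<beta> \<and> 0 \<le> snd x}"
    and "{x :: 'm space. x \<bullet> x \<le> \<beta> \<and> 0 \<le> snd x} \<subseteq> closed_half R"
proof -
  have norm_less: "norm x < R" if "x \<bullet> x \<le> \<beta>" for x :: "'m space"
  proof -
    have "(norm x)\<^sup>2 < R\<^sup>2" using that assms by (simp add: dot_square_norm)
    then show ?thesis using R by (simp add: power2_less_imp_less)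
  qed
  then show C: "{x :: 'm space. x \<bullet> x \<le> \<beta> \<and> 0 \<le> snd x} \<subseteq> closed_half R"
    by (auto simp: closed_half_def)
  have "closed {x :: 'm space. x \<bullet> x \<le> \<beta> \<and> 0 \<le> snd x}"
    by (intro closed_Collect_conj closed_Collect_le continuous_intros)
  moreover have "bounded {x :: 'm space. x \<bullet> x \<le> \<beta> \<and> 0 \<le> snd x}"
    by (rule bounded_subset[of "ball 0 R"]) (use C in \<open>auto simp: closed_half_def\<close>)
  ultimately show "compact {x :: 'm space. x \<bullet> x \<le> \<beta> \<and> 0 \<le> snd x}"
    by (simp add: compact_eq_bounded_closed)
qed

lemma norm_f_le: "norm x \<le> 1 \<Longrightarrow> \<bar>f x\<bar> \<le> M"
  using f_le[of x] M power_le_one[of "norm x" "k - 1"] by (smt (verit) mult_left_le norm_ge_zero)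

lemma comparison_bounded:
  assumes "\<beta> < R\<^sup>2"
  obtains c where "0 \<le> c"
    "\<And>x. x \<bullet> x \<le> \<beta> \<Longrightarrow> 0 \<le> snd x \<Longrightarrow> \<bar>G x \<bullet> W x + f x * w x\<bar> \<le> c"
    "\<And>x. x \<bullet> x \<le> \<beta> \<Longrightarrow> 0 \<le> snd x \<Longrightarrow> \<bar>w x * (G x \<bullet> x)\<bar> \<le> c"
    "\<And>x. x \<bullet> x \<le> \<beta> \<Longrightarrow> 0 \<le> snd x \<Longrightarrow> \<bar>w x * snd (G x)\<bar> \<le> c"
proof -
  define C :: "'m space set" where "C = {x. x \<bullet> x \<le> \<beta> \<and> 0 \<le> snd x}"
  have C: "compact C" "C \<subseteq> closed_half R" unfolding C_def using compact_slice[OF assms] by auto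
  have "bounded (w ` C)" "bounded (W ` C)"
    using C by (auto intro!: compact_imp_bounded compact_continuous_image
        intro: continuous_on_subset[OF cont_w] continuous_on_subset[OF cont_W])
  then obtain a b where a: "\<forall>x\<in>C. \<bar>w x\<bar> \<le> a" and b: "\<forall>x\<in>C. norm (W x) \<le> b"
    by (auto simp: bounded_iff)
  define c where "c = M * \<bar>b\<bar> + M * \<bar>a\<bar>"
  have "\<bar>G x \<bullet> W x + f x * w x\<bar> \<le> c \<and> \<bar>w x * (G x \<bullet> x)\<bar> \<le> c \<and> \<bar>w x * snd (G x)\<bar> \<le> c"
    if x: "x \<in> C" for x
  proof -
    have x1: "x \<in> closed_half 1" using x C(2) closed_half_R by blast
    then have n1: "norm x \<le> 1" by (simp add: closed_half_def)
    have w: "\<bar>w x\<bar> \<le> \<bar>a\<bar>" "norm (W x) \<le> \<bar>b\<bar>" using a b x by force+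
    have snd: "\<bar>snd (G x)\<bar> \<le> norm (G x)" using norm_snd_le[of "snd (G x)" "fst (G x)"] by simp
    have "\<bar>G x \<bullet> W x\<bar> \<le> norm (G x) * norm (W x)" by (rule Cauchy_Schwarz_ineq2)
    also have "\<dots> \<le> M * \<bar>b\<bar>" using G_le[OF x1] w M by (intro mult_mono) auto
    finally have 1: "\<bar>G x \<bullet> W x\<bar> \<le> M * \<bar>b\<bar>" .
    have 2: "\<bar>f x * w x\<bar> \<le> M * \<bar>a\<bar>"
      unfolding abs_mult using norm_f_le[OF n1] w M by (intro mult_mono) auto
    have "\<bar>G x \<bullet> x\<bar> \<le> norm (G x) * norm x" by (rule Cauchy_Schwarz_ineq2)
    also have "\<dots> \<le> M * 1" using G_le[OF x1] n1 M by (intro mult_mono) auto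
    finally have 3: "\<bar>w x * (G x \<bullet> x)\<bar> \<le> \<bar>a\<bar> * M"
      unfolding abs_mult using w M by (intro mult_mono) auto
    have 4: "\<bar>w x * snd (G x)\<bar> \<le> \<bar>a\<bar> * M"
      unfolding abs_mult using w M order_trans[OF snd G_le[OF x1]] by (intro mult_mono) auto
    have "\<bar>G x \<bullet> W x + f x * w x\<bar> \<le> c"
      using abs_triangle_ineq[of "G x \<bullet> W x" "f x * w x"] 1 2 unfolding c_def by linarith
    moreover have "\<bar>a\<bar> * M \<le> c" using M by (simp add: c_def mult.commute)
    ultimately show ?thesis using 3 4 by linarith
  qed
  moreover have "0 \<le> c" using M by (simp add: c_def)
  ultimately show ?thesis by (intro that) (auto simp: C_def)
qed

text \<open>The bound sees the cutoffs only through \<open>\<beta>\<close> and \<open>B\<close>, so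
  it gives a common dominating function for a whole sequence of them.\<close>

lemma energy_bounded:
  assumes "\<beta> < R\<^sup>2"
  obtains E where "0 \<le> E"
    "\<And>P P' B x. (\<And>t. \<beta> \<le> t \<Longrightarrow> P t = 0) \<Longrightarrow> (\<And>t. \<beta> \<le> t \<Longrightarrow> P' t = 0) \<Longrightarrow>
        (\<And>t. \<bar>P t\<bar> \<le> B) \<Longrightarrow> (\<And>t. \<bar>P' t\<bar> \<le> B) \<Longrightarrow> \<bar>indicator H x * energy P P' x\<bar> \<le> B * E"
proof -
  obtain c where c: "0 \<le> c"
    "\<And>x. x \<bullet> x \<le> \<beta> \<Longrightarrow> 0 \<le> snd x \<Longrightarrow> \<bar>G x \<bullet> W x + f x * w x\<bar> \<le> c"
    "\<And>x. x \<bullet> x \<le> \<beta> \<Longrightarrow> 0 \<le> snd x \<Longrightarrow> \<bar>w x * (G x \<bullet> x)\<bar> \<le> c"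
    by (rule comparison_bounded[OF assms]) blast
  have "\<bar>indicator H x * energy P P' x\<bar> \<le> B * (3 * c)"
    if P: "\<And>t. \<beta> \<le> t \<Longrightarrow> P t = 0" "\<And>t. \<beta> \<le> t \<Longrightarrow> P' t = 0"
      and B: "\<And>t. \<bar>P t\<bar> \<le> B" "\<And>t. \<bar>P' t\<bar> \<le> B" for P P' B x
  proof (cases "x \<in> H \<and> x \<bullet> x \<le> \<beta>")
    case False
    have "0 \<le> B" using B(1)[of 0] by simp
    moreover have "indicator H x * energy P P' x = 0"
      using False P by (auto simp: energy_def indicator_def)
    ultimately show ?thesis using c(1) by (simp only: abs_zero mult_nonneg_nonneg)
  next
    case True
    then have x: "x \<bullet> x \<le> \<beta>" "0 \<le> snd x" by (auto simp: H_def upper_def)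
    have B0: "0 \<le> B" using B(1)[of 0] by simp
    have "\<bar>P (x \<bullet> x) * (G x \<bullet> W x + f x * w x)\<bar> \<le> B * c"
      unfolding abs_mult using c(2)[OF x] B B0 by (intro mult_mono) auto
    moreover have "\<bar>P' (x \<bullet> x) * (w x * (G x \<bullet> x))\<bar> \<le> B * c"
      unfolding abs_mult[of "P' (x \<bullet> x)"] using c(3)[OF x] B B0 by (intro mult_mono) auto
    ultimately have "\<bar>energy P P' x\<bar> \<le> B * c + 2 * (B * c)" unfolding energy_def by linarith
    then show ?thesis using True by simp
  qed
  then show ?thesis using c(1) by (intro that[of "3 * c"]) auto
qed

text \<open>Moving a point vertically onto the thin ball changes \<open>w * snd (G x)\<close> by
  less than \<open>\<epsilon>\<close>, uniformly on the compact slice, and on the thin ball the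
  product is at most 0.\<close>

lemma thin_limit:
  assumes "\<beta> < R\<^sup>2" "0 < \<epsilon>"
  shows "\<exists>d>0. \<forall>x. x \<bullet> x \<le> \<beta> \<longrightarrow> 0 \<le> snd x \<longrightarrow> snd x \<le> d \<longrightarrow> w x * snd (G x) \<le> \<epsilon>"
proof -
  define C :: "'m space set" where "C = {x. x \<bullet> x \<le> \<beta> \<and> 0 \<le> snd x}"
  have "compact C" and C: "C \<subseteq> closed_half R"
    unfolding C_def using compact_slice[OF assms(1)] by auto
  moreover have "continuous_on C (\<lambda>x. w x * snd (G x))"
    using C closed_half_R
    by (intro continuous_intros) (auto intro: continuous_on_subset[OF cont_w] continuous_on_subset[OF cont_G])
  ultimately have "uniformly_continuous_on C (\<lambda>x. w x * snd (G x))"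
    by (simp add: compact_uniformly_continuous)
  then obtain d where d: "0 < d" "\<And>x y. x \<in> C \<Longrightarrow> y \<in> C \<Longrightarrow> dist y x < d \<Longrightarrow>
      dist (w y * snd (G y)) (w x * snd (G x)) < \<epsilon>"
    using assms unfolding uniformly_continuous_on_def by metis
  have "w x * snd (G x) \<le> \<epsilon>" if x: "x \<bullet> x \<le> \<beta>" "0 \<le> snd x" "snd x \<le> d / 2" for x
  proof -
    define y where "y = (fst x, 0::real)"
    have "y \<bullet> y \<le> x \<bullet> x" by (simp add: y_def inner_prod_def)
    then have y: "y \<in> C" using x by (auto simp: C_def y_def)
    then have "y \<in> ball 0 R" using C by (auto simp: closed_half_def)
    have "dist x y = \<bar>snd x\<bar>" by (simp add: y_def dist_prod_def)
    then have "dist (w x * snd (G x)) (w y * snd (G y)) < \<epsilon>"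
      using x d(1) y by (intro d(2)) (auto simp: C_def)
    moreover have "w y * snd (G y) \<le> 0"
      by (rule w_thin) (use \<open>y \<in> ball 0 R\<close> R in \<open>auto simp: thin_ball_def y_def\<close>)
    ultimately show ?thesis by (simp add: dist_real_def)
  qed
  then show ?thesis using d(1) by (intro exI[of _ "d / 2"]) auto
qed

lemma integrable_H:
  fixes F :: "'m space \<Rightarrow> real"
  assumes [measurable]: "F \<in> borel_measurable borel" and "\<And>x. \<bar>F x\<bar> \<le> B" "\<And>x. x \<notin> H \<Longrightarrow> F x = 0"
  shows "integrable lborel F"
proof -
  have "integrable lborel (\<lambda>x. indicator (ball 0 1) x * F x)"
    by (rule integrable_on_ball) (use assms in auto)
  also have "(\<lambda>x. indicator (ball 0 1) x * F x) = F"
    using assms(3) R by (force simp: indicator_def H_def)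
  finally show ?thesis .
qed

text \<open>By \<open>weak_cutoff\<close>, the integral of the energy weighted with the vertical
  cutoff is minus that of \<open>z' * P * w * snd G\<close>. The slope \<open>z'\<close> is at most
  \<open>1 / d\<close> on a slab of thickness \<open>2 * d\<close>, so by \<open>thin_limit\<close>
  the result is at least minus a multiple of \<open>\<epsilon>\<close>; then the cutoff tends to 1
  in the half ball.\<close>

lemma energy_nonneg:
  assumes P: "\<And>t. (P has_real_derivative P' t) (at t)" "continuous_on UNIV P'"
      "\<And>t. \<beta> \<le> t \<Longrightarrow> P t = 0" "\<And>t. \<beta> \<le> t \<Longrightarrow> P' t = 0" "\<beta> < R\<^sup>2"
    and B: "\<And>t. 0 \<le> P t" "\<And>t. P t \<le> B" "\<And>t. \<bar>P' t\<bar> \<le> B"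
  shows "0 \<le> (\<integral>x. indicator H x * energy P P' x \<partial>lborel)"
proof -
  have B0: "0 \<le> B" using B(3)[of 0] by simp
  define A where "A x = indicator H x * energy P P' x" for x
  define T where "T x = indicator H x * (P (x \<bullet> x) * (w x * snd (G x)))" for x
  have cP: "continuous_on UNIV P"
    using P(1) by (auto intro!: DERIV_isCont continuous_at_imp_continuous_on)
  have [measurable]: "A \<in> borel_measurable borel" unfolding A_def by (rule measurable_energy[OF cP P(2)])
  have [measurable]: "T \<in> borel_measurable borel"
  proof -
    have [measurable]: "P \<in> borel_measurable borel" using cP by (rule borel_measurable_continuous_onI)
    have "(\<lambda>x. P (x \<bullet> x) * ((indicator H x * w x) * ((indicator H x *\<^sub>R G x) \<bullet> (0, 1)))) \<in> borel_measurable borel"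
      by measurable
    also have "(\<lambda>x. P (x \<bullet> x) * ((indicator H x * w x) * ((indicator H x *\<^sub>R G x) \<bullet> (0, 1)))) = T"
      by (auto simp: T_def indicator_def inner_prod_def)
    finally show ?thesis .
  qed
  obtain E where E: "0 \<le> E" "\<And>x. \<bar>A x\<bar> \<le> E"
  proof -
    obtain E' where E': "0 \<le> E'"
      "\<And>P P' B x. (\<And>t. \<beta> \<le> t \<Longrightarrow> P t = 0) \<Longrightarrow> (\<And>t. \<beta> \<le> t \<Longrightarrow> P' t = 0) \<Longrightarrow>
        (\<And>t. \<bar>P t\<bar> \<le> B) \<Longrightarrow> (\<And>t. \<bar>P' t\<bar> \<le> B) \<Longrightarrow> \<bar>indicator H x * energy P P' x\<bar> \<le> B * E'"
      by (rule energy_bounded[OF P(5)]) blast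
    have "\<bar>A x\<bar> \<le> B * E'" for x
      unfolding A_def using P B by (intro E'(2)) auto
    then show ?thesis using that[of "B * E'"] B0 E'(1) by simp
  qed
  \<comment> \<open>Rises from 0 to 1 between \<open>d\<close> and \<open>3 * d\<close>: two copies
    of the same smoothed ramp are subtracted, one shifted by a unit of \<open>t / d\<close>.\<close>
  define z where "z d t = cramp 0 (t / d - 1) - cramp 0 (t / d - 2)" for d t
  define z' where "z' d t = (cramp' 0 (t / d - 1) - cramp' 0 (t / d - 2)) / d" for d t
  have z: "(z d has_real_derivative z' d t) (at t)" if "0 < d" for d t
  proof -
    have "((\<lambda>t. cramp 0 (t / d - c)) has_real_derivative cramp' 0 (t / d - c) * (1 / d)) (at t)" for c
      by (rule DERIV_chain2[OF DERIV_cramp]) (use that in \<open>auto intro!: derivative_eq_intros\<close>)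
    from DERIV_diff[OF this[of 1] this[of 2]] show ?thesis
      unfolding z_def z'_def by (simp add: diff_divide_distrib)
  qed
  have cz': "continuous_on UNIV (z' d)" if "0 < d" for d
    unfolding z'_def using that by (intro continuous_intros) auto
  have cz: "continuous_on UNIV (z d)" if "0 < d" for d
    using z[OF that] by (auto intro!: DERIV_isCont continuous_at_imp_continuous_on)
  have z_snd: "(\<lambda>x::'m space. z d (snd x)) \<in> borel_measurable borel"
    "(\<lambda>x::'m space. z' d (snd x)) \<in> borel_measurable borel" if "0 < d" for d
    using continuous_on_compose2[OF cz[OF that] continuous_on_snd[OF continuous_on_id]]
      continuous_on_compose2[OF cz'[OF that] continuous_on_snd[OF continuous_on_id]]
    by (auto intro!: borel_measurable_continuous_onI)
  have z_0: "z d t = 0" "z' d t = 0" if "0 < d" "t \<le> d" for d t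
  proof -
    have "t / d - 1 \<le> 0" "t / d - 2 \<le> 0" using that by (auto simp: field_simps)
    then show "z d t = 0" "z' d t = 0" by (simp_all add: z_def z'_def cramp_nonpos)
  qed
  have z_1: "z d t = 1" "z' d t = 0" if "0 < d" "3 * d \<le> t" for d t
  proof -
    have "1 / Suc 0 \<le> t / d - 1" "1 / Suc 0 \<le> t / d - 2" using that by (auto simp: field_simps)
    then show "z d t = 1" "z' d t = 0" by (simp_all add: z_def z'_def cramp_ge)
  qed
  have z'_b: "0 \<le> z' d t" "z' d t \<le> 1 / d" if "0 < d" for d t
  proof -
    have "0 \<le> cramp' 0 (t / d - 1) - cramp' 0 (t / d - 2)"
      by (auto simp: cramp'_def max_def)
    then show "0 \<le> z' d t" unfolding z'_def using that by (intro divide_nonneg_nonneg) auto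
    have "cramp' 0 (t / d - 1) - cramp' 0 (t / d - 2) \<le> 1"
      using cramp'_bounds[of 0 "t / d - 1"] cramp'_bounds[of 0 "t / d - 2"] by linarith
    then show "z' d t \<le> 1 / d" unfolding z'_def using that by (intro divide_right_mono) auto
  qed
  have z_b: "\<bar>z d t\<bar> \<le> 1" if "0 < d" for d t
  proof (cases "3 * d \<le> t")
    case False
    have "z d t \<le> z d (3 * d)" "z d 0 \<le> z d (max 0 t)"
      by (rule DERIV_nonneg_imp_nondecreasing; use z[OF that] z'_b[OF that] False in force)+
    then show ?thesis using z_1[of d "3 * d"] z_0[of d 0] z_0[of d t] that by (auto simp: max_def split: if_splits)
  qed (simp add: z_1 that)
  have eq0: "(\<integral>x. indicator H x * (z d (snd x) * energy P P' x
      + z' d (snd x) * (P (x \<bullet> x) * (w x * snd (G x)))) \<partial>lborel) = 0" if "0 < d" for d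
    by (rule weak_cutoff[OF P z[OF that] cz'[OF that] z_0[OF that] that])
  have ev_small: "\<forall>\<^sub>F i in sequentially. 1 / real (Suc i) < a" if "0 < a" for a
    using order_tendstoD(2)[OF LIMSEQ_inverse_real_of_nat that] by (simp add: inverse_eq_divide)
  \<comment> \<open>The cube with corners \<open>- Q\<close> and \<open>Q\<close> contains the
    projection of the unit ball along the last coordinate; its volume \<open>L\<close> bounds the
    cross section of the slab.\<close>
  define Q :: "(real,'m) vec" where "Q = One"
  define L where "L = measure lborel (cbox (- Q) Q)"
  have L: "0 \<le> L" by (simp add: L_def)
  have low: "- (2 * L * (B * \<epsilon>)) \<le> (\<integral>x. z d (snd x) * A x \<partial>lborel)"
    if d: "0 < d" and \<epsilon>: "0 < \<epsilon>" and thin: "\<And>x. x \<bullet> x \<le> \<beta> \<Longrightarrow> 0 \<le> snd x \<Longrightarrow> snd x \<le> 3 * d \<Longrightarrow> w x * snd (G x) \<le> \<epsilon>"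
    for d \<epsilon>
  proof -
    note [measurable] = z_snd[OF d]
    define S where "S = cbox (- Q, d) (Q, 3 * d)"
    have Tup: "z' d (snd x) * T x \<le> indicator S x * (1 / d * (B * \<epsilon>))" for x
    proof (cases "x \<in> H \<and> x \<bullet> x < \<beta> \<and> d \<le> snd x \<and> snd x \<le> 3 * d")
      case True
      have "norm (fst x) \<le> norm x" by (simp add: norm_prod_def real_le_rsqrt)
      moreover have "norm x < 1" using True R by (auto simp: H_def)
      ultimately have n1: "\<bar>fst x \<bullet> i\<bar> \<le> 1" if "i \<in> Basis" for i
        using Basis_le_norm[OF that, of "fst x"] by linarith
      have "fst x \<in> cbox (- Q) Q"
        using n1 by (force simp: Q_def mem_box abs_le_iff)
      then have xS: "x \<in> S" using True by (simp add: S_def cbox_Pair_eq mem_Times_iff)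
      have "T x \<le> B * \<epsilon>"
      proof -
        have "w x * snd (G x) \<le> \<epsilon>" by (rule thin) (use True d in auto)
        then have "P (x \<bullet> x) * (w x * snd (G x)) \<le> P (x \<bullet> x) * \<epsilon>" using B(1) by (intro mult_left_mono) auto
        also have "\<dots> \<le> B * \<epsilon>" using B(2) \<epsilon> by (intro mult_right_mono) auto
        finally show ?thesis using True by (simp add: T_def)
      qed
      then have "z' d (snd x) * T x \<le> z' d (snd x) * (B * \<epsilon>)"
        using z'_b[OF d] by (intro mult_left_mono) auto
      also have "\<dots> \<le> 1 / d * (B * \<epsilon>)" using z'_b[OF d] B0 \<epsilon> by (intro mult_right_mono) auto
      finally show ?thesis using xS by simp
    next
      case False
      then have "x \<notin> H \<or> P (x \<bullet> x) = 0 \<or> z' d (snd x) = 0"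
        using P(3)[of "x \<bullet> x"] z_0(2)[OF d, of "snd x"] z_1(2)[OF d, of "snd x"] by force
      then have "z' d (snd x) * T x = 0" by (auto simp: T_def)
      then show ?thesis using d B0 \<epsilon> by (auto simp: indicator_def)
    qed
    have split: "z d (snd x) * A x + z' d (snd x) * T x = indicator H x * (z d (snd x) * energy P P' x
      + z' d (snd x) * (P (x \<bullet> x) * (w x * snd (G x))))" for x
      by (simp add: A_def T_def algebra_simps)
    have iA: "integrable lborel (\<lambda>x. z d (snd x) * A x)"
    proof (rule integrable_H[where B=E])
      show "\<bar>z d (snd x) * A x\<bar> \<le> E" for x
        unfolding abs_mult using z_b[OF d, of "snd x"] E(2)[of x] by (smt (verit) mult_left_le_one_le abs_ge_zero)
      show "(\<lambda>x. z d (snd x) * A x) \<in> borel_measurable borel" by measurable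
      show "z d (snd x) * A x = 0" if "x \<notin> H" for x using that by (simp add: A_def)
    qed
    have iT: "integrable lborel (\<lambda>x. z' d (snd x) * T x)"
    proof -
      obtain c where c: "0 \<le> c" "\<And>x. x \<bullet> x \<le> \<beta> \<Longrightarrow> 0 \<le> snd x \<Longrightarrow> \<bar>w x * snd (G x)\<bar> \<le> c"
        by (rule comparison_bounded[OF P(5)]) blast
      have T_b: "\<bar>T x\<bar> \<le> B * c" for x
      proof (cases "x \<in> H \<and> x \<bullet> x \<le> \<beta>")
        case True
        then have "\<bar>w x * snd (G x)\<bar> \<le> c" by (intro c(2)) (auto simp: H_def upper_def)
        then have "\<bar>P (x \<bullet> x)\<bar> * \<bar>w x * snd (G x)\<bar> \<le> B * c"
          using B B0 by (intro mult_mono) auto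
        then show ?thesis using True by (simp add: T_def abs_mult)
      next
        case False
        then have "T x = 0" using P(3)[of "x \<bullet> x"] by (auto simp: T_def)
        then show ?thesis using B0 c(1) by simp
      qed
      show ?thesis
      proof (rule integrable_H[where B="1 / d * (B * c)"])
        show "\<bar>z' d (snd x) * T x\<bar> \<le> 1 / d * (B * c)" for x
          unfolding abs_mult using z'_b[OF d, of "snd x"] T_b[of x] d by (intro mult_mono) auto
        show "(\<lambda>x. z' d (snd x) * T x) \<in> borel_measurable borel" by measurable
        show "z' d (snd x) * T x = 0" if "x \<notin> H" for x using that by (simp add: T_def)
      qed
    qed
    have "(\<integral>x. z d (snd x) * A x \<partial>lborel) + (\<integral>x. z' d (snd x) * T x \<partial>lborel) = 0"
      using eq0[OF d] unfolding split[symmetric] by (subst Bochner_Integration.integral_add[symmetric, OF iA iT]) simp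
    moreover have "(\<integral>x. z' d (snd x) * T x \<partial>lborel) \<le> (\<integral>x. indicator S x * (1 / d * (B * \<epsilon>)) \<partial>lborel)"
    proof (rule integral_mono[OF iT])
      have "emeasure lborel S < \<infinity>" unfolding S_def by (rule emeasure_bounded_finite) simp
      then show "integrable lborel (\<lambda>x. indicator S x * (1 / d * (B * \<epsilon>)))"
        by (intro integrable_mult_left integrable_real_indicator) (auto simp: S_def)
    qed (rule Tup)
    moreover have "(\<integral>x. indicator S x * (1 / d * (B * \<epsilon>)) \<partial>lborel) = 2 * L * (B * \<epsilon>)"
    proof -
      have "measure lborel S = L * (3 * d - d)"
        unfolding S_def L_def content_Pair using d by simp
      then show ?thesis using d by (simp add: S_def)
    qed
    ultimately show ?thesis by linarith
  qed
  have lim: "(\<lambda>i. \<integral>x. z (1 / Suc i) (snd x) * A x \<partial>lborel) \<longlonglongrightarrow> (\<integral>x. A x \<partial>lborel)"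
  proof (rule integral_dominated_convergence)
    show "integrable lborel (\<lambda>x. indicator (ball 0 1) x * E)"
      by (rule integrable_on_ball[of "\<lambda>x. E"]) auto
    show "(\<lambda>x. z (1 / Suc i) (snd x) * A x) \<in> borel_measurable lborel" for i
    proof -
      have [measurable]: "(\<lambda>x::'m space. z (1 / Suc i) (snd x)) \<in> borel_measurable borel"
        by (rule z_snd) simp
      show ?thesis by measurable
    qed
    have "(\<lambda>i. z (1 / Suc i) (snd x) * A x) \<longlonglongrightarrow> A x" for x
    proof (cases "x \<in> H")
      case True
      then have "0 < snd x / 3" by (simp add: H_def upper_def)
      then have "\<forall>\<^sub>F i in sequentially. 1 / Suc i < snd x / 3"
        by (rule ev_small)
      then have "\<forall>\<^sub>F i in sequentially. z (1 / Suc i) (snd x) * A x = A x"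
        by eventually_elim (simp add: z_1)
      then show ?thesis by (rule tendsto_eventually)
    qed (simp add: A_def)
    then show "AE x in lborel. (\<lambda>i. z (1 / Suc i) (snd x) * A x) \<longlonglongrightarrow> A x" by simp
    have "norm (z (1 / Suc i) (snd x) * A x) \<le> indicator (ball 0 1) x * E" for i x
    proof (cases "x \<in> ball 0 1")
      case True
      have "\<bar>z (1 / Suc i) (snd x)\<bar> * \<bar>A x\<bar> \<le> 1 * E"
        using z_b[of "1 / Suc i"] E by (intro mult_mono) auto
      then show ?thesis using True by (simp add: abs_mult)
    next
      case False
      then have "A x = 0" using R by (auto simp: A_def H_def)
      then show ?thesis using E by simp
    qed
    then show "AE x in lborel. norm (z (1 / Suc i) (snd x) * A x) \<le> indicator (ball 0 1) x * E" for i by simp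
  qed simp
  have "0 \<le> (\<integral>x. A x \<partial>lborel)"
  proof (rule field_le_epsilon)
    fix e :: real assume e: "0 < e"
    define \<epsilon> where "\<epsilon> = e / (2 * L * B + 1)"
    have LB: "0 \<le> 2 * L * B" using L B0 by simp
    have \<epsilon>: "0 < \<epsilon>" unfolding \<epsilon>_def using e LB by (intro divide_pos_pos) linarith+
    obtain d where d: "0 < d" "\<And>x. x \<bullet> x \<le> \<beta> \<Longrightarrow> 0 \<le> snd x \<Longrightarrow> snd x \<le> d \<Longrightarrow> w x * snd (G x) \<le> \<epsilon>"
      using thin_limit[OF P(5) \<epsilon>] by blast
    have "0 < d / 3" using d by simp
    then have "\<forall>\<^sub>F i in sequentially. 1 / Suc i < d / 3"
      by (rule ev_small)
    then have "\<forall>\<^sub>F i in sequentially. - (2 * L * (B * \<epsilon>)) \<le> (\<integral>x. z (1 / Suc i) (snd x) * A x \<partial>lborel)"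
      by eventually_elim (rule low, use \<epsilon> d in auto)
    then have "- (2 * L * (B * \<epsilon>)) \<le> (\<integral>x. A x \<partial>lborel)"
      by (rule tendsto_lowerbound[OF lim]) simp
    moreover have "2 * L * (B * \<epsilon>) \<le> e"
    proof -
      have "2 * L * (B * \<epsilon>) = 2 * L * B * \<epsilon>" by simp
      also have "\<dots> \<le> (2 * L * B + 1) * \<epsilon>" using \<epsilon> by (intro mult_right_mono) auto
      also have "\<dots> = e"
      proof -
        have "2 * L * B + 1 \<noteq> 0" using LB by linarith
        then show ?thesis unfolding \<epsilon>_def by simp
      qed
      finally show ?thesis .
    qed
    ultimately show "0 \<le> (\<integral>x. A x \<partial>lborel) + e" by simp
  qed
  then show ?thesis unfolding A_def .
qed

section \<open>Green's inequality on full balls\<close>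

definition flux :: "'m space \<Rightarrow> real" where
  "flux x = indicator (ball 0 R) x * (w (up x) * (G (up x) \<bullet> up x))"

definition bulk :: "'m space \<Rightarrow> real" where
  "bulk x = indicator (ball 0 R) x * (G (up x) \<bullet> W (up x) + f (up x) * w (up x))"

lemma flux_continuous: "continuous_on (ball 0 R) flux"
  and flux_measurable [measurable]: "flux \<in> borel_measurable borel"
  and bulk_measurable [measurable]: "bulk \<in> borel_measurable borel"
proof -
  have upR: "up ` ball 0 R \<subseteq> closed_half R" "up ` ball 0 R \<subseteq> closed_half 1"
    using up_in_closed_half closed_half_R by blast+
  have cw: "continuous_on (ball 0 R) (\<lambda>x. w (up x))"
    by (rule continuous_on_compose2[OF cont_w _ upR(1)]) (intro continuous_intros)
  have cW: "continuous_on (ball 0 R) (\<lambda>x. W (up x))"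
    by (rule continuous_on_compose2[OF cont_W _ upR(1)]) (intro continuous_intros)
  have cG: "continuous_on (ball 0 R) (\<lambda>x. G (up x))"
    by (rule continuous_on_compose2[OF cont_G _ upR(2)]) (intro continuous_intros)
  show "continuous_on (ball 0 R) flux"
  proof (rule continuous_on_eq)
    show "continuous_on (ball 0 R) (\<lambda>x. w (up x) * (G (up x) \<bullet> up x))"
      by (intro continuous_intros cw cG)
  qed (simp add: flux_def)
  have ind[measurable]: "(\<lambda>x. indicator (ball 0 R) x * g x) \<in> borel_measurable borel"
    if "continuous_on (ball 0 R) g" for g :: "'m space \<Rightarrow> real"
    using borel_measurable_continuous_on_indicator[OF _ that] by simp
  show "flux \<in> borel_measurable borel"
    unfolding flux_def[abs_def] by (intro ind continuous_intros cw cG)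
  show "bulk \<in> borel_measurable borel"
  proof -
    have 1: "(\<lambda>x. indicator (ball 0 R) x * (G (up x) \<bullet> W (up x))) \<in> borel_measurable borel"
      by (intro ind continuous_intros cW cG)
    have 2: "(\<lambda>x. indicator (ball 0 R) x * w (up x)) \<in> borel_measurable borel"
      by (rule ind[OF cw])
    have 3: "(\<lambda>x. f (up x)) \<in> borel_measurable borel" by measurable
    have "bulk = (\<lambda>x. indicator (ball 0 R) x * (G (up x) \<bullet> W (up x)) + f (up x) * (indicator (ball 0 R) x * w (up x)))"
      by (auto simp: bulk_def indicator_def)
    then show ?thesis using 1 2 3 by simp
  qed
qed

lemma flux_bulk_bounded:
  assumes t: "0 < t" "t < R"
  shows "\<exists>c. \<forall>x\<in>ball 0 t. \<bar>flux x\<bar> \<le> c \<and> \<bar>bulk x\<bar> \<le> c"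
proof -
  have tR: "t\<^sup>2 < R\<^sup>2" using t by (auto intro!: power_strict_mono)
  obtain c where c:
    "\<And>x. x \<bullet> x \<le> t\<^sup>2 \<Longrightarrow> 0 \<le> snd x \<Longrightarrow> \<bar>G x \<bullet> W x + f x * w x\<bar> \<le> c"
    "\<And>x. x \<bullet> x \<le> t\<^sup>2 \<Longrightarrow> 0 \<le> snd x \<Longrightarrow> \<bar>w x * (G x \<bullet> x)\<bar> \<le> c"
    by (rule comparison_bounded[OF tR]) blast
  have "\<bar>flux x\<bar> \<le> c \<and> \<bar>bulk x\<bar> \<le> c" if x: "x \<in> ball 0 t" for x
  proof -
    have "(norm (up x))\<^sup>2 \<le> t\<^sup>2" using x by (intro power_mono) auto
    then have "up x \<bullet> up x \<le> t\<^sup>2" by (simp only: dot_square_norm)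
    moreover have "0 \<le> snd (up x)" by (simp add: up_def)
    moreover have "x \<in> ball 0 R" using x t by simp
    ultimately show ?thesis using c[of "up x"] by (simp add: flux_def bulk_def del: up_inner_up)
  qed
  then show ?thesis by blast
qed

text \<open>As a function of \<open>t = x \<bullet> x\<close>, the cutoff
  \<open>max 0 (s^2 - t) - max 0 (r^2 - t)\<close> is constant on the inner ball, has slope -1 on
  the annulus and vanishes beyond, so the term with \<open>P'\<close> leaves the flux over the
  annulus. Differences of \<open>cramp\<close> approximate it by admissible cutoffs.\<close>

lemma green_annulus:
  assumes r: "0 < r" and s: "r < s" "s < R"
  shows "2 * (ball_int s flux - ball_int r flux)
    \<le> (\<integral>x. (max 0 (s\<^sup>2 - x \<bullet> x) - max 0 (r\<^sup>2 - x \<bullet> x)) * bulk x \<partial>lborel)"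
proof -
  have rs: "r\<^sup>2 < s\<^sup>2" "s\<^sup>2 < R\<^sup>2" "s\<^sup>2 \<le> 1" "0 \<le> r\<^sup>2" using s r R by (auto intro!: power_strict_mono power_le_one)
  obtain B where B: "0 \<le> B"
    "\<And>P P' B' x. (\<And>t. s\<^sup>2 \<le> t \<Longrightarrow> P t = 0) \<Longrightarrow> (\<And>t. s\<^sup>2 \<le> t \<Longrightarrow> P' t = 0) \<Longrightarrow>
      (\<And>t. \<bar>P t\<bar> \<le> B') \<Longrightarrow> (\<And>t. \<bar>P' t\<bar> \<le> B') \<Longrightarrow> \<bar>indicator H x * energy P P' x\<bar> \<le> B' * B"
    by (rule energy_bounded[OF rs(2)]) blast
  define P where "P j t = cramp j (s\<^sup>2 - t) - cramp j (r\<^sup>2 - t)" for j t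
  define P' where "P' j t = - cramp' j (s\<^sup>2 - t) + cramp' j (r\<^sup>2 - t)" for j t
  have dP: "(P j has_real_derivative P' j t) (at t)" for j t
  proof -
    have "((\<lambda>t. cramp j (c - t)) has_real_derivative cramp' j (c - t) * (- 1)) (at t)" for c
      by (rule DERIV_chain2[OF DERIV_cramp]) (auto intro!: derivative_eq_intros)
    from DERIV_diff[OF this[of "s\<^sup>2"] this[of "r\<^sup>2"]] show ?thesis
      unfolding P_def P'_def by simp
  qed
  have cP': "continuous_on UNIV (P' j)" for j unfolding P'_def by (intro continuous_intros)
  have cP: "continuous_on UNIV (P j)" for j unfolding P_def by (intro continuous_intros)
  have [measurable]: "P j \<in> borel_measurable borel" "P' j \<in> borel_measurable borel" for j
    using cP cP' by (auto intro: borel_measurable_continuous_onI)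
  have P0: "P j t = 0" "P' j t = 0" if "s\<^sup>2 \<le> t" for j t
    using that rs by (auto simp: P_def P'_def cramp_nonpos)
  have Pb: "0 \<le> P j t" "P j t \<le> 1" "\<bar>P' j t\<bar> \<le> 1" for j t
  proof -
    show "0 \<le> P j t" using cramp_mono[of "r\<^sup>2 - t" "s\<^sup>2 - t" j] rs by (simp add: P_def)
    show "P j t \<le> 1" using cramp_lipschitz[of "r\<^sup>2 - t" "s\<^sup>2 - t" j] rs unfolding P_def by linarith
    show "\<bar>P' j t\<bar> \<le> 1" using cramp'_bounds[of j "r\<^sup>2 - t"] cramp'_bounds[of j "s\<^sup>2 - t"]
      by (auto simp: P'_def)
  qed
  define A where "A j x = P j (x \<bullet> x) * bulk x + 2 * P' j (x \<bullet> x) * flux x" for j x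
  have [measurable]: "A j \<in> borel_measurable borel" for j unfolding A_def by measurable
  have up_H: "up x \<in> H \<longleftrightarrow> x \<in> ball 0 R" if "snd x \<noteq> 0" for x
    using that norm_up[of x] by (simp add: H_def upper_def) (simp add: up_def)
  have A_up: "A j x = indicator H (up x) * energy (P j) (P' j) (up x)" if "snd x \<noteq> 0" for j x
    using up_H[OF that] by (auto simp: A_def bulk_def flux_def energy_def indicator_def)
  have A_nonneg: "0 \<le> (\<integral>x. A j x \<partial>lborel)" for j
  proof -
    have "(\<integral>x. A j x \<partial>lborel) = 2 * (\<integral>x. indicator H x * energy (P j) (P' j) x \<partial>lborel)"
    proof (rule half_ball_integral)
      show m: "(\<lambda>x. indicator H x * energy (P j) (P' j) x) \<in> borel_measurable borel"
        by (rule measurable_energy[OF cP cP'])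
      show "integrable lborel (\<lambda>x. indicator H x * energy (P j) (P' j) x)"
      proof (rule integrable_H[OF m])
        show "\<bar>indicator H x * energy (P j) (P' j) x\<bar> \<le> 1 * B" for x
          using P0 Pb by (intro B(2)) auto
      qed simp
    qed (use A_up in \<open>auto simp: H_def\<close>)
    moreover have "0 \<le> (\<integral>x. indicator H x * energy (P j) (P' j) x \<partial>lborel)"
      by (rule energy_nonneg[OF dP cP' P0 rs(2) Pb])
    ultimately show ?thesis by simp
  qed
  define A0 where "A0 x = (max 0 (s\<^sup>2 - x \<bullet> x) - max 0 (r\<^sup>2 - x \<bullet> x)) * bulk x
      + 2 * (indicator (ball 0 r) x * flux x - indicator (ball 0 s) x * flux x)" for x
  have "(\<lambda>j. \<integral>x. A j x \<partial>lborel) \<longlonglongrightarrow> (\<integral>x. A0 x \<partial>lborel)"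
  proof (rule integral_dominated_convergence)
    show "integrable lborel (\<lambda>x::'m space. indicator (ball 0 1) x * B)"
      by (rule integrable_on_ball[of "\<lambda>x. B"]) auto
    show "A0 \<in> borel_measurable lborel" unfolding A0_def by measurable
    have "norm (A j x) \<le> indicator (ball 0 1) x * B" if "snd x \<noteq> 0" for j x
    proof (cases "x \<in> ball 0 1")
      case True
      have "\<bar>indicator H (up x) * energy (P j) (P' j) (up x)\<bar> \<le> 1 * B"
        using P0 Pb by (intro B(2)) auto
      then show ?thesis using A_up[OF that] True by simp
    next
      case False
      then show ?thesis using R B(1) by (auto simp: A_def bulk_def flux_def)
    qed
    then show "AE x in lborel. norm (A j x) \<le> indicator (ball 0 1) x * B" for j
      using AE_snd_neq_0 by (auto elim: eventually_mono)
    have "(\<lambda>j. A j x) \<longlonglongrightarrow> A0 x" for x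
    proof -
      have b: "indicat_real (ball 0 t) x = (if 0 < t\<^sup>2 - x \<bullet> x then 1 else 0)" if "0 < t" for t
      proof -
        have "norm x < t \<longleftrightarrow> (norm x)\<^sup>2 < t\<^sup>2"
          using that by (meson norm_ge_zero less_imp_le power2_less_imp_less power_strict_mono zero_less_numeral)
        then show ?thesis by (simp add: indicator_def dot_square_norm)
      qed
      have ct: "(\<lambda>j. cramp' j (t\<^sup>2 - x \<bullet> x)) \<longlonglongrightarrow> indicat_real (ball 0 t) x" if "0 < t" for t
        unfolding b[OF that] by (rule cramp_tendsto(2))
      have "(\<lambda>j. A j x) \<longlonglongrightarrow> (max 0 (s\<^sup>2 - x \<bullet> x) - max 0 (r\<^sup>2 - x \<bullet> x)) * bulk x
        + 2 * (- indicator (ball 0 s) x + indicator (ball 0 r) x) * flux x"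
        unfolding A_def P_def P'_def using s r
        by (intro tendsto_intros ct cramp_tendsto(1)) auto
      moreover have "(max 0 (s\<^sup>2 - x \<bullet> x) - max 0 (r\<^sup>2 - x \<bullet> x)) * bulk x
        + 2 * (- indicator (ball 0 s) x + indicator (ball 0 r) x) * flux x = A0 x"
        by (simp add: A0_def algebra_simps)
      ultimately show ?thesis by simp
    qed
    then show "AE x in lborel. (\<lambda>j. A j x) \<longlonglongrightarrow> A0 x" by simp
  qed simp
  then have "0 \<le> (\<integral>x. A0 x \<partial>lborel)"
    by (rule tendsto_lowerbound) (use A_nonneg in auto)
  obtain c where c: "\<And>x. x \<in> ball 0 s \<Longrightarrow> \<bar>flux x\<bar> \<le> c" "\<And>x. x \<in> ball 0 s \<Longrightarrow> \<bar>bulk x\<bar> \<le> c"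
  proof -
    have "0 < s" using s r by simp
    from flux_bulk_bounded[OF this s(2)] that show ?thesis by blast
  qed
  have iFs: "integrable lborel (\<lambda>x. indicator (ball 0 s) x * flux x)"
    by (rule integrable_on_ball[OF flux_measurable]) (rule c)
  have iFr: "integrable lborel (\<lambda>x. indicator (ball 0 r) x * flux x)"
    by (rule integrable_on_ball[OF flux_measurable]) (rule c, use s in simp)
  define q where "q x = max 0 (s\<^sup>2 - x \<bullet> x) - max 0 (r\<^sup>2 - x \<bullet> x)" for x :: "'m space"
  have q01: "0 \<le> q x" "q x \<le> 1" for x
    unfolding q_def using rs inner_ge_zero[of x] by linarith+
  have qs: "q x = 0" if "x \<notin> ball 0 s" for x
  proof -
    have "s\<^sup>2 \<le> (norm x)\<^sup>2" using that s r by (intro power_mono) auto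
    then show ?thesis using rs by (simp add: q_def dot_square_norm)
  qed
  have iE: "integrable lborel (\<lambda>x. indicator (ball 0 s) x * (q x * bulk x))"
  proof (rule integrable_on_ball)
    show "(\<lambda>x. q x * bulk x) \<in> borel_measurable borel" unfolding q_def by measurable
    show "\<bar>q x * bulk x\<bar> \<le> c" if "x \<in> ball 0 s" for x
    proof -
      have "\<bar>q x\<bar> * \<bar>bulk x\<bar> \<le> 1 * c" using q01[of x] c(2)[OF that] by (intro mult_mono) auto
      then show ?thesis by (simp add: abs_mult)
    qed
  qed
  have A0_eq: "A0 x = indicator (ball 0 s) x * (q x * bulk x)
      + 2 * (indicator (ball 0 r) x * flux x - indicator (ball 0 s) x * flux x)" for x
    using qs[of x] by (auto simp: A0_def q_def[symmetric] indicator_def)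
  have "(\<integral>x. A0 x \<partial>lborel) = (\<integral>x. indicator (ball 0 s) x * (q x * bulk x) \<partial>lborel)
      + 2 * (ball_int r flux - ball_int s flux)"
    unfolding A0_eq ball_int_def using iE iFs iFr by simp
  also have "(\<lambda>x. indicator (ball 0 s) x * (q x * bulk x)) = (\<lambda>x. q x * bulk x)"
  proof
    show "indicator (ball 0 s) x * (q x * bulk x) = q x * bulk x" for x
      by (cases "x \<in> ball 0 s") (simp_all add: qs del: mem_ball)
  qed
  finally show ?thesis using \<open>0 \<le> (\<integral>x. A0 x \<partial>lborel)\<close> by (simp add: q_def)
qed

text \<open>After division by \<open>s - r\<close>, as \<open>s\<close> decreases to
  \<open>r\<close>, the flux over the annulus becomes a sphere integral and the cutoff becomes
  \<open>2 * r\<close> times the indicator of the ball. Since \<open>G \<bullet> x\<close> is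
  \<open>r\<close> times the normal derivative on the sphere, this is Green's formula multiplied by
  \<open>r\<close>, with the thin boundary term dropped by its sign.\<close>

lemma green:
  assumes r: "0 < r" "r < R"
  shows "r ^ (DIM('m space) - 1) * sph r (\<lambda>x. w (up x) * (G (up x) \<bullet> up x))
    \<le> r * ball_int r (\<lambda>x. G (up x) \<bullet> W (up x) + f (up x) * w (up x))"
proof -
  define s0 where "s0 = (r + R) / 2"
  have s0: "r < s0" "s0 < R" using r by (auto simp: s0_def)
  obtain c where c: "\<And>x. x \<in> ball 0 s0 \<Longrightarrow> \<bar>bulk x\<bar> \<le> c"
  proof -
    have "0 < s0" using s0 r by simp
    from flux_bulk_bounded[OF this s0(2)] that show ?thesis by blast
  qed
  have c0: "0 \<le> c" using c[of 0] s0 r by auto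
  define q where "q s x = max 0 (s\<^sup>2 - x \<bullet> x) - max 0 (r\<^sup>2 - x \<bullet> x)" for s and x :: "'m space"
  have ev: "\<forall>\<^sub>F s in at_right r. r < s \<and> s < s0" using s0 by (auto simp: eventually_at_right)
  have "((\<lambda>s. (ball_int s flux - ball_int r flux) / (s - r)) \<longlongrightarrow> r ^ (DIM('m space) - 1) * sph r flux) (at r)"
    using DERIV_ball_int[OF flux_measurable flux_continuous r] by (simp add: has_field_derivative_iff)
  then have lim1: "((\<lambda>s. 2 * ((ball_int s flux - ball_int r flux) / (s - r))) \<longlongrightarrow>
      2 * (r ^ (DIM('m space) - 1) * sph r flux)) (at_right r)"
    by (intro tendsto_mult_left) (rule tendsto_within_subset, auto)
  have lim2: "((\<lambda>s. \<integral>x. q s x / (s - r) * bulk x \<partial>lborel) \<longlongrightarrow>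
      (\<integral>x. 2 * r * (indicator (ball 0 r) x * bulk x) \<partial>lborel)) (at_right r)"
  proof (rule dominated_convergence_at_within)
    show "integrable lborel (\<lambda>x. indicator (ball 0 s0) x * (2 * c))"
      by (rule integrable_on_ball[of "\<lambda>x. 2 * c"]) auto
    show "(\<lambda>x. q t x / (t - r) * bulk x) \<in> borel_measurable lborel" for t unfolding q_def by measurable
    \<comment> \<open>The sphere itself is excluded: there \<open>q t x / (t - r)\<close> still
      tends to \<open>2 * r\<close>, while the indicator of the open ball is 0.\<close>
    have "negligible (sphere 0 r)" by (rule negligible_sphere)
    from AE_lborel_not_in[OF this]
    show "AE x in lborel. ((\<lambda>t. q t x / (t - r) * bulk x) \<longlongrightarrow> 2 * r * (indicator (ball 0 r) x * bulk x)) (at_right r)"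
    proof eventually_elim
      case (elim x)
      show ?case
      proof (cases "norm x < r")
        case True
        have "((\<lambda>t. (t + r) * bulk x) \<longlongrightarrow> (r + r) * bulk x) (at_right r)"
          by (intro tendsto_intros)
        moreover have "\<forall>\<^sub>F t in at_right r. (t + r) * bulk x = q t x / (t - r) * bulk x"
          using ev
        proof eventually_elim
          case (elim t)
          have "(norm x)\<^sup>2 \<le> r\<^sup>2" "r\<^sup>2 \<le> t\<^sup>2" using True elim r by (auto intro!: power_mono)
          then have "q t x = (t + r) * (t - r)"
            by (simp add: q_def dot_square_norm power2_eq_square algebra_simps)
          then show ?case using elim by simp
        qed
        ultimately show ?thesis using True by (simp add: tendsto_cong)
      next
        case False
        then have "r < norm x" using elim by simp
        then have "\<forall>\<^sub>F t in at_right r. r < t \<and> t < norm x" by (auto simp: eventually_at_right)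
        then have "\<forall>\<^sub>F t in at_right r. q t x / (t - r) * bulk x = 0"
        proof eventually_elim
          case (elim t)
          have "t\<^sup>2 \<le> (norm x)\<^sup>2" "r\<^sup>2 \<le> t\<^sup>2" using elim r by (auto intro!: power_mono)
          then show ?case by (simp add: q_def dot_square_norm)
        qed
        then show ?thesis using False by (simp add: tendsto_eventually)
      qed
    qed
    show "\<forall>\<^sub>F t in at_right r. AE x in lborel. norm (q t x / (t - r) * bulk x) \<le> indicator (ball 0 s0) x * (2 * c)"
      using ev
    proof eventually_elim
      case (elim t)
      have t2: "r\<^sup>2 \<le> t\<^sup>2" using elim r by (auto intro!: power_mono)
      have "norm (q t x / (t - r) * bulk x) \<le> indicator (ball 0 s0) x * (2 * c)" for x
      proof (cases "norm x < s0")
        case True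
        have "0 \<le> q t x" "q t x \<le> t\<^sup>2 - r\<^sup>2" using t2 by (auto simp: q_def max_def)
        moreover have "t\<^sup>2 - r\<^sup>2 = (t + r) * (t - r)" by (simp add: power2_eq_square algebra_simps)
        ultimately have "\<bar>q t x / (t - r)\<bar> \<le> t + r" using elim by (simp add: divide_le_eq)
        also have "\<dots> \<le> 2" using elim s0 R by simp
        finally have "\<bar>q t x / (t - r)\<bar> * \<bar>bulk x\<bar> \<le> 2 * c" using c[of x] True by (intro mult_mono) auto
        then show ?thesis using True by (simp add: abs_mult)
      next
        case False
        then have "t\<^sup>2 \<le> (norm x)\<^sup>2" using elim r by (intro power_mono) auto
        then show ?thesis using t2 c0 by (simp add: q_def dot_square_norm)
      qed
      then show ?case by simp
    qed
  qed (use bulk_measurable in measurable)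
  have "2 * (r ^ (DIM('m space) - 1) * sph r flux) \<le> (\<integral>x. 2 * r * (indicator (ball 0 r) x * bulk x) \<partial>lborel)"
  proof (rule tendsto_le[OF _ lim2 lim1])
    show "\<forall>\<^sub>F s in at_right r. 2 * ((ball_int s flux - ball_int r flux) / (s - r)) \<le> (\<integral>x. q s x / (s - r) * bulk x \<partial>lborel)"
      using ev
    proof eventually_elim
      case (elim s)
      have "2 * (ball_int s flux - ball_int r flux) / (s - r) \<le> (\<integral>x. q s x * bulk x \<partial>lborel) / (s - r)"
        using green_annulus[OF r(1), of s] elim s0 by (intro divide_right_mono) (auto simp: q_def)
      also have "\<dots> = (\<integral>x. q s x / (s - r) * bulk x \<partial>lborel)"
        by (subst integral_divide_zero[symmetric]) simp
      finally show ?case by simp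
    qed
  qed simp
  then have "r ^ (DIM('m space) - 1) * sph r flux \<le> r * ball_int r bulk" by (simp add: ball_int_def)
  moreover have "sph r flux = sph r (\<lambda>x. w (up x) * (G (up x) \<bullet> up x))"
  proof -
    have "flux (r *\<^sub>R sgn x) = w (up (r *\<^sub>R sgn x)) * (G (up (r *\<^sub>R sgn x)) \<bullet> up (r *\<^sub>R sgn x))" for x
    proof -
      have "norm (r *\<^sub>R sgn x) \<le> r" using r by (auto simp: norm_sgn)
      then have "r *\<^sub>R sgn x \<in> ball 0 R" using r by (simp del: norm_scaleR)
      then show ?thesis unfolding flux_def by (simp only: indicator_simps mult_1)
    qed
    then show ?thesis by (simp add: sph_def)
  qed
  moreover have "ball_int r bulk = ball_int r (\<lambda>x. G (up x) \<bullet> W (up x) + f (up x) * w (up x))"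
    unfolding ball_int_def using r
    by (intro Bochner_Integration.integral_cong) (auto simp: bulk_def indicator_def)
  ultimately show ?thesis by simp
qed

end

section \<open>Linearity, bounds and continuity of ball and sphere integrals\<close>

lemma ball_int_integrable:
  fixes F :: "'a::euclidean_space \<Rightarrow> real"
  assumes "F \<in> borel_measurable borel" "\<And>x. \<bar>F x\<bar> \<le> B"
  shows "integrable lborel (\<lambda>x. indicator (ball 0 r) x * F x)"
  by (rule integrable_on_ball[OF assms(1)]) (rule assms(2))

lemma sph_measurable:
  fixes F :: "'a::euclidean_space \<Rightarrow> real"
  assumes [measurable]: "F \<in> borel_measurable borel"
  shows "(\<lambda>x. F (s *\<^sub>R sgn x)) \<in> borel_measurable borel"
  by (rule measurable_compose[OF _ assms]) measurable

lemma sph_integrable: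
  fixes F :: "'a::euclidean_space \<Rightarrow> real"
  assumes "F \<in> borel_measurable borel" "\<And>x. \<bar>F x\<bar> \<le> B"
  shows "integrable lborel (\<lambda>x. indicator (ball 0 1) x * F (s *\<^sub>R sgn x))"
  by (rule integrable_on_ball[OF sph_measurable[OF assms(1)]]) (rule assms(2))

lemma ball_int_linear:
  fixes F F' :: "'a::euclidean_space \<Rightarrow> real"
  assumes "F \<in> borel_measurable borel" "\<And>x. \<bar>F x\<bar> \<le> B"
    and "F' \<in> borel_measurable borel" "\<And>x. \<bar>F' x\<bar> \<le> B'"
  shows "ball_int r (\<lambda>x. a * F x + b * F' x) = a * ball_int r F + b * ball_int r F'"
proof -
  have "(\<lambda>x. indicator (ball 0 r) x * (a * F x + b * F' x)) =
      (\<lambda>x. a * (indicator (ball 0 r) x * F x) + b * (indicator (ball 0 r) x * F' x))"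
    by (simp add: algebra_simps)
  then show ?thesis unfolding ball_int_def
    using ball_int_integrable[OF assms(1,2)] ball_int_integrable[OF assms(3,4)] by simp
qed

lemma sph_linear:
  fixes F F' :: "'a::euclidean_space \<Rightarrow> real"
  assumes "F \<in> borel_measurable borel" "\<And>x. \<bar>F x\<bar> \<le> B"
    and "F' \<in> borel_measurable borel" "\<And>x. \<bar>F' x\<bar> \<le> B'"
  shows "sph s (\<lambda>x. a * F x + b * F' x) = a * sph s F + b * sph s F'"
proof -
  have "(\<lambda>x. indicator (ball 0 1) x * (a * F (s *\<^sub>R sgn x) + b * F' (s *\<^sub>R sgn x))) =
      (\<lambda>x. a * (indicator (ball 0 1) x * F (s *\<^sub>R sgn x)) + b * (indicator (ball 0 1) x * F' (s *\<^sub>R sgn x)))"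
    by (simp add: algebra_simps)
  then show ?thesis unfolding sph_def
    using sph_integrable[OF assms(1,2)] sph_integrable[OF assms(3,4)] by (simp add: algebra_simps)
qed

lemma ball_int_cong:
  "(\<And>x. norm x < r \<Longrightarrow> F x = F' x) \<Longrightarrow> ball_int r F = ball_int r F'"
  unfolding ball_int_def by (intro Bochner_Integration.integral_cong) (auto simp: indicator_def)

lemma sph_cong:
  assumes "0 \<le> s" "\<And>x. norm x \<le> s \<Longrightarrow> F x = F' x"
  shows "sph s F = sph s F'"
proof -
  have "F (s *\<^sub>R sgn x) = F' (s *\<^sub>R sgn x)" for x
    by (rule assms(2)) (use assms(1) in \<open>auto simp: norm_sgn\<close>)
  then show ?thesis by (simp add: sph_def)
qed

lemma ball_int_mono:
  fixes F F' :: "'a::euclidean_space \<Rightarrow> real"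
  assumes "F \<in> borel_measurable borel" "\<And>x. \<bar>F x\<bar> \<le> B"
    and "F' \<in> borel_measurable borel" "\<And>x. \<bar>F' x\<bar> \<le> B'"
    and "\<And>x. norm x < r \<Longrightarrow> F x \<le> F' x"
  shows "ball_int r F \<le> ball_int r F'"
  unfolding ball_int_def
  by (intro integral_mono ball_int_integrable[OF assms(1,2)] ball_int_integrable[OF assms(3,4)])
    (auto simp: indicator_def assms(5))

lemma sph_nonneg: "(\<And>x. 0 \<le> F x) \<Longrightarrow> 0 \<le> sph s F"
  unfolding sph_def by (intro mult_nonneg_nonneg Bochner_Integration.integral_nonneg) auto

lemma ball_int_nonneg: "(\<And>x. 0 \<le> F x) \<Longrightarrow> 0 \<le> ball_int s F"
  unfolding ball_int_def by (intro mult_nonneg_nonneg Bochner_Integration.integral_nonneg) auto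

definition unit_vol :: "'a::euclidean_space itself \<Rightarrow> real" where
  "unit_vol _ = ball_int 1 (\<lambda>x::'a. 1)"

lemma unit_vol_nonneg: "0 \<le> unit_vol TYPE('a::euclidean_space)"
  unfolding unit_vol_def by (rule ball_int_nonneg) simp

lemma ball_int_const:
  "0 < r \<Longrightarrow> ball_int r (\<lambda>x::'a::euclidean_space. c) = r ^ DIM('a) * unit_vol TYPE('a) * c"
  using ball_int_sgn[of "\<lambda>x::'a. 1" r] by (simp add: ball_int_def unit_vol_def)

lemma sph_le:
  fixes F :: "'a::euclidean_space \<Rightarrow> real"
  assumes "F \<in> borel_measurable borel" "\<And>x. \<bar>F x\<bar> \<le> B"
  shows "sph s F \<le> DIM('a) * (unit_vol TYPE('a) * B)"
proof -
  have "(\<integral>x. indicator (ball 0 1) x * F (s *\<^sub>R sgn x) \<partial>lborel) \<le> (\<integral>x. indicator (ball 0 1) (x::'a) * B \<partial>lborel)"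
    by (intro integral_mono sph_integrable[OF assms] ball_int_integrable[of "\<lambda>x. B" "\<bar>B\<bar>"])
      (use assms(2) in \<open>auto simp: indicator_def abs_le_iff\<close>)
  also have "\<dots> = unit_vol TYPE('a) * B"
    using ball_int_const[of 1 B, where 'a='a] by (simp add: ball_int_def)
  finally show ?thesis unfolding sph_def by (intro mult_left_mono) auto
qed

text \<open>The radius 0 is included: \<open>frequency_system\<close> asks for continuity of
  \<open>h\<close> there, where the derivative formula says nothing.\<close>

lemma continuous_on_sph:
  fixes F :: "'a::euclidean_space \<Rightarrow> real"
  assumes F: "F \<in> borel_measurable borel" "\<And>x. \<bar>F x\<bar> \<le> B" and c: "continuous_on (ball 0 R) F"
  shows "continuous_on {0..<R} (\<lambda>s. sph s F)"
  unfolding continuous_on_def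
proof
  fix s assume s: "s \<in> {0..<R}"
  have "((\<lambda>s. \<integral>x. indicator (ball 0 1) x * F (s *\<^sub>R sgn x) \<partial>lborel) \<longlongrightarrow>
     (\<integral>x. indicator (ball 0 1) x * F (s *\<^sub>R sgn x) \<partial>lborel)) (at s within {0..<R})"
  proof (rule dominated_convergence_at_within)
    show "integrable lborel (\<lambda>x::'a. indicator (ball 0 1) x * B)"
      by (rule ball_int_integrable[of "\<lambda>x. B" "\<bar>B\<bar>"]) auto
    have m: "(\<lambda>x. indicat_real (ball 0 1) x * F (t *\<^sub>R sgn x)) \<in> borel_measurable lborel" for t
      using sph_integrable[OF F, of t] by (rule borel_measurable_integrable)
    show "(\<lambda>x. indicat_real (ball 0 1) x * F (t *\<^sub>R sgn x)) \<in> borel_measurable lborel" for t by (rule m)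
    show "(\<lambda>x. indicat_real (ball 0 1) x * F (t *\<^sub>R sgn x)) \<in> borel_measurable lborel" for t by (rule m)
    have "((\<lambda>t. F (t *\<^sub>R sgn x)) \<longlongrightarrow> F (s *\<^sub>R sgn x)) (at s within {0..<R})" for x
    proof -
      have "continuous_on {0..<R} (\<lambda>t. F (t *\<^sub>R sgn x))"
      proof (rule continuous_on_compose2[OF c])
        show "(\<lambda>t. t *\<^sub>R sgn x) ` {0..<R} \<subseteq> ball 0 R"
          by (auto simp: norm_sgn)
      qed (intro continuous_intros)
      then show ?thesis using s by (auto simp: continuous_on_def)
    qed
    then show "AE x in lborel. ((\<lambda>t. indicat_real (ball 0 1) x * F (t *\<^sub>R sgn x)) \<longlongrightarrow>
        indicat_real (ball 0 1) x * F (s *\<^sub>R sgn x)) (at s within {0..<R})"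
      by (simp add: tendsto_mult_left)
    show "\<forall>\<^sub>F t in at s within {0..<R}. AE x in lborel. norm (indicat_real (ball 0 1) x * F (t *\<^sub>R sgn x))
        \<le> indicator (ball 0 1) x * B"
    proof (intro always_eventually allI AE_I2)
      show "norm (indicat_real (ball 0 1) x * F (t *\<^sub>R sgn x)) \<le> indicator (ball 0 1) x * B" for t x
        using F(2)[of "t *\<^sub>R sgn x"] by (cases "x \<in> ball 0 1") simp_all
    qed
  qed
  then show "((\<lambda>s. sph s F) \<longlongrightarrow> sph s F) (at s within {0..<R})"
    unfolding sph_def by (rule tendsto_mult_left)
qed

section \<open>The energy identity and the Rellich inequality\<close>

context weak_solution begin

text \<open>Even extensions to the unit ball, by zero outside; \<open>V\<close> is not the gradient of \<open>U\<close> in the lower half space but its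
  mirror image, which makes it continuous, and \<open>X x\<close> is \<open>norm x\<close> times the radial derivative.\<close>

definition U :: "'m space \<Rightarrow> real" where "U x = indicator (ball 0 1) x * u (up x)"
definition V :: "'m space \<Rightarrow> 'm space" where "V x = indicator (ball 0 1) x *\<^sub>R G (up x)"
definition X :: "'m space \<Rightarrow> real" where "X x = V x \<bullet> up x"
definition fl :: "'m space \<Rightarrow> real" where "fl x = indicator (ball 0 1) x * f (up x)"

lemma lift_continuous: "continuous_on (ball 0 1) U" "continuous_on (ball 0 1) V" "continuous_on (ball 0 1) X"
proof -
  have i: "up ` ball 0 1 \<subseteq> closed_half 1" using up_in_closed_half by blast
  have "continuous_on (ball 0 1) (\<lambda>x. u (up x))"
    by (rule continuous_on_compose2[OF cont_u _ i]) (intro continuous_intros)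
  then show "continuous_on (ball 0 1) U"
    by (rule continuous_on_eq) (simp add: U_def)
  have "continuous_on (ball 0 1) (\<lambda>x. G (up x))"
    by (rule continuous_on_compose2[OF cont_G _ i]) (intro continuous_intros)
  then show V: "continuous_on (ball 0 1) V"
    by (rule continuous_on_eq) (simp add: V_def)
  show "continuous_on (ball 0 1) X"
    unfolding X_def by (intro continuous_intros V)
qed

lemma lift_measurable [measurable]: "U \<in> borel_measurable borel" "V \<in> borel_measurable borel"
  "X \<in> borel_measurable borel" "fl \<in> borel_measurable borel"
proof -
  have "(\<lambda>x. indicator (ball 0 1) x *\<^sub>R U x) \<in> borel_measurable borel"
    by (rule borel_measurable_continuous_on_indicator[OF _ lift_continuous(1)]) simp
  moreover have "(\<lambda>x. indicator (ball 0 1) x *\<^sub>R U x) = U"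
    by (rule ext) (simp add: U_def indicator_def)
  ultimately show "U \<in> borel_measurable borel" by (simp only:)
  have "(\<lambda>x. indicator (ball 0 1) x *\<^sub>R V x) \<in> borel_measurable borel"
    by (rule borel_measurable_continuous_on_indicator[OF _ lift_continuous(2)]) simp
  moreover have "(\<lambda>x. indicator (ball 0 1) x *\<^sub>R V x) = V"
    by (rule ext) (simp add: V_def indicator_def)
  ultimately show [measurable]: "V \<in> borel_measurable borel" by (simp only:)
  show "X \<in> borel_measurable borel" unfolding X_def by measurable
  show "fl \<in> borel_measurable borel" unfolding fl_def by measurable
qed

lemma lift_bounds: "\<bar>U x\<bar> \<le> M" "norm (V x) \<le> M" "\<bar>X x\<bar> \<le> norm x * norm (V x)" "\<bar>X x\<bar> \<le> M" "\<bar>fl x\<bar> \<le> M"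
  "\<bar>fl x\<bar> \<le> M * norm x ^ (k - 1)"
proof -
  show U: "\<bar>U x\<bar> \<le> M" using u_le[OF up_in_closed_half[of x 1]] M by (auto simp: U_def indicator_def)
  show V: "norm (V x) \<le> M" using G_le[OF up_in_closed_half[of x 1]] M by (auto simp: V_def indicator_def)
  show X: "\<bar>X x\<bar> \<le> norm x * norm (V x)"
    using Cauchy_Schwarz_ineq2[of "V x" "up x"] by (simp add: X_def mult.commute)
  show "\<bar>X x\<bar> \<le> M"
  proof (cases "norm x < 1")
    case True
    have "norm x * norm (V x) \<le> 1 * M" using True V M by (intro mult_mono) auto
    then show ?thesis using X by simp
  qed (simp add: X_def V_def M)
  show f: "\<bar>fl x\<bar> \<le> M * norm x ^ (k - 1)"
    using f_le[of "up x"] M by (auto simp: fl_def indicator_def)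
  show "\<bar>fl x\<bar> \<le> M"
  proof (cases "norm x < 1")
    case True
    have "M * norm x ^ (k - 1) \<le> M * 1" using True M by (intro mult_left_mono power_le_one) auto
    then show ?thesis using f by simp
  qed (simp add: fl_def M)
qed

lemma abs_mult_le: "\<bar>a\<bar> \<le> A \<Longrightarrow> \<bar>b\<bar> \<le> B \<Longrightarrow> \<bar>a * b\<bar> \<le> A * (B :: real)"
  unfolding abs_mult by (intro mult_mono) auto

lemma comparison_u: "comparison u f G k M u G 1"
proof
  show "u x * snd (G x) \<le> 0" if "x \<in> thin_ball" for x using uG_thin[OF that] by linarith
qed (use cont_u cont_G GDERIV_u in \<open>auto simp: half_ball_def\<close>)

lemma comparison_minus_u: "comparison u f G k M (\<lambda>x. - u x) (\<lambda>x. - G x) 1"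
proof
  show "- u x * snd (G x) \<le> 0" if "x \<in> thin_ball" for x using uG_thin[OF that] by linarith
  show "GDERIV (\<lambda>x. - u x) x :> - G x" if "x \<in> ball 0 1" "x \<in> upper" for x
    using that by (intro GDERIV_minus GDERIV_u) (auto simp: half_ball_def)
qed (use cont_u cont_G in \<open>auto intro: continuous_intros\<close>)

text \<open>Complementarity on the thin ball admits both \<open>u\<close> and \<open>- u\<close> in
  Green's inequality, and the two opposite inequalities give an equality.\<close>

lemma energy_identity:
  assumes r: "0 < r" "r < 1"
  shows "r ^ (DIM('m space) - 1) * sph r (\<lambda>x. U x * X x)
    = r * (ball_int r (\<lambda>x. V x \<bullet> V x) + ball_int r (\<lambda>x. fl x * U x))"
proof -
  define A where "A = ball_int r (\<lambda>x. G (up x) \<bullet> G (up x) + f (up x) * u (up x))"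
  define S where "S = sph r (\<lambda>x. u (up x) * (G (up x) \<bullet> up x))"
  have "r ^ (DIM('m space) - 1) * S \<le> r * A"
    unfolding A_def S_def by (rule comparison.green[OF comparison_u r])
  moreover have "r ^ (DIM('m space) - 1) * sph r (\<lambda>x. - u (up x) * (G (up x) \<bullet> up x)) \<le>
      r * ball_int r (\<lambda>x. G (up x) \<bullet> - G (up x) + f (up x) * - u (up x))"
    by (rule comparison.green[OF comparison_minus_u r])
  moreover have "sph r (\<lambda>x. - u (up x) * (G (up x) \<bullet> up x)) = - S"
    by (simp add: S_def sph_def)
  moreover have "ball_int r (\<lambda>x. G (up x) \<bullet> - G (up x) + f (up x) * - u (up x)) = - A"
  proof -
    have "(\<lambda>x. indicat_real (ball 0 r) x * (G (up x) \<bullet> - G (up x) + f (up x) * - u (up x))) =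
      (\<lambda>x. - (indicat_real (ball 0 r) x * (G (up x) \<bullet> G (up x) + f (up x) * u (up x))))"
      by (simp add: algebra_simps)
    then show ?thesis by (simp add: A_def ball_int_def)
  qed
  ultimately have "r ^ (DIM('m space) - 1) * S = r * A" by simp
  moreover have "S = sph r (\<lambda>x. U x * X x)" unfolding S_def
    by (rule sph_cong) (use r in \<open>auto simp: U_def X_def V_def\<close>)
  moreover have "A = ball_int r (\<lambda>x. 1 * (V x \<bullet> V x) + 1 * (fl x * U x))" unfolding A_def
    by (rule ball_int_cong) (use r in \<open>auto simp: U_def fl_def V_def\<close>)
  moreover have "\<dots> = 1 * ball_int r (\<lambda>x. V x \<bullet> V x) + 1 * ball_int r (\<lambda>x. fl x * U x)"
  proof (rule ball_int_linear)
    show "\<bar>V x \<bullet> V x\<bar> \<le> M * M" for x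
      using lift_bounds(2)[of x] M by (auto simp: dot_square_norm power2_eq_square intro!: mult_mono)
    show "\<bar>fl x * U x\<bar> \<le> M * M" for x by (rule abs_mult_le) (rule lift_bounds)+
  qed measurable
  ultimately show ?thesis by simp
qed

lemma up_scaleR: "0 \<le> t \<Longrightarrow> up (t *\<^sub>R x) = t *\<^sub>R up x"
  by (simp add: up_def abs_mult)

text \<open>When \<open>snd x\<close> is nonzero, the open ray through \<open>x\<close> stays on one
  side of the thin hyperplane, so \<open>U\<close> is differentiable along it although it may have a
  kink across the hyperplane. On the ray \<open>U\<close> is \<open>u\<close> at the folded points,
  whence \<open>up x\<close>.\<close>

lemma U_radial:
  assumes x: "snd x \<noteq> 0" and t: "0 < t" "norm (t *\<^sub>R x) < 1"
  shows "((\<lambda>t. U (t *\<^sub>R x)) has_real_derivative V (t *\<^sub>R x) \<bullet> up x) (at t)"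
proof -
  have y: "t *\<^sub>R up x \<in> half_ball"
    using x t by (auto simp: half_ball_def upper_def) (simp add: up_def)
  have 1: "FDERIV u (t *\<^sub>R up x) :> (\<lambda>h. h \<bullet> G (t *\<^sub>R up x))"
    using GDERIV_u[OF y] by (simp add: gderiv_def)
  have 2: "((\<lambda>t. t *\<^sub>R up x) has_derivative (\<lambda>h. h *\<^sub>R up x)) (at t)"
    by (auto intro!: derivative_eq_intros)
  have 3: "((\<lambda>t. u (t *\<^sub>R up x)) has_derivative (\<lambda>h. (h *\<^sub>R up x) \<bullet> G (t *\<^sub>R up x))) (at t)"
    by (rule has_derivative_compose[OF 2 1])
  have "V (t *\<^sub>R x) = G (t *\<^sub>R up x)" using t by (simp add: V_def up_scaleR)
  then have 4: "(\<lambda>h. (h *\<^sub>R up x) \<bullet> G (t *\<^sub>R up x)) = (*) (V (t *\<^sub>R x) \<bullet> up x)"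
    by (auto simp: inner_commute)
  have "((\<lambda>t. u (t *\<^sub>R up x)) has_real_derivative V (t *\<^sub>R x) \<bullet> up x) (at t)"
    using 3 unfolding has_field_derivative_def 4 .
  moreover have "\<forall>\<^sub>F s in nhds t. U (s *\<^sub>R x) = u (s *\<^sub>R up x)"
  proof -
    have "open {s. norm (s *\<^sub>R x) < 1}" by (intro open_Collect_less continuous_intros)
    from eventually_nhds_in_open[OF this, of t] t(2)
    have "\<forall>\<^sub>F s in nhds t. norm (s *\<^sub>R x) < 1" by simp
    moreover have "\<forall>\<^sub>F s in nhds t. 0 < s" using t(1) by (rule order_tendstoD(1)[OF filterlim_ident])
    ultimately show ?thesis by eventually_elim (simp add: U_def up_scaleR)
  qed
  ultimately show ?thesis by (simp add: DERIV_cong_ev)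
qed

text \<open>Supplies the dominating functions for difference quotients in the radius and in the
  dilation factor.\<close>

lemma U_radial_lipschitz:
  assumes x: "snd x \<noteq> 0" and s: "0 < s" "norm (s *\<^sub>R x) < 1" and t: "0 < t" "norm (t *\<^sub>R x) < 1"
  shows "\<bar>U (s *\<^sub>R x) - U (t *\<^sub>R x)\<bar> \<le> M * norm x * \<bar>s - t\<bar>"
proof -
  define S where "S = {0<..<1 / norm x}"
  have nx: "0 < norm x" using x by auto
  have S: "s \<in> S \<longleftrightarrow> 0 < s \<and> norm (s *\<^sub>R x) < 1" for s
    using nx by (auto simp: S_def field_simps)
  have cv: "convex S" unfolding S_def by (rule convex_real_interval)
  have dv: "((\<lambda>t. U (t *\<^sub>R x)) has_field_derivative V (z *\<^sub>R x) \<bullet> up x) (at z within S)" if "z \<in> S" for z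
    by (rule has_field_derivative_at_within[OF U_radial[OF x]]) (use that S[of z] in blast)+
  have bv: "norm (V (z *\<^sub>R x) \<bullet> up x) \<le> M * norm x" if "z \<in> S" for z
  proof -
    have "\<bar>V (z *\<^sub>R x) \<bullet> up x\<bar> \<le> norm (V (z *\<^sub>R x)) * norm (up x)" by (rule Cauchy_Schwarz_ineq2)
    also have "\<dots> \<le> M * norm x" unfolding norm_up using lift_bounds(2) by (intro mult_right_mono) auto
    finally show ?thesis by (simp only: real_norm_def)
  qed
  have "s \<in> S" "t \<in> S" using s t S by blast+
  from field_differentiable_bound[OF cv dv bv this] show ?thesis by (simp only: real_norm_def)
qed

lemma snd_sgn_neq_0: "snd x \<noteq> 0 \<Longrightarrow> snd (sgn x :: 'm space) \<noteq> 0"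
  by (auto simp: sgn_div_norm)

lemma X_scaleR: "0 \<le> t \<Longrightarrow> X (t *\<^sub>R x) = t * (V (t *\<^sub>R x) \<bullet> up x)"
  by (simp add: X_def up_scaleR)

text \<open>All spheres are parametrised by the unit sphere, so the derivative passes under a fixed
  integral and only radial derivatives of \<open>U\<close> occur.\<close>

lemma DERIV_height:
  assumes r: "0 < r" "r < 1"
  shows "((\<lambda>s. sph s (\<lambda>x. U x * U x)) has_real_derivative 2 * sph r (\<lambda>x. U x * X x) / r) (at r)"
  unfolding has_field_derivative_iff
proof -
  define Q where "Q s x = (U (s *\<^sub>R sgn x) * U (s *\<^sub>R sgn x) - U (r *\<^sub>R sgn x) * U (r *\<^sub>R sgn x)) / (s - r)"
    for s x
  have product_bounds: "\<bar>U x * U x\<bar> \<le> M * M" for x by (rule abs_mult_le) (rule lift_bounds)+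
  have ev: "\<forall>\<^sub>F s in at r. 0 < s \<and> s < 1 \<and> s \<noteq> r"
  proof -
    have "\<forall>\<^sub>F s in nhds r. 0 < s \<and> s < 1"
      by (intro eventually_conj order_tendstoD[OF filterlim_ident]) (use r in auto)
    then show ?thesis unfolding eventually_at_filter by eventually_elim auto
  qed
  have lim0: "((\<lambda>s. \<integral>x. indicator (ball 0 1) x * Q s x \<partial>lborel) \<longlongrightarrow>
      (\<integral>x. 2 / r * (indicator (ball 0 1) x * (U (r *\<^sub>R sgn x) * X (r *\<^sub>R sgn x))) \<partial>lborel)) (at r)"
  proof (rule dominated_convergence_at_within)
    show "integrable lborel (\<lambda>x::'m space. indicator (ball 0 1) x * (2 * M * M))"
      by (rule ball_int_integrable[of "\<lambda>x. 2 * M * M" "\<bar>2 * M * M\<bar>"]) auto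
    show "(\<lambda>x. indicator (ball 0 1) x * Q s x) \<in> borel_measurable lborel" for s
    proof -
      have [measurable]: "(\<lambda>x. U (s *\<^sub>R sgn x)) \<in> borel_measurable borel" for s
        by (rule sph_measurable[OF lift_measurable(1)])
      show ?thesis unfolding Q_def by measurable
    qed
    show "(\<lambda>x. 2 / r * (indicator (ball 0 1) x * (U (r *\<^sub>R sgn x) * X (r *\<^sub>R sgn x)))) \<in> borel_measurable lborel"
    proof -
      have [measurable]: "(\<lambda>x. U (r *\<^sub>R sgn x)) \<in> borel_measurable borel"
        "(\<lambda>x. X (r *\<^sub>R sgn x)) \<in> borel_measurable borel"
        by (rule sph_measurable[OF lift_measurable(1)], rule sph_measurable[OF lift_measurable(3)])
      show ?thesis by measurable
    qed
    have lim: "((\<lambda>s. Q s x) \<longlongrightarrow> 2 / r * (U (r *\<^sub>R sgn x) * X (r *\<^sub>R sgn x))) (at r)" if "snd x \<noteq> 0" for x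
    proof -
      have "norm (r *\<^sub>R sgn x) < 1" using r by (auto simp: norm_sgn)
      note d = U_radial[OF snd_sgn_neq_0[OF that] r(1) this]
      have "V (r *\<^sub>R sgn x) \<bullet> up (sgn x) = X (r *\<^sub>R sgn x) / r" using r by (simp add: X_scaleR)
      with DERIV_mult[OF d d] show ?thesis
        by (simp add: has_field_derivative_iff Q_def mult.commute mult.assoc)
    qed
    show "AE x in lborel. ((\<lambda>s. indicator (ball 0 1) x * Q s x) \<longlongrightarrow>
        2 / r * (indicator (ball 0 1) x * (U (r *\<^sub>R sgn x) * X (r *\<^sub>R sgn x)))) (at r)"
      using AE_snd_neq_0
    proof eventually_elim
      case (elim x)
      have "2 / r * (indicator (ball 0 1) x * (U (r *\<^sub>R sgn x) * X (r *\<^sub>R sgn x))) =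
        indicator (ball 0 1) x * (2 / r * (U (r *\<^sub>R sgn x) * X (r *\<^sub>R sgn x)))" by (simp only: mult_ac)
      then show ?case using tendsto_mult_left[OF lim[OF elim], of "indicator (ball 0 1) x"] by (simp only:)
    qed
    have bd: "norm (indicator (ball 0 1) x * Q s x) \<le> indicator (ball 0 1) x * (2 * M * M)"
      if "snd x \<noteq> 0" "0 < s" "s < 1" "s \<noteq> r" for s x
    proof -
      have n: "norm (sgn x) = 1" using that by (auto simp: norm_sgn)
      have "\<bar>U (s *\<^sub>R sgn x) - U (r *\<^sub>R sgn x)\<bar> \<le> M * norm (sgn x) * \<bar>s - r\<bar>"
        by (rule U_radial_lipschitz) (use that r n snd_sgn_neq_0 in auto)
      moreover have "\<bar>U (s *\<^sub>R sgn x) + U (r *\<^sub>R sgn x)\<bar> \<le> 2 * M"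
        using abs_triangle_ineq[of "U (s *\<^sub>R sgn x)" "U (r *\<^sub>R sgn x)"] lift_bounds(1)[of "s *\<^sub>R sgn x"]
          lift_bounds(1)[of "r *\<^sub>R sgn x"] by linarith
      ultimately have "\<bar>(U (s *\<^sub>R sgn x) + U (r *\<^sub>R sgn x)) * (U (s *\<^sub>R sgn x) - U (r *\<^sub>R sgn x))\<bar>
          \<le> (2 * M) * (M * norm (sgn x) * \<bar>s - r\<bar>)" by (rule abs_mult_le[rotated])
      then have "\<bar>U (s *\<^sub>R sgn x) * U (s *\<^sub>R sgn x) - U (r *\<^sub>R sgn x) * U (r *\<^sub>R sgn x)\<bar>
          \<le> 2 * M * M * \<bar>s - r\<bar>" using n by (simp add: algebra_simps)
      then have "\<bar>Q s x\<bar> \<le> 2 * M * M" using that by (simp add: Q_def abs_divide divide_le_eq)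
      then show ?thesis by (auto simp: indicator_def)
    qed
    show "\<forall>\<^sub>F s in at r. AE x in lborel. norm (indicator (ball 0 1) x * Q s x) \<le> indicator (ball 0 1) x * (2 * M * M)"
      using ev
    proof eventually_elim
      case (elim s)
      show ?case using AE_snd_neq_0 by eventually_elim (rule bd, use elim in auto)
    qed
  qed
  have "DIM('m space) * (\<integral>x. 2 / r * (indicator (ball 0 1) x * (U (r *\<^sub>R sgn x) * X (r *\<^sub>R sgn x))) \<partial>lborel)
      = 2 * sph r (\<lambda>x. U x * X x) / r"
  proof -
    have "a * (2 / r * b) = 2 * (a * b) / r" for a b :: real by simp
    then show ?thesis unfolding sph_def integral_mult_right_zero by blast
  qed
  note eq = this
  from tendsto_mult_left[OF lim0, of "DIM('m space)", unfolded eq]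
  have "((\<lambda>s. DIM('m space) * (\<integral>x. indicator (ball 0 1) x * Q s x \<partial>lborel)) \<longlongrightarrow>
      2 * sph r (\<lambda>x. U x * X x) / r) (at r)" .
  moreover have "DIM('m space) * (\<integral>x. indicator (ball 0 1) x * Q s x \<partial>lborel) =
      (sph s (\<lambda>x. U x * U x) - sph r (\<lambda>x. U x * U x)) / (s - r)" for s
  proof -
    have i: "integrable lborel (\<lambda>x. indicator (ball 0 1) x * (U (s *\<^sub>R sgn x) * U (s *\<^sub>R sgn x)))" for s
      by (rule sph_integrable[of "\<lambda>x. U x * U x", OF _ product_bounds]) measurable
    have "indicator (ball 0 1) x * Q s x =
      (indicator (ball 0 1) x * (U (s *\<^sub>R sgn x) * U (s *\<^sub>R sgn x))
        - indicator (ball 0 1) x * (U (r *\<^sub>R sgn x) * U (r *\<^sub>R sgn x))) / (s - r)" for x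
      unfolding Q_def times_divide_eq_right right_diff_distrib ..
    then show ?thesis unfolding sph_def
      by (simp only: integral_divide_zero Bochner_Integration.integral_diff[OF i i] times_divide_eq_right right_diff_distrib)
  qed
  ultimately show "((\<lambda>s. (sph s (\<lambda>x. U x * U x) - sph r (\<lambda>x. U x * U x)) / (s - r)) \<longlongrightarrow>
      2 * sph r (\<lambda>x. U x * X x) / r) (at r)"
    by (simp only:)
qed

definition D :: "real \<Rightarrow> real" where "D r = ball_int r (\<lambda>x. V x \<bullet> V x)"

section \<open>REMOVE\<close>

lemma VV_bound: "\<bar>V x \<bullet> V x\<bar> \<le> M * M"
  using Cauchy_Schwarz_ineq2[of "V x" "V x"] mult_mono[OF lift_bounds(2)[of x] lift_bounds(2)[of x]] M by simp

lemma DERIV_D: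
  assumes "0 < r" "r < 1"
  shows "(D has_real_derivative r ^ (DIM('m space) - 1) * sph r (\<lambda>x. V x \<bullet> V x)) (at r)"
  unfolding D_def[abs_def]
proof (rule DERIV_ball_int)
  show "continuous_on (ball 0 1) (\<lambda>x. V x \<bullet> V x)" by (intro continuous_intros lift_continuous)
qed (use assms in measurable)

lemma DIM_ge_2: "2 \<le> DIM('m space)"
  using DIM_positive[where 'a="(real,'m) vec"] by (simp only: DIM_prod) simp

text \<open>On the thin ball \<open>u x * snd (G x)\<close> vanishes, while
  \<open>u (l *\<^sub>R x)\<close> is nonnegative and \<open>snd (G x)\<close> is not positive. The
  sign goes one way only, which is why the Rellich relation is an inequality.\<close>

lemma comparison_dilation:
  assumes "1 < l"
  shows "comparison u f G k M (\<lambda>x. u (l *\<^sub>R x) - u x) (\<lambda>x. l *\<^sub>R G (l *\<^sub>R x) - G x) (1 / l)"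
proof
  have sc: "(\<lambda>x. l *\<^sub>R x) ` closed_half (1 / l) \<subseteq> closed_half 1"
  proof
    fix y assume "y \<in> (\<lambda>x. l *\<^sub>R x) ` closed_half (1 / l)"
    then obtain x where "y = l *\<^sub>R x" "x \<in> closed_half (1 / l)" by blast
    then have x: "y = l *\<^sub>R x" "norm x < 1 / l" "0 \<le> snd x" by (simp_all add: closed_half_def)
    then have "norm y < 1" "0 \<le> snd y" using assms by (simp_all add: less_divide_eq mult.commute)
    then show "y \<in> closed_half 1" by (simp add: closed_half_def)
  qed
  have sub: "closed_half (1 / l) \<subseteq> closed_half 1" by (rule closed_half_mono) (use assms in simp)
  show "continuous_on (closed_half (1 / l)) (\<lambda>x. u (l *\<^sub>R x) - u x)"
    by (intro continuous_on_diff continuous_on_compose2[OF cont_u _ sc] continuous_on_subset[OF cont_u sub])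
      (intro continuous_intros)
  show "continuous_on (closed_half (1 / l)) (\<lambda>x. l *\<^sub>R G (l *\<^sub>R x) - G x)"
    by (intro continuous_on_diff continuous_on_scaleR continuous_on_const
        continuous_on_compose2[OF cont_G _ sc] continuous_on_subset[OF cont_G sub])
      (intro continuous_intros)
  show "GDERIV (\<lambda>x. u (l *\<^sub>R x) - u x) x :> l *\<^sub>R G (l *\<^sub>R x) - G x"
    if x: "x \<in> ball 0 (1 / l)" "x \<in> upper" for x
  proof -
    have "l * norm x < 1" using x assms by (simp add: field_simps)
    moreover have "norm x \<le> l * norm x" using assms by (simp add: mult_le_cancel_right1)
    ultimately have "l *\<^sub>R x \<in> half_ball" "x \<in> half_ball"
      using x assms by (auto simp: half_ball_def upper_def)
    then have 1: "FDERIV u (l *\<^sub>R x) :> (\<lambda>h. h \<bullet> G (l *\<^sub>R x))" and 2: "GDERIV u x :> G x"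
      using GDERIV_u by (auto simp: gderiv_def)
    have "((\<lambda>x. l *\<^sub>R x) has_derivative (\<lambda>h. l *\<^sub>R h)) (at x)"
      by (auto intro!: derivative_eq_intros)
    from has_derivative_compose[OF this 1]
    have "GDERIV (\<lambda>x. u (l *\<^sub>R x)) x :> l *\<^sub>R G (l *\<^sub>R x)"
      by (simp add: gderiv_def)
    then show ?thesis using 2 by (rule GDERIV_diff)
  qed
  show "(u (l *\<^sub>R x) - u x) * snd (G x) \<le> 0" if x: "x \<in> thin_ball" "x \<in> ball 0 (1 / l)" for x
  proof -
    have "norm (l *\<^sub>R x) < 1" using x assms by (simp add: less_divide_eq mult.commute)
    then have "l *\<^sub>R x \<in> thin_ball" using x by (simp add: thin_ball_def mem_Times_iff)
    then have "u (l *\<^sub>R x) * snd (G x) \<le> 0"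
      using u_thin G_thin[OF x(1)] by (intro mult_nonneg_nonpos) auto
    then show ?thesis using uG_thin[OF x(1)] by (simp only: left_diff_distrib)
  qed
qed (use assms in auto)

definition incr :: "real \<Rightarrow> 'm space \<Rightarrow> real" where "incr l x = U (l *\<^sub>R x) - U x"

lemma measurable_scale [measurable]:
  "(\<lambda>x. U (l *\<^sub>R x)) \<in> borel_measurable borel" "(\<lambda>x. V (l *\<^sub>R x)) \<in> borel_measurable borel"
  using measurable_compose[OF _ lift_measurable(1), of "\<lambda>x. l *\<^sub>R x" borel] measurable_compose[OF _ lift_measurable(2), of "\<lambda>x. l *\<^sub>R x" borel]
  by measurable

lemma incr_borel [measurable]: "incr l \<in> borel_measurable borel"
  unfolding incr_def[abs_def] by measurable

lemma incr_bound: "\<bar>incr l x\<bar> \<le> 2 * M"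
  using lift_bounds(1)[of "l *\<^sub>R x"] lift_bounds(1)[of x] unfolding incr_def by linarith

text \<open>Green's inequality for \<open>incr l\<close>, with \<open>|A|\<^sup>2 - |B|\<^sup>2 \<ge> 2 B \<bullet> (A - B)\<close> for the gradients \<open>A\<close>, \<open>B\<close> of
  \<open>u (l x)\<close> and \<open>u x\<close>. The difference quotient at \<open>l = 1\<close> replaces second derivatives of \<open>u\<close>, which need not exist.\<close>

lemma dilation_inequality:
  assumes r: "0 < r" and l: "1 < l" "l * r < 1"
  shows "2 * (r ^ (DIM('m space) - 1) * sph r (\<lambda>x. incr l x * X x) / r - ball_int r (\<lambda>x. fl x * incr l x))
     \<le> l\<^sup>2 / l ^ DIM('m space) * D (l * r) - D r"
proof -
  define J where "J = ball_int r (\<lambda>x. V x \<bullet> (l *\<^sub>R V (l *\<^sub>R x) - V x))"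
  have r1: "r < 1 / l" using l by (simp add: field_simps)
  have lx: "norm (l *\<^sub>R x) < 1" "norm x < 1" if "norm x \<le> r" for x :: "'m space"
  proof -
    have "l * norm x \<le> l * r" using that l by (intro mult_left_mono) auto
    moreover have "1 * norm x \<le> l * norm x" using l by (intro mult_right_mono) auto
    moreover have "norm (l *\<^sub>R x) = l * norm x" using l by simp
    ultimately show "norm (l *\<^sub>R x) < 1" "norm x < 1" using l(2) by linarith+
  qed
  have U2: "U (l *\<^sub>R x) = u (l *\<^sub>R up x)" "U x = u (up x)" "V (l *\<^sub>R x) = G (l *\<^sub>R up x)"
      "V x = G (up x)" "fl x = f (up x)" if "norm x \<le> r" for x
    using lx[OF that] l by (simp_all add: U_def V_def fl_def up_scaleR)
  have Vb: "norm (l *\<^sub>R V (l *\<^sub>R x) - V x) \<le> l * M + M" for x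
  proof -
    have "norm (l *\<^sub>R V (l *\<^sub>R x)) \<le> l * M" using lift_bounds(2)[of "l *\<^sub>R x"] l by simp
    then show ?thesis using norm_triangle_ineq4[of "l *\<^sub>R V (l *\<^sub>R x)" "V x"] lift_bounds(2)[of x] by linarith
  qed
  have Jb: "\<bar>V x \<bullet> (l *\<^sub>R V (l *\<^sub>R x) - V x)\<bar> \<le> M * (l * M + M)" for x
    using Cauchy_Schwarz_ineq2[of "V x" "l *\<^sub>R V (l *\<^sub>R x) - V x"]
      mult_mono[OF lift_bounds(2)[of x] Vb[of x]] M by simp
  have fb: "\<bar>fl x * incr l x\<bar> \<le> M * (2 * M)" for x by (rule abs_mult_le[OF lift_bounds(5) incr_bound])
  have "r ^ (DIM('m space) - 1) * sph r (\<lambda>x. (u (l *\<^sub>R up x) - u (up x)) * (G (up x) \<bullet> up x))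
      \<le> r * ball_int r (\<lambda>x. G (up x) \<bullet> (l *\<^sub>R G (l *\<^sub>R up x) - G (up x)) + f (up x) * (u (l *\<^sub>R up x) - u (up x)))"
    by (rule comparison.green[OF comparison_dilation[OF l(1)] r r1])
  moreover have "sph r (\<lambda>x. (u (l *\<^sub>R up x) - u (up x)) * (G (up x) \<bullet> up x)) = sph r (\<lambda>x. incr l x * X x)"
    by (rule sph_cong) (use r U2 in \<open>auto simp: incr_def X_def\<close>)
  moreover have "ball_int r (\<lambda>x. G (up x) \<bullet> (l *\<^sub>R G (l *\<^sub>R up x) - G (up x)) + f (up x) * (u (l *\<^sub>R up x) - u (up x)))
      = ball_int r (\<lambda>x. 1 * (V x \<bullet> (l *\<^sub>R V (l *\<^sub>R x) - V x)) + 1 * (fl x * incr l x))"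
    by (rule ball_int_cong) (use U2 in \<open>simp add: incr_def\<close>)
  moreover have "\<dots> = 1 * J + 1 * ball_int r (\<lambda>x. fl x * incr l x)"
    unfolding J_def by (rule ball_int_linear[OF _ Jb _ fb]) measurable
  ultimately have "r ^ (DIM('m space) - 1) * sph r (\<lambda>x. incr l x * X x)
      \<le> r * (J + ball_int r (\<lambda>x. fl x * incr l x))" by simp
  then have 1: "r ^ (DIM('m space) - 1) * sph r (\<lambda>x. incr l x * X x) / r - ball_int r (\<lambda>x. fl x * incr l x) \<le> J"
    using r by (simp add: field_simps)
  have lV: "\<bar>V (l *\<^sub>R x) \<bullet> V (l *\<^sub>R x)\<bar> \<le> M * M" for x by (rule VV_bound)
  have "2 * J + 1 * D r = ball_int r (\<lambda>x. 2 * (V x \<bullet> (l *\<^sub>R V (l *\<^sub>R x) - V x)) + 1 * (V x \<bullet> V x))"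
    unfolding J_def D_def by (rule ball_int_linear[OF _ Jb _ VV_bound, symmetric]) measurable
  also have "\<dots> \<le> ball_int r (\<lambda>x. l\<^sup>2 * (V (l *\<^sub>R x) \<bullet> V (l *\<^sub>R x)))"
  proof (rule ball_int_mono)
    show "\<bar>2 * (V x \<bullet> (l *\<^sub>R V (l *\<^sub>R x) - V x)) + 1 * (V x \<bullet> V x)\<bar> \<le> 2 * (M * (l * M + M)) + M * M" for x
      using Jb[of x] VV_bound[of x] by linarith
    show "\<bar>l\<^sup>2 * (V (l *\<^sub>R x) \<bullet> V (l *\<^sub>R x))\<bar> \<le> l\<^sup>2 * (M * M)" for x
      by (rule abs_mult_le[OF _ lV]) simp
    show "2 * (V x \<bullet> (l *\<^sub>R V (l *\<^sub>R x) - V x)) + 1 * (V x \<bullet> V x) \<le> l\<^sup>2 * (V (l *\<^sub>R x) \<bullet> V (l *\<^sub>R x))" for x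
    proof -
      have "0 \<le> (l *\<^sub>R V (l *\<^sub>R x) - V x) \<bullet> (l *\<^sub>R V (l *\<^sub>R x) - V x)" by simp
      then show ?thesis
        by (simp add: inner_diff_left inner_diff_right inner_commute power2_eq_square algebra_simps)
    qed
  qed measurable
  also have "\<dots> = l\<^sup>2 * ball_int r (\<lambda>x. V (l *\<^sub>R x) \<bullet> V (l *\<^sub>R x))"
    unfolding ball_int_def mult.left_commute[of _ "l\<^sup>2"] by (rule integral_mult_right_zero)
  also have "ball_int r (\<lambda>x. V (l *\<^sub>R x) \<bullet> V (l *\<^sub>R x)) = D (l * r) / l ^ DIM('m space)"
  proof -
    have "D (l * r) = l ^ DIM('m space) * ball_int r (\<lambda>x. V (l *\<^sub>R x) \<bullet> V (l *\<^sub>R x))"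
      unfolding D_def by (rule ball_int_scale) (measurable, use l in simp)
    then show ?thesis using l by simp
  qed
  finally have "2 * J \<le> l\<^sup>2 / l ^ DIM('m space) * D (l * r) - D r" by simp
  moreover have "2 * (r ^ (DIM('m space) - 1) * sph r (\<lambda>x. incr l x * X x) / r
      - ball_int r (\<lambda>x. fl x * incr l x)) \<le> 2 * J"
    by (rule mult_left_mono[OF 1]) simp
  ultimately show ?thesis by (rule order_trans[rotated])
qed

lemma incr_lim:
  assumes "snd x \<noteq> 0" "norm x < 1"
  shows "((\<lambda>l. incr l x / (l - 1)) \<longlongrightarrow> X x) (at_right 1)"
proof -
  have "((\<lambda>l. U (l *\<^sub>R x)) has_real_derivative V (1 *\<^sub>R x) \<bullet> up x) (at 1)"
    by (rule U_radial) (use assms in auto)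
  then have "((\<lambda>l. incr l x / (l - 1)) \<longlongrightarrow> X x) (at 1)"
    by (simp add: has_field_derivative_iff incr_def X_def)
  then show ?thesis by (rule tendsto_within_subset) simp
qed

lemma incr_quotient_bound:
  assumes "snd x \<noteq> 0" "1 < l" "norm (l *\<^sub>R x) < 1"
  shows "\<bar>incr l x / (l - 1)\<bar> \<le> M"
proof -
  have "norm x \<le> l * norm x" using assms by (simp add: mult_le_cancel_right1)
  then have n: "norm x < 1" using assms by simp
  have "\<bar>U (l *\<^sub>R x) - U (1 *\<^sub>R x)\<bar> \<le> M * norm x * \<bar>l - 1\<bar>"
    by (rule U_radial_lipschitz) (use assms n in auto)
  also have "\<dots> \<le> M * 1 * \<bar>l - 1\<bar>" using n M by (intro mult_right_mono mult_left_mono) auto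
  finally show ?thesis using assms by (simp add: incr_def abs_divide divide_le_eq)
qed

text \<open>Divide \<open>dilation_inequality\<close> by \<open>l - 1 > 0\<close>. Its right hand
  side becomes the difference quotient at 1 of \<open>l\<^sup>2 / l ^ n * D (l * r)\<close>, whose
  derivative there is the right hand side here; on the left, \<open>incr l x / (l - 1)\<close> tends
  to \<open>X x\<close>.\<close>

lemma rellich:
  assumes r: "0 < r" "r < 1"
  shows "2 * (r ^ (DIM('m space) - 1) * sph r (\<lambda>x. X x * X x) / r - ball_int r (\<lambda>x. fl x * X x))
    \<le> r * (r ^ (DIM('m space) - 1) * sph r (\<lambda>x. V x \<bullet> V x)) + (2 - real DIM('m space)) * D r"
proof -
  define n where "n = DIM('m space)"
  have ev: "\<forall>\<^sub>F l in at_right 1. 1 < l \<and> l * r < 1"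
  proof -
    have "1 < 1 / r" using r by simp
    then have "\<forall>\<^sub>F l in at_right 1. 1 < l \<and> l < 1 / r" by (auto simp: eventually_at_right)
    then show ?thesis by eventually_elim (use r in \<open>simp add: field_simps\<close>)
  qed
  have nl: "norm (l *\<^sub>R x) < 1" if "norm x \<le> r" "1 < l" "l * r < 1" for l and x :: "'m space"
  proof -
    have "l * norm x \<le> l * r" using that by (intro mult_left_mono) auto
    moreover have "norm (l *\<^sub>R x) = l * norm x" using that by simp
    ultimately show ?thesis using that(3) by linarith
  qed
  have limS: "((\<lambda>l. sph r (\<lambda>x. incr l x / (l - 1) * X x)) \<longlongrightarrow> sph r (\<lambda>x. X x * X x)) (at_right 1)"
    unfolding sph_def
  proof (rule tendsto_mult_left, rule dominated_convergence_at_within)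
    show "integrable lborel (\<lambda>x::'m space. indicator (ball 0 1) x * (M * M))"
      by (rule ball_int_integrable[of "\<lambda>x. M * M" "\<bar>M * M\<bar>"]) auto
    have XX: "(\<lambda>x. X (r *\<^sub>R sgn x)) \<in> borel_measurable borel" by (rule sph_measurable[OF lift_measurable(3)])
    then show "(\<lambda>x. indicat_real (ball 0 1) x * (X (r *\<^sub>R sgn x) * X (r *\<^sub>R sgn x))) \<in> borel_measurable lborel"
      by measurable
    have "(\<lambda>x. incr l (r *\<^sub>R sgn x)) \<in> borel_measurable borel" for l by (rule sph_measurable[OF incr_borel])
    with XX show "(\<lambda>x. indicat_real (ball 0 1) x * (incr l (r *\<^sub>R sgn x) / (l - 1) * X (r *\<^sub>R sgn x)))
        \<in> borel_measurable lborel" for l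
      by measurable
    have nr: "norm (r *\<^sub>R sgn x) \<le> r" for x :: "'m space" using r by (auto simp: norm_sgn)
    have sn: "snd (r *\<^sub>R sgn x) \<noteq> 0" if "snd x \<noteq> 0" for x :: "'m space"
      using snd_sgn_neq_0[OF that] r by simp
    show "AE x in lborel. ((\<lambda>l. indicat_real (ball 0 1) x * (incr l (r *\<^sub>R sgn x) / (l - 1) * X (r *\<^sub>R sgn x))) \<longlongrightarrow>
        indicat_real (ball 0 1) x * (X (r *\<^sub>R sgn x) * X (r *\<^sub>R sgn x))) (at_right 1)"
      using AE_snd_neq_0
    proof eventually_elim
      case (elim x)
      have "((\<lambda>l. incr l (r *\<^sub>R sgn x) / (l - 1)) \<longlongrightarrow> X (r *\<^sub>R sgn x)) (at_right 1)"
        by (rule incr_lim) (use sn[OF elim] nr[of x] r in linarith)+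
      then show ?case by (rule tendsto_mult_left[OF tendsto_mult_right])
    qed
    show "\<forall>\<^sub>F l in at_right 1. AE x in lborel.
        norm (indicat_real (ball 0 1) x * (incr l (r *\<^sub>R sgn x) / (l - 1) * X (r *\<^sub>R sgn x))) \<le> indicator (ball 0 1) x * (M * M)"
      using ev
    proof eventually_elim
      case (elim l)
      show ?case using AE_snd_neq_0
      proof eventually_elim
        case (elim x)
        have "\<bar>incr l (r *\<^sub>R sgn x) / (l - 1)\<bar> \<le> M"
          by (rule incr_quotient_bound[OF sn[OF elim]]) (use nl[OF nr[of x]] \<open>1 < l \<and> l * r < 1\<close> in blast)+
        then have "\<bar>incr l (r *\<^sub>R sgn x) / (l - 1) * X (r *\<^sub>R sgn x)\<bar> \<le> M * M"
          by (rule abs_mult_le[OF _ lift_bounds(4)])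
        then show ?case by (cases "x \<in> ball 0 1") simp_all
      qed
    qed
  qed
  have limB: "((\<lambda>l. ball_int r (\<lambda>x. fl x * (incr l x / (l - 1)))) \<longlongrightarrow> ball_int r (\<lambda>x. fl x * X x)) (at_right 1)"
    unfolding ball_int_def
  proof (rule dominated_convergence_at_within)
    show "integrable lborel (\<lambda>x::'m space. indicator (ball 0 r) x * (M * M))"
      by (rule ball_int_integrable[of "\<lambda>x. M * M" "\<bar>M * M\<bar>"]) auto
    show "(\<lambda>x. indicat_real (ball 0 r) x * (fl x * X x)) \<in> borel_measurable lborel" by measurable
    show "(\<lambda>x. indicat_real (ball 0 r) x * (fl x * (incr l x / (l - 1)))) \<in> borel_measurable lborel" for l
      by measurable
    show "AE x in lborel. ((\<lambda>l. indicat_real (ball 0 r) x * (fl x * (incr l x / (l - 1)))) \<longlongrightarrow>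
        indicat_real (ball 0 r) x * (fl x * X x)) (at_right 1)"
      using AE_snd_neq_0
    proof eventually_elim
      case (elim x)
      show ?case
      proof (cases "x \<in> ball 0 r")
        case True
        then have "((\<lambda>l. incr l x / (l - 1)) \<longlongrightarrow> X x) (at_right 1)"
          using elim r by (intro incr_lim) auto
        then show ?thesis by (intro tendsto_mult_left)
      qed simp
    qed
    show "\<forall>\<^sub>F l in at_right 1. AE x in lborel.
        norm (indicat_real (ball 0 r) x * (fl x * (incr l x / (l - 1)))) \<le> indicator (ball 0 r) x * (M * M)"
      using ev
    proof eventually_elim
      case (elim l)
      show ?case using AE_snd_neq_0
      proof eventually_elim
        case (elim x)
        show ?case
        proof (cases "x \<in> ball 0 r")
          case True
          then have "\<bar>incr l x / (l - 1)\<bar> \<le> M"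
            using elim \<open>1 < l \<and> l * r < 1\<close> by (intro incr_quotient_bound nl) auto
          then have "\<bar>fl x * (incr l x / (l - 1))\<bar> \<le> M * M" by (rule abs_mult_le[OF lift_bounds(5)])
          then show ?thesis using True by (simp del: mem_ball)
        qed simp
      qed
    qed
  qed
  have lim1: "((\<lambda>l. 2 * (r ^ (n - 1) * sph r (\<lambda>x. incr l x / (l - 1) * X x) / r
        - ball_int r (\<lambda>x. fl x * (incr l x / (l - 1))))) \<longlongrightarrow>
      2 * (r ^ (n - 1) * sph r (\<lambda>x. X x * X x) / r - ball_int r (\<lambda>x. fl x * X x))) (at_right 1)"
    by (intro tendsto_mult_left tendsto_diff tendsto_divide tendsto_const limS limB) (use r in simp)
  define \<phi> where "\<phi> l = l\<^sup>2 / l ^ n * D (l * r)" for l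
  define D' where "D' = r ^ (n - 1) * sph r (\<lambda>x. V x \<bullet> V x)"
  have d1: "((\<lambda>l. D (l * r)) has_real_derivative D' * r) (at 1)"
  proof -
    have a: "(D has_real_derivative D') (at (1 * r))" using DERIV_D[OF r] by (simp add: D'_def n_def)
    have b: "((\<lambda>l. l * r) has_real_derivative r) (at 1)" by (auto intro!: derivative_eq_intros)
    show ?thesis by (rule DERIV_chain2[where f=D and g="\<lambda>l. l * r", OF a b])
  qed
  have "((\<lambda>l. l\<^sup>2 / l ^ n) has_real_derivative (2 - real n)) (at (1::real))"
    by (auto intro!: derivative_eq_intros)
  from DERIV_mult[OF this d1] have "(\<phi> has_real_derivative r * D' + (2 - real n) * D r) (at 1)"
    unfolding \<phi>_def by (simp add: algebra_simps)
  then have "((\<lambda>l. (\<phi> l - \<phi> 1) / (l - 1)) \<longlongrightarrow> r * D' + (2 - real n) * D r) (at 1)"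
    by (simp add: has_field_derivative_iff)
  then have lim2: "((\<lambda>l. (\<phi> l - \<phi> 1) / (l - 1)) \<longlongrightarrow> r * D' + (2 - real n) * D r) (at_right 1)"
    by (rule tendsto_within_subset) simp
  have "2 * (r ^ (n - 1) * sph r (\<lambda>x. X x * X x) / r - ball_int r (\<lambda>x. fl x * X x)) \<le> r * D' + (2 - real n) * D r"
  proof (rule tendsto_le[OF _ lim2 lim1])
    show "\<forall>\<^sub>F l in at_right 1. 2 * (r ^ (n - 1) * sph r (\<lambda>x. incr l x / (l - 1) * X x) / r
        - ball_int r (\<lambda>x. fl x * (incr l x / (l - 1)))) \<le> (\<phi> l - \<phi> 1) / (l - 1)"
      using ev
    proof eventually_elim
      case (elim l)
      have s: "sph r (\<lambda>x. incr l x / (l - 1) * X x) = sph r (\<lambda>x. incr l x * X x) / (l - 1)"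
        unfolding sph_def by (simp only: times_divide_eq_left times_divide_eq_right integral_divide_zero)
      have b: "ball_int r (\<lambda>x. fl x * (incr l x / (l - 1))) = ball_int r (\<lambda>x. fl x * incr l x) / (l - 1)"
        unfolding ball_int_def by (simp only: times_divide_eq_right integral_divide_zero)
      have "2 * (r ^ (n - 1) * (A / t) / r - B / t) = 2 * (r ^ (n - 1) * A / r - B) / t" for A B t :: real
        by (simp add: diff_divide_distrib)
      then have "2 * (r ^ (n - 1) * sph r (\<lambda>x. incr l x / (l - 1) * X x) / r
        - ball_int r (\<lambda>x. fl x * (incr l x / (l - 1)))) =
        2 * (r ^ (n - 1) * sph r (\<lambda>x. incr l x * X x) / r - ball_int r (\<lambda>x. fl x * incr l x)) / (l - 1)"
        unfolding s b .
      also have "\<dots> \<le> (\<phi> l - \<phi> 1) / (l - 1)"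
        using dilation_inequality[OF r(1), of l] elim
        by (intro divide_right_mono) (auto simp: \<phi>_def n_def)
      finally show ?case .
    qed
  qed simp
  then show ?thesis by (simp add: n_def D'_def)
qed

section \<open>Scale invariant quantities and their differential relations\<close>

definition ht :: "real \<Rightarrow> real" where "ht s = sph s (\<lambda>x. U x * U x)"
text \<open>The factor \<open>s ^ (2 - n)\<close>, written as a quotient of natural powers because
  \<open>2 - n\<close> may be negative.\<close>

definition scl :: "real \<Rightarrow> real" where "scl s = s\<^sup>2 / s ^ DIM('m space)"
definition dir :: "real \<Rightarrow> real" where "dir s = scl s * D s"
definition dir' :: "real \<Rightarrow> real" where
  "dir' s = scl s / s * ((2 - real DIM('m space)) * D s
     + s * (s ^ (DIM('m space) - 1) * sph s (\<lambda>x. V x \<bullet> V x)))"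
definition err :: "real \<Rightarrow> real" where "err s = scl s * ball_int s (\<lambda>x. fl x * U x)"
definition rad :: "real \<Rightarrow> real" where "rad s = sph s (\<lambda>x. X x * X x)"

lemma scl_pos: "0 < s \<Longrightarrow> 0 < scl s"
  by (simp add: scl_def)

lemma scl_pow: "0 < s \<Longrightarrow> scl s * s ^ (DIM('m space) - 1) = s" "0 < s \<Longrightarrow> scl s * s ^ DIM('m space) = s\<^sup>2"
proof -
  assume s: "0 < s"
  obtain m where m: "DIM('m space) = Suc m" using gr0_implies_Suc[OF DIM_positive] by blast
  show "scl s * s ^ (DIM('m space) - 1) = s"
    unfolding scl_def m using s by (simp add: power2_eq_square)
  show "scl s * s ^ DIM('m space) = s\<^sup>2"
    unfolding scl_def using s by simp
qed

lemma DERIV_scl: "0 < s \<Longrightarrow> (scl has_real_derivative scl s / s * (2 - real DIM('m space))) (at s)"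
proof -
  assume s: "0 < s"
  obtain m where m: "DIM('m space) = Suc m" using gr0_implies_Suc[OF DIM_positive] by blast
  have "((\<lambda>s. s\<^sup>2) has_real_derivative 2 * s) (at s)" by (auto intro!: derivative_eq_intros)
  moreover have "((\<lambda>s. s ^ Suc m) has_real_derivative real (Suc m) * s ^ m) (at s)"
    using DERIV_pow[of "Suc m" s UNIV] by simp
  ultimately have "((\<lambda>s. s\<^sup>2 / s ^ Suc m) has_real_derivative
      (2 * s * s ^ Suc m - s\<^sup>2 * (real (Suc m) * s ^ m)) / (s ^ Suc m * s ^ Suc m)) (at s)"
    by (rule DERIV_divide) (use s in simp)
  moreover have "(2 * s * s ^ Suc m - s\<^sup>2 * (real (Suc m) * s ^ m)) / (s ^ Suc m * s ^ Suc m)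
      = s\<^sup>2 / s ^ Suc m / s * (2 - real (Suc m))"
    using s by (simp add: field_simps power2_eq_square)
  ultimately show ?thesis unfolding scl_def[abs_def] m by (simp only:)
qed

lemma DERIV_dir:
  assumes "0 < s" "s < 1"
  shows "(dir has_real_derivative dir' s) (at s)"
proof -
  have "((\<lambda>s. scl s * D s) has_real_derivative scl s / s * (2 - real DIM('m space)) * D s
      + s ^ (DIM('m space) - 1) * sph s (\<lambda>x. V x \<bullet> V x) * scl s) (at s)"
    by (rule DERIV_mult[OF DERIV_scl[OF assms(1)] DERIV_D[OF assms]])
  moreover have "scl s / s * (2 - real DIM('m space)) * D s
      + s ^ (DIM('m space) - 1) * sph s (\<lambda>x. V x \<bullet> V x) * scl s = dir' s"
    unfolding dir'_def using assms by (simp add: field_simps)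
  ultimately show ?thesis by (simp add: dir_def[abs_def])
qed

lemma product_bounds: "\<bar>U x * U x\<bar> \<le> M * M" "\<bar>X x * X x\<bar> \<le> M * M" "\<bar>U x * X x\<bar> \<le> M * M"
  "\<bar>fl x * U x\<bar> \<le> M * M" "\<bar>fl x * X x\<bar> \<le> M * M"
  by (rule abs_mult_le; rule lift_bounds)+

lemma dir_plus_err:
  assumes s: "0 < s" "s < 1"
  shows "dir s + err s = sph s (\<lambda>x. U x * X x)"
proof -
  have "s * (dir s + err s) = scl s * (s * (D s + ball_int s (\<lambda>x. fl x * U x)))"
    by (simp add: dir_def err_def algebra_simps)
  also have "\<dots> = scl s * (s ^ (DIM('m space) - 1) * sph s (\<lambda>x. U x * X x))"
    using energy_identity[OF s] by (simp add: D_def)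
  also have "\<dots> = (scl s * s ^ (DIM('m space) - 1)) * sph s (\<lambda>x. U x * X x)" by (simp only: mult.assoc)
  also have "\<dots> = s * sph s (\<lambda>x. U x * X x)" by (simp only: scl_pow(1)[OF s(1)])
  finally show ?thesis using s by simp
qed

lemma abs_ball_int_le:
  fixes F F' :: "'m space \<Rightarrow> real"
  assumes "F \<in> borel_measurable borel" "\<And>x. \<bar>F x\<bar> \<le> B"
    and "F' \<in> borel_measurable borel" "\<And>x. \<bar>F' x\<bar> \<le> B'"
    and "\<And>x. norm x < r \<Longrightarrow> \<bar>F x\<bar> \<le> F' x"
  shows "\<bar>ball_int r F\<bar> \<le> ball_int r F'"
proof -
  have "ball_int r F \<le> ball_int r F'"
    by (rule ball_int_mono[OF assms(1-4)]) (use assms(5) in \<open>force simp: abs_le_iff\<close>)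
  moreover have "ball_int r (\<lambda>x. - F x) \<le> ball_int r F'"
    by (rule ball_int_mono[OF _ _ assms(3,4), where B=B])
      (use assms(1,2) in simp, use assms(2) in simp, use assms(5) in \<open>force simp: abs_le_iff\<close>)
  moreover have "ball_int r (\<lambda>x. - F x) = - ball_int r F" by (simp add: ball_int_def)
  ultimately show ?thesis by (simp add: abs_le_iff)
qed

definition vol :: real where "vol = unit_vol TYPE('m space)"

lemma vol_nonneg: "0 \<le> vol" unfolding vol_def by (rule unit_vol_nonneg)

text \<open>Young's inequality for \<open>y\<close> and \<open>s ^ k\<close>, divided by
  \<open>s\<close>; \<open>1 \<le> k\<close> makes \<open>s ^ k\<close> equal to
  \<open>s * s ^ (k - 1)\<close>.\<close>

lemma power_split:
  fixes s y :: real
  assumes "1 \<le> k" "0 < s" "0 \<le> y"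
  shows "s ^ (k - 1) * y \<le> (y * y + s ^ (2 * k)) / (2 * s)"
proof -
  have "0 \<le> (y - s ^ k)\<^sup>2" by simp
  then have "2 * (s ^ k * y) \<le> y * y + s ^ (2 * k)"
    unfolding power_even_eq by (simp add: power2_eq_square algebra_simps)
  moreover have "s ^ k = s * s ^ (k - 1)" using assms(1) by (cases k) auto
  ultimately have "(s ^ (k - 1) * y) * (2 * s) \<le> y * y + s ^ (2 * k)" by (simp add: mult_ac)
  then show ?thesis using assms(2) by (subst pos_le_divide_eq) auto
qed

lemma ball_int_const_plus:
  fixes F :: "'m space \<Rightarrow> real"
  assumes "F \<in> borel_measurable borel" "\<And>x. \<bar>F x\<bar> \<le> B" "0 < s"
  shows "ball_int s (\<lambda>x. a * F x + b) = a * ball_int s F + b * (s ^ DIM('m space) * vol)"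
proof -
  have "ball_int s (\<lambda>x. a * F x + b * 1) = a * ball_int s F + b * ball_int s (\<lambda>x::'m space. 1)"
    by (rule ball_int_linear[OF assms(1,2), where F'="\<lambda>x. 1" and B'=1]) auto
  then show ?thesis using ball_int_const[OF assms(3), where 'a="'m space" and c=1] by (simp add: vol_def)
qed

text \<open>In the ball of radius \<open>s\<close> the source is at most
  \<open>M * s ^ (k - 1)\<close>, and \<open>power_split\<close> separates it from \<open>Y\<close>.
  It serves twice: with \<open>Y = U\<close> for \<open>err\<close>, and with \<open>Y = X\<close>
  and \<open>Z x = s\<^sup>2 * (V x \<bullet> V x)\<close> for the source term in the Rellich
  inequality.\<close>

lemma source_ball_int_le:
  fixes Y :: "'m space \<Rightarrow> real"
  assumes k: "1 \<le> k" and s: "0 < s"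
    and Y: "Y \<in> borel_measurable borel" "\<And>x. \<bar>Y x\<bar> \<le> B"
    and Z: "Z \<in> borel_measurable borel" "\<And>x. \<bar>Z x\<bar> \<le> B'"
    and YZ: "\<And>x. norm x < s \<Longrightarrow> Y x * Y x \<le> Z x"
  shows "scl s * \<bar>ball_int s (\<lambda>x. fl x * Y x)\<bar> \<le> M / 2 * (scl s / s * ball_int s Z + s * s ^ (2 * k) * vol)"
proof -
  have b: "\<bar>fl x * Y x\<bar> \<le> M * B" for x by (rule abs_mult_le[OF lift_bounds(5) Y(2)])
  have "\<bar>ball_int s (\<lambda>x. fl x * Y x)\<bar> \<le> ball_int s (\<lambda>x. M / (2 * s) * Z x + M / (2 * s) * s ^ (2 * k))"
  proof (rule abs_ball_int_le[OF _ b])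
    show "\<bar>M / (2 * s) * Z x + M / (2 * s) * s ^ (2 * k)\<bar> \<le> M / (2 * s) * B' + M / (2 * s) * s ^ (2 * k)" for x
    proof -
      have "\<bar>M / (2 * s) * Z x\<bar> \<le> M / (2 * s) * B'" using M s by (intro abs_mult_le Z) auto
      moreover have "0 \<le> M / (2 * s) * s ^ (2 * k)" using M s by simp
      ultimately show ?thesis by linarith
    qed
    show "\<bar>fl x * Y x\<bar> \<le> M / (2 * s) * Z x + M / (2 * s) * s ^ (2 * k)" if x: "norm x < s" for x
    proof -
      have "\<bar>fl x\<bar> \<le> M * norm x ^ (k - 1)" by (rule lift_bounds)
      also have "\<dots> \<le> M * s ^ (k - 1)" using M x by (intro mult_left_mono power_mono) auto
      finally have "\<bar>fl x * Y x\<bar> \<le> M * s ^ (k - 1) * \<bar>Y x\<bar>" by (rule abs_mult_le) simp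
      also have "\<dots> = M * (s ^ (k - 1) * \<bar>Y x\<bar>)" by simp
      also have "\<dots> \<le> M * ((\<bar>Y x\<bar> * \<bar>Y x\<bar> + s ^ (2 * k)) / (2 * s))"
        using M by (intro mult_left_mono power_split k s) auto
      also have "\<dots> \<le> M * ((Z x + s ^ (2 * k)) / (2 * s))"
        using M s YZ[OF x] by (intro mult_left_mono divide_right_mono) auto
      also have "\<dots> = M / (2 * s) * Z x + M / (2 * s) * s ^ (2 * k)"
        by (simp add: add_divide_distrib algebra_simps)
      finally show ?thesis .
    qed
    show "(\<lambda>x. fl x * Y x) \<in> borel_measurable borel" using Y(1) lift_measurable(4) by measurable
    show "(\<lambda>x. M / (2 * s) * Z x + M / (2 * s) * s ^ (2 * k)) \<in> borel_measurable borel" using Z(1) by measurable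
  qed
  also have "\<dots> = M / (2 * s) * ball_int s Z + M / (2 * s) * s ^ (2 * k) * (s ^ DIM('m space) * vol)"
    by (rule ball_int_const_plus[OF Z s])
  finally have "scl s * \<bar>ball_int s (\<lambda>x. fl x * Y x)\<bar> \<le>
      scl s * (M / (2 * s) * ball_int s Z + M / (2 * s) * s ^ (2 * k) * (s ^ DIM('m space) * vol))"
    using scl_pos[OF s] by (intro mult_left_mono) auto
  also have "\<dots> = M / 2 * (scl s / s * ball_int s Z + (scl s * s ^ DIM('m space)) / s * s ^ (2 * k) * vol)"
    using s by (simp add: field_simps)
  also have "(scl s * s ^ DIM('m space)) / s = s"
    unfolding scl_pow(2)[OF s] using s by (simp add: power2_eq_square)
  finally show ?thesis .
qed

lemma ht_nonneg: "0 \<le> ht s" unfolding ht_def by (rule sph_nonneg) simp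

text \<open>The ball integral of \<open>U x * U x\<close> has derivative
  \<open>t ^ (n - 1) * ht t\<close>, so subtracting \<open>m * t ^ n / n\<close> leaves a
  nonincreasing function. Near 0 the ball integral is at most \<open>M * M\<close> times the volume,
  and this tends to 0.\<close>

lemma ball_int_UU_le:
  assumes s: "0 < s" "s < 1" and m: "\<And>t. 0 < t \<Longrightarrow> t \<le> s \<Longrightarrow> ht t \<le> m"
  shows "ball_int s (\<lambda>x. U x * U x) \<le> m * s ^ DIM('m space)"
proof -
  define n where "n = DIM('m space)"
  have n: "2 \<le> n" unfolding n_def by (rule DIM_ge_2)
  define K where "K t = ball_int t (\<lambda>x. U x * U x)" for t
  have m0: "0 \<le> m" using order_trans[OF ht_nonneg m[of s]] s by simp
  have dK: "(K has_real_derivative t ^ (n - 1) * ht t) (at t)" if "0 < t" "t < 1" for t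
    unfolding K_def[abs_def] ht_def n_def
  proof (rule DERIV_ball_int)
    show "continuous_on (ball 0 1) (\<lambda>x. U x * U x)" by (intro continuous_intros lift_continuous)
  qed (use that in measurable)
  have le: "K s - m * s ^ n / n \<le> M * M * (t ^ n * vol)" if t: "0 < t" "t \<le> s" for t
  proof -
    have "K s - m * s ^ n / n \<le> K t - m * t ^ n / n"
    proof (rule DERIV_nonpos_imp_nonincreasing[OF t(2)])
      fix x assume x: "t \<le> x" "x \<le> s"
      have "((\<lambda>x. K x - m * x ^ n / n) has_real_derivative x ^ (n - 1) * ht x - m * x ^ (n - 1)) (at x)"
        using x t s n by (auto intro!: derivative_eq_intros dK)
      moreover have "x ^ (n - 1) * ht x - m * x ^ (n - 1) \<le> 0"
        using m[of x] x t mult_left_mono[of "ht x" m "x ^ (n - 1)"] by (simp add: mult.commute)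
      ultimately show "\<exists>y. ((\<lambda>x. K x - m * x ^ n / n) has_real_derivative y) (at x) \<and> y \<le> 0" by blast
    qed
    also have "\<dots> \<le> K t" using m0 t by simp
    also have "\<dots> \<le> ball_int t (\<lambda>x::'m space. M * M)"
      unfolding K_def by (rule ball_int_mono[OF _ product_bounds(1), where B'="\<bar>M * M\<bar>"]) (use product_bounds(1) in \<open>auto simp: abs_le_iff\<close>)
    also have "\<dots> = M * M * (t ^ n * vol)"
      unfolding ball_int_const[OF t(1)] by (simp add: vol_def n_def)
    finally show ?thesis .
  qed
  have "((\<lambda>t. M * M * (t ^ n * vol)) \<longlongrightarrow> M * M * (0 ^ n * vol)) (at_right 0)"
    by (intro tendsto_intros)
  then have "K s - m * s ^ n / n \<le> M * M * (0 ^ n * vol)"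
  proof (rule tendsto_lowerbound)
    show "\<forall>\<^sub>F t in at_right 0. K s - m * s ^ n / n \<le> M * M * (t ^ n * vol)"
      using le s by (auto simp: eventually_at_right intro!: exI[of _ s])
  qed simp
  moreover have "m * s ^ n / n \<le> m * s ^ n / 1"
    using m0 s n by (intro divide_left_mono) auto
  ultimately show ?thesis using n by (simp add: K_def n_def)
qed

text \<open>One constant for all requirements of \<open>frequency_system\<close>:
  \<open>2 ^ n\<close> for the doubling of \<open>dir\<close>, \<open>M * (1 + vol)\<close> for the
  source terms, the last summand for the bound on \<open>ht\<close>. It is built from
  \<open>n\<close> and \<open>M\<close> alone and not from \<open>u\<close> or \<open>f\<close>, and
  the uniformity of the final constants rests on this.\<close>

definition cst :: real where
  "cst = 1 + 2 ^ DIM('m space) + M * (1 + vol) + DIM('m space) * (vol * (M * M))"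

lemma cst: "1 \<le> cst" "2 ^ DIM('m space) \<le> cst" "M * (1 + vol) \<le> cst" "DIM('m space) * (vol * (M * M)) \<le> cst"
proof -
  have "0 \<le> (2::real) ^ DIM('m space)" "0 \<le> M * (1 + vol)" "0 \<le> real DIM('m space) * (vol * (M * M))"
    using M vol_nonneg by auto
  then show "1 \<le> cst" "2 ^ DIM('m space) \<le> cst" "M * (1 + vol) \<le> cst" "DIM('m space) * (vol * (M * M)) \<le> cst"
    unfolding cst_def by linarith+
qed

lemma cst_bound:
  assumes "0 \<le> A" "0 \<le> B"
  shows "M * (A + B * vol) \<le> cst * (A + B)"
proof -
  have "A + B * vol \<le> (1 + vol) * (A + B)"
    using assms vol_nonneg by (simp add: algebra_simps)
  then have "M * (A + B * vol) \<le> M * (1 + vol) * (A + B)"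
    using M by (simp add: mult.assoc mult_left_mono)
  also have "\<dots> \<le> cst * (A + B)" using cst(3) assms by (intro mult_right_mono) auto
  finally show ?thesis .
qed

lemma frequency_system:
  assumes k: "1 \<le> k" and \<kappa>: "\<kappa> \<le> real k"
    and freq: "\<And>\<eta> \<rho>. 0 < \<eta> \<Longrightarrow> 0 < \<rho> \<Longrightarrow>
        (\<exists>s. 0 < s \<and> s < \<rho> \<and> s ^ (2 * k) < ht s \<and> \<bar>(dir s + err s) / ht s - \<kappa>\<bar> \<le> \<eta>) \<or>
        (\<kappa> = real k \<and> (\<exists>s. 0 < s \<and> s < \<rho> \<and> ht s \<le> s ^ (2 * k)))"
  shows "frequency_system ht dir dir' err rad k cst \<kappa>"
proof
  show "1 \<le> cst" by (rule cst)
  show "continuous_on {0..<1} ht" unfolding ht_def[abs_def]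
    by (rule continuous_on_sph[OF _ product_bounds(1)]) (measurable, intro continuous_intros lift_continuous)
  have "U 0 = 0" using u_0 by (simp add: U_def up_def zero_prod_def)
  then show "ht 0 = 0" by (simp add: ht_def sph_def)
  show "0 \<le> ht s" for s by (rule ht_nonneg)
  show "ht s \<le> cst" for s
  proof -
    have "ht s \<le> DIM('m space) * (vol * (M * M))"
      unfolding ht_def vol_def by (rule sph_le[OF _ product_bounds(1)]) measurable
    then show ?thesis using cst(4) by (rule order_trans)
  qed
  show "\<kappa> \<le> real k" by (rule \<kappa>)
  show "(\<exists>s. 0 < s \<and> s < \<rho> \<and> s ^ (2 * k) < ht s \<and> \<bar>(dir s + err s) / ht s - \<kappa>\<bar> \<le> \<eta>) \<or>
        (\<kappa> = real k \<and> (\<exists>s. 0 < s \<and> s < \<rho> \<and> ht s \<le> s ^ (2 * k)))" if "0 < \<eta>" "0 < \<rho>" for \<eta> \<rho>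
    by (rule freq[OF that])
next
  fix s :: real assume s: "0 < s" "s < 1"
  have D0: "0 \<le> D s" unfolding D_def by (rule ball_int_nonneg) simp
  show "(ht has_real_derivative 2 * (dir s + err s) / s) (at s)"
    unfolding dir_plus_err[OF s] ht_def[abs_def] by (rule DERIV_height[OF s])
  show "(dir has_real_derivative dir' s) (at s)" by (rule DERIV_dir[OF s])
  show d0: "0 \<le> dir s" using D0 scl_pos[OF s(1)] by (simp add: dir_def)
  \<comment> \<open>The Rellich inequality multiplied by \<open>scl s\<close>: its right hand side
    becomes \<open>s * dir' s\<close>, and \<open>scl s * s ^ (n - 1) = s\<close> turns the sphere
    term into \<open>2 * rad s\<close>.\<close>
  show "2 * rad s - cst * s * (s ^ (2 * k) + dir s) \<le> s * dir' s"
  proof -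
    define S where "S = s ^ (DIM('m space) - 1) * rad s"
    define I where "I = ball_int s (\<lambda>x. fl x * X x)"
    have "scl s * (2 * (S / s - I)) \<le> scl s * (s * (s ^ (DIM('m space) - 1) * sph s (\<lambda>x. V x \<bullet> V x))
        + (2 - real DIM('m space)) * D s)"
      using rellich[OF s] scl_pos[OF s(1)] unfolding S_def I_def rad_def by (intro mult_left_mono) auto
    also have "\<dots> = s * dir' s" using s by (simp add: dir'_def algebra_simps)
    finally have 1: "2 * (scl s * S / s) - 2 * (scl s * I) \<le> s * dir' s"
      by (simp add: algebra_simps)
    have "scl s * S = (scl s * s ^ (DIM('m space) - 1)) * rad s" by (simp add: S_def mult.assoc)
    then have 2: "scl s * S / s = rad s" unfolding scl_pow(1)[OF s(1)] using s by simp
    have "scl s * \<bar>I\<bar> \<le> M / 2 * (scl s / s * ball_int s (\<lambda>x. s\<^sup>2 * (V x \<bullet> V x)) + s * s ^ (2 * k) * vol)"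
      unfolding I_def
    proof (rule source_ball_int_le[OF k s(1) _ lift_bounds(4)])
      show "\<bar>s\<^sup>2 * (V x \<bullet> V x)\<bar> \<le> s\<^sup>2 * (M * M)" for x by (rule abs_mult_le[OF _ VV_bound]) simp
      show "X x * X x \<le> s\<^sup>2 * (V x \<bullet> V x)" if "norm x < s" for x
      proof -
        have "\<bar>X x\<bar> \<le> s * norm (V x)"
          using lift_bounds(3)[of x] mult_right_mono[of "norm x" s "norm (V x)"] that by simp
        then have "\<bar>X x\<bar>\<^sup>2 \<le> (s * norm (V x))\<^sup>2" by (intro power_mono) auto
        then show ?thesis by (simp add: power_mult_distrib dot_square_norm power2_eq_square mult_ac)
      qed
    qed measurable
    also have "ball_int s (\<lambda>x. s\<^sup>2 * (V x \<bullet> V x)) = s\<^sup>2 * D s"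
      unfolding ball_int_def D_def mult.left_commute[of _ "s\<^sup>2"] by (rule integral_mult_right_zero)
    also have "scl s / s * (s\<^sup>2 * D s) = s * dir s" using s by (simp add: dir_def power2_eq_square)
    also have "s * dir s + s * s ^ (2 * k) * vol = s * (dir s + s ^ (2 * k) * vol)" by (simp add: algebra_simps)
    finally have "2 * (scl s * \<bar>I\<bar>) \<le> s * (M * (dir s + s ^ (2 * k) * vol))" by (simp add: mult_ac)
    also have "\<dots> \<le> s * (cst * (dir s + s ^ (2 * k)))"
      using s d0 by (intro mult_left_mono cst_bound) auto
    finally have "2 * (scl s * \<bar>I\<bar>) \<le> cst * s * (s ^ (2 * k) + dir s)" by (simp add: mult_ac add.commute)
    moreover have "scl s * I \<le> scl s * \<bar>I\<bar>" using scl_pos[OF s(1)] by (intro mult_left_mono) auto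
    ultimately show ?thesis using 1 2 by linarith
  qed
  show "\<bar>err s\<bar> \<le> cst * s * (m + s ^ (2 * k))" if m: "\<And>t. 0 < t \<Longrightarrow> t \<le> s \<Longrightarrow> ht t \<le> m" for m
  proof -
    have m0: "0 \<le> m" using order_trans[OF ht_nonneg m[of s]] s by simp
    have "\<bar>err s\<bar> = scl s * \<bar>ball_int s (\<lambda>x. fl x * U x)\<bar>"
      using scl_pos[OF s(1)] by (simp add: err_def abs_mult)
    also have "\<dots> \<le> M / 2 * (scl s / s * ball_int s (\<lambda>x. U x * U x) + s * s ^ (2 * k) * vol)"
      by (rule source_ball_int_le[OF k s(1) lift_measurable(1) lift_bounds(1) _ product_bounds(1)]) (use lift_measurable in auto)
    also have "\<dots> \<le> M / 2 * (scl s / s * (m * s ^ DIM('m space)) + s * s ^ (2 * k) * vol)"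
      using M s scl_pos[OF s(1)] ball_int_UU_le[OF s m]
      by (intro mult_left_mono add_right_mono) auto
    also have "scl s / s * (m * s ^ DIM('m space)) = (scl s * s ^ DIM('m space)) / s * m" by (simp add: mult_ac)
    also have "(scl s * s ^ DIM('m space)) / s = s"
      unfolding scl_pow(2)[OF s(1)] using s by (simp add: power2_eq_square)
    also have "M / 2 * (s * m + s * s ^ (2 * k) * vol) = s / 2 * (M * (m + s ^ (2 * k) * vol))"
      by (simp add: algebra_simps)
    also have "\<dots> \<le> s / 2 * (cst * (m + s ^ (2 * k)))"
      using s m0 by (intro mult_left_mono cst_bound) auto
    also have "\<dots> \<le> s * (cst * (m + s ^ (2 * k)))"
      using s m0 cst(1) by (intro mult_right_mono) auto
    finally show ?thesis by (simp add: mult_ac)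
  qed
  \<comment> \<open>Expands the sphere integral of \<open>(X x - y * U x)\<^sup>2\<close>; by the
    energy identity the mixed term is \<open>dir s + err s\<close>.\<close>
  show "0 \<le> rad s - 2 * y * (dir s + err s) + y\<^sup>2 * ht s" for y
  proof -
    have "sph s (\<lambda>x. 1 * (X x * X x) + (- 2 * y) * (U x * X x)) = 1 * rad s + (- 2 * y) * (dir s + err s)"
      unfolding rad_def dir_plus_err[OF s] by (rule sph_linear[OF _ product_bounds(2) _ product_bounds(3)]) measurable
    moreover have "sph s (\<lambda>x. 1 * (1 * (X x * X x) + (- 2 * y) * (U x * X x)) + y\<^sup>2 * (U x * U x)) =
        1 * sph s (\<lambda>x. 1 * (X x * X x) + (- 2 * y) * (U x * X x)) + y\<^sup>2 * ht s"
      unfolding ht_def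
    proof (rule sph_linear[OF _ _ _ product_bounds(1)])
      show "\<bar>1 * (X x * X x) + (- 2 * y) * (U x * X x)\<bar> \<le> M * M + \<bar>- 2 * y\<bar> * (M * M)" for x
        using product_bounds(2)[of x] abs_mult_le[OF order_refl product_bounds(3)[of x], of "- 2 * y"] by linarith
    qed measurable
    moreover have "(\<lambda>x. 1 * (1 * (X x * X x) + (- 2 * y) * (U x * X x)) + y\<^sup>2 * (U x * U x)) =
        (\<lambda>x. (X x - y * U x)\<^sup>2)"
      by (auto simp: power2_eq_square algebra_simps)
    moreover have "0 \<le> sph s (\<lambda>x. (X x - y * U x)\<^sup>2)" by (rule sph_nonneg) simp
    ultimately show ?thesis by simp
  qed
next
  fix r s :: real assume rs: "0 < r" "r \<le> s" "s \<le> 2 * r" "s < 1"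
  have Ds: "0 \<le> D s" unfolding D_def by (rule ball_int_nonneg) simp
  have "D r \<le> D s"
    unfolding D_def ball_int_def
    by (intro integral_mono ball_int_integrable[OF _ VV_bound])
      (measurable, use rs in \<open>auto simp: indicator_def\<close>)
  then have "dir r \<le> scl r * D s" using scl_pos[OF rs(1)] by (simp add: dir_def)
  also have "scl r \<le> 2 ^ DIM('m space) * scl s"
  proof -
    have "s ^ DIM('m space) \<le> (2 * r) ^ DIM('m space)" using rs by (intro power_mono) auto
    moreover have "r\<^sup>2 \<le> s\<^sup>2" using rs by (intro power_mono) auto
    ultimately have "r\<^sup>2 * s ^ DIM('m space) \<le> s\<^sup>2 * (2 * r) ^ DIM('m space)"
      using rs by (intro mult_mono) auto
    also have "\<dots> = 2 ^ DIM('m space) * s\<^sup>2 * r ^ DIM('m space)" unfolding power_mult_distrib by simp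
    finally show ?thesis unfolding scl_def times_divide_eq_right
      using rs by (intro frac_le_eq[THEN iffD2] divide_le_eq[THEN iffD2]) (auto simp: field_simps)
  qed
  then have "scl r * D s \<le> 2 ^ DIM('m space) * scl s * D s" using Ds by (rule mult_right_mono)
  also have "\<dots> = 2 ^ DIM('m space) * dir s" by (simp add: dir_def)
  also have "\<dots> \<le> cst * dir s"
    using cst(2) Ds scl_pos[of s] rs by (intro mult_right_mono) (auto simp: dir_def)
  finally show "dir r \<le> cst * dir s" .
qed

end

section \<open>Solutions of the thin obstacle problem\<close>

lemma GDERIV_gradient:
  fixes f :: "'a::euclidean_space \<Rightarrow> real"
  assumes "f differentiable (at x)"
  shows "GDERIV f x :> gradient f x"
proof -
  obtain f' where f': "(f has_derivative f') (at x)" using assms by (auto simp: differentiable_def)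
  then have l: "linear f'" by (rule has_derivative_linear)
  have "f' h = h \<bullet> (\<Sum>b\<in>Basis. f' b *\<^sub>R b)" for h
  proof -
    have "f' h = f' (\<Sum>b\<in>Basis. (h \<bullet> b) *\<^sub>R b)" by (simp add: euclidean_representation)
    also have "\<dots> = (\<Sum>b\<in>Basis. (h \<bullet> b) * f' b)"
      by (simp add: linear_sum[OF l] linear_cmul[OF l])
    finally show ?thesis by (simp add: inner_sum_right mult.commute)
  qed
  then have "f' = (\<lambda>h. h \<bullet> (\<Sum>b\<in>Basis. f' b *\<^sub>R b))" by (rule ext)
  then have "GDERIV f x :> (\<Sum>b\<in>Basis. f' b *\<^sub>R b)" using f' by (simp add: gderiv_def)
  then show ?thesis unfolding gradient_def by (rule someI)
qed

lemma GDERIV_unique: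
  fixes f :: "'a::euclidean_space \<Rightarrow> real"
  assumes "GDERIV f x :> D" "GDERIV f x :> E"
  shows "D = E"
proof -
  have "(\<lambda>h. h \<bullet> D) = (\<lambda>h. h \<bullet> E)"
    using assms unfolding gderiv_def by (rule has_derivative_unique)
  then have "(D - E) \<bullet> (D - E) = 0" by (metis inner_diff_right right_minus_eq)
  then show ?thesis by simp
qed

lemma gradient_eqI: "GDERIV f x :> D \<Longrightarrow> gradient f x = (D :: 'a::euclidean_space)"
  unfolding gradient_def by (rule some_equality) (auto intro: GDERIV_unique)

text \<open>Local integrability gives measurability along an exhaustion of the half ball by compact
  sets, and a Borel version agrees almost everywhere. Setting that version to 0 where the bound
  fails makes the bound hold at every point of the space; \<open>norm (fst x) \<le> norm x\<close>
  turns it into a radial bound.\<close>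

lemma borel_representative:
  fixes f :: "('m::finite) space \<Rightarrow> real"
  assumes int: "\<And>K. compact K \<Longrightarrow> K \<subseteq> half_ball \<Longrightarrow> set_integrable lebesgue K f"
    and ae: "AE x in lebesgue. x \<in> half_ball \<longrightarrow> \<bar>f x\<bar> \<le> M * norm (fst x) ^ j"
    and M: "0 \<le> M"
  obtains f0 where "f0 \<in> borel_measurable borel" "\<And>x. \<bar>f0 x\<bar> \<le> M * norm x ^ j"
    "AE x in lborel. x \<in> half_ball \<longrightarrow> f x = f0 x"
    "(\<lambda>x. indicator half_ball x * f x) \<in> borel_measurable lebesgue"
proof -
  define K :: "nat \<Rightarrow> 'm space set" where
    "K n = cball 0 (1 - inverse (Suc n)) \<inter> {x. inverse (Suc n) \<le> snd x}" for n
  have K: "compact (K n)" "K n \<subseteq> half_ball" for n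
  proof -
    have "closed {x :: 'm space. inverse (Suc n) \<le> snd x}"
      by (intro closed_Collect_le continuous_intros)
    then show "compact (K n)" unfolding K_def by (intro compact_Int_closed) auto
    show "K n \<subseteq> half_ball"
    proof
      fix x assume "x \<in> K n"
      moreover have "0 < inverse (real (Suc n))" by simp
      ultimately have "norm x < 1" "0 < snd x" unfolding K_def Int_iff mem_cball mem_Collect_eq dist_0_norm by linarith+
      then show "x \<in> half_ball" by (simp add: half_ball_def upper_def)
    qed
  qed
  have m: "(\<lambda>x. indicator half_ball x * f x) \<in> borel_measurable lebesgue"
  proof (rule borel_measurable_LIMSEQ_real)
    show "(\<lambda>x. indicator (K n) x *\<^sub>R f x) \<in> borel_measurable lebesgue" for n
      using int[OF K] unfolding set_integrable_def by (rule borel_measurable_integrable)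
    show "(\<lambda>n. indicator (K n) x *\<^sub>R f x) \<longlonglongrightarrow> indicator half_ball x * f x" for x
    proof (cases "x \<in> half_ball")
      case True
      then have "0 < min (snd x) (1 - norm x)" by (simp add: half_ball_def upper_def)
      from order_tendstoD(2)[OF LIMSEQ_inverse_real_of_nat this]
      have "\<forall>\<^sub>F n in sequentially. indicator (K n) x *\<^sub>R f x = indicator half_ball x * f x"
      proof eventually_elim
        case (elim n)
        then have "x \<in> K n" by (simp add: K_def)
        then show ?case using True by simp
      qed
      then show ?thesis by (rule tendsto_eventually)
    next
      case False
      then have "x \<notin> K n" for n using K(2) by blast
      then show ?thesis using False by simp
    qed
  qed
  from completion_ex_borel_measurable_real[OF m]
  obtain g where g: "g \<in> borel_measurable lborel" "AE x in lborel. indicator half_ball x * f x = g x" by blast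
  define f0 where "f0 x = (if \<bar>g x\<bar> \<le> M * norm x ^ j then g x else 0)" for x
  have [measurable]: "g \<in> borel_measurable borel" using g(1) by simp
  have "f0 \<in> borel_measurable borel" unfolding f0_def by measurable
  moreover have "\<bar>f0 x\<bar> \<le> M * norm x ^ j" for x using M by (simp add: f0_def)
  moreover have "AE x in lborel. x \<in> half_ball \<longrightarrow> f x = f0 x"
  proof -
    have "AE x in lborel. x \<in> half_ball \<longrightarrow> \<bar>f x\<bar> \<le> M * norm (fst x) ^ j"
      using ae by (simp add: AE_completion_iff)
    then show ?thesis using g(2)
    proof eventually_elim
      case (elim x)
      show ?case
      proof
        assume x: "x \<in> half_ball"
        have "norm (fst x) \<le> norm x" by (simp add: norm_prod_def real_le_rsqrt)
        then have "M * norm (fst x) ^ j \<le> M * norm x ^ j" using M by (intro mult_left_mono power_mono) auto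
        then show "f x = f0 x" using elim x by (simp add: f0_def)
      qed
    qed
  qed
  ultimately show ?thesis using m by (intro that)
qed

text \<open>Passes from chosen gradients and a Lebesgue measurable source to the Borel setting of
  \<open>weak_solution\<close>, where explicit pairs of a function and its gradient replace the
  choice.\<close>

lemma solution_weak_solution:
  fixes u :: "('m::finite) space \<Rightarrow> real"
  assumes u: "u \<in> solution_class k M" and M: "0 < M"
  shows "\<exists>f. weak_solution u f (upper_gradient u) k M"
proof -
  define G where "G = upper_gradient u"
  obtain \<alpha> where \<alpha>: "C1_Hoelder \<alpha> u" using u by (auto simp: solution_class_def)
  obtain f where f: "weak_laplacian half_ball u f"
      "AE x in lebesgue. x \<in> half_ball \<longrightarrow> \<bar>f x\<bar> \<le> M * norm (fst x) ^ (k - 1)"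
    using u by (auto simp: solution_class_def)
  have thin: "\<forall>x\<in>thin_ball. 0 \<le> u x \<and> 0 \<le> - snd (G x) \<and> u x * snd (G x) = 0"
    using u by (simp add: solution_class_def normal_deriv_def G_def)
  have C1: "C1_norm u \<le> ennreal M" using u by (simp add: solution_class_def)
  have cu: "continuous_on (closed_half 1) u" and cG: "continuous_on (closed_half 1) G"
    using \<alpha> by (simp_all add: C1_Hoelder_def closed_half_1 G_def)
  have hu: "half_ball \<subseteq> (upper :: 'm space set)" by (simp add: half_ball_def)
  have dG: "GDERIV u x :> G x" if "x \<in> half_ball" for x
  proof -
    have "u differentiable (at x)" using \<alpha> that by (simp add: C1_Hoelder_def)
    from GDERIV_gradient[OF this] show ?thesis using that hu by (auto simp: G_def upper_gradient_def)
  qed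
  have ub: "\<bar>u x\<bar> \<le> M" "norm (G x) \<le> M" if x: "x \<in> closed_half 1" for x
  proof -
    have x': "x \<in> half_ball \<union> thin_ball" using x by (simp add: closed_half_1)
    have "ennreal \<bar>u x\<bar> \<le> C1_norm u"
      unfolding C1_norm_def by (rule order_trans[OF SUP_upper[OF x']]) (rule add_increasing2, simp_all)
    then show "\<bar>u x\<bar> \<le> M" using C1 M by (metis ennreal_le_iff less_imp_le order_trans)
    have "ennreal (norm (G x)) \<le> C1_norm u"
      unfolding C1_norm_def G_def by (rule order_trans[OF SUP_upper[OF x']]) (rule add_increasing, simp_all)
    then show "norm (G x) \<le> M" using C1 M by (metis ennreal_le_iff less_imp_le order_trans)
  qed
  have "0 \<in> (top_of_set thin_ball) frontier_of {x \<in> thin_ball. u x = 0}"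
    using u by (simp add: solution_class_def free_boundary_def)
  \<comment> \<open>A closed set contains its frontier, so the free boundary condition at the origin
    yields \<open>u 0 = 0\<close>.\<close>
  moreover have "closedin (top_of_set thin_ball) {x \<in> thin_ball. u x = 0}"
    by (rule continuous_closedin_preimage_constant, rule continuous_on_subset[OF cu]) (simp add: closed_half_1)
  ultimately have u0: "u 0 = 0" using frontier_of_subset_closedin by blast
  obtain f0 where f0: "f0 \<in> borel_measurable borel" "\<And>x. \<bar>f0 x\<bar> \<le> M * norm x ^ (k - 1)"
    "AE x in lborel. x \<in> half_ball \<longrightarrow> f x = f0 x"
    "(\<lambda>x. indicator half_ball x * f x) \<in> borel_measurable lebesgue"
    by (rule borel_representative[OF _ f(2)]) (use f(1) M in \<open>auto simp: weak_laplacian_def\<close>)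
  have hb: "half_ball \<in> sets (borel :: 'm space measure)"
    unfolding half_ball_def using open_upper by (intro borel_open open_Int) auto
  have "(\<integral>x. indicator half_ball x * (G x \<bullet> g x + f0 x * \<phi> x) \<partial>lborel) = 0"
    if \<phi>: "\<And>x. GDERIV \<phi> x :> g x" and cg: "continuous_on UNIV g" and K: "compact K" "K \<subseteq> half_ball"
      and supp: "\<And>x. x \<notin> K \<Longrightarrow> \<phi> x = 0" for \<phi> g K
  proof -
    have gr: "gradient \<phi> = g" using gradient_eqI[OF \<phi>] by (rule ext)
    have d\<phi>: "\<phi> differentiable (at x)" for x
      using \<phi>[of x] unfolding gderiv_def differentiable_def by blast
    have c\<phi>: "continuous_on UNIV \<phi>"
      using d\<phi> by (intro continuous_at_imp_continuous_on ballI differentiable_imp_continuous_within)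
    have "closure {x. \<phi> x \<noteq> 0} \<subseteq> K"
      using supp compact_imp_closed[OF K(1)] by (intro closure_minimal) auto
    moreover from this have "compact (closure {x. \<phi> x \<noteq> 0})"
      using K(1) by (metis closed_closure compact_Int_closed inf.absorb_iff2)
    ultimately have test: "\<phi> \<in> test_functions half_ball"
      using d\<phi> cg K(2) by (auto simp: test_functions_def gr)
    have g0: "g x = 0" if "x \<notin> K" for x
    proof -
      have "x \<in> - K" "open (- K)" using that K(1) compact_imp_closed by auto
      moreover have "FDERIV (\<lambda>x. 0::real) x :> (\<lambda>h. h \<bullet> 0)" by simp
      ultimately have "FDERIV \<phi> x :> (\<lambda>h. h \<bullet> 0)"
        using supp by (intro has_derivative_transform_within_open[of "\<lambda>x. 0::real" _ x UNIV "- K" \<phi>]) auto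
      then have "GDERIV \<phi> x :> 0" unfolding gderiv_def .
      with \<phi> show ?thesis by (rule GDERIV_unique)
    qed
    have "bounded (g ` K)" "bounded (\<phi> ` K)"
      using K(1) by (auto intro!: compact_imp_bounded compact_continuous_image
          intro: continuous_on_subset[OF cg] continuous_on_subset[OF c\<phi>])
    then obtain a b where ab: "\<forall>x\<in>K. norm (g x) \<le> a" "\<forall>x\<in>K. \<bar>\<phi> x\<bar> \<le> b"
      by (auto simp: bounded_iff)
    have [measurable]: "g \<in> borel_measurable borel" "\<phi> \<in> borel_measurable borel" "f0 \<in> borel_measurable borel"
      using cg c\<phi> f0 by (auto intro: borel_measurable_continuous_onI)
    have mG[measurable]: "(\<lambda>x. indicator half_ball x *\<^sub>R G x) \<in> borel_measurable borel"
      by (rule borel_measurable_continuous_on_indicator[OF hb]) (rule continuous_on_subset[OF cG], simp add: closed_half_1)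
    have hK: "half_ball \<subseteq> ball 0 1" "half_ball \<subseteq> (closed_half 1 :: 'm space set)"
      by (auto simp: half_ball_def closed_half_1)
    have e1: "indicator half_ball x * (G x \<bullet> g x) = (indicator half_ball x *\<^sub>R G x) \<bullet> g x" for x by simp
    have e2: "indicator (ball 0 1) x * ((indicator half_ball x *\<^sub>R G x) \<bullet> g x) = indicator half_ball x * (G x \<bullet> g x)" for x
      using hK(1) by (auto simp: indicator_def)
    have i1: "integrable lborel (\<lambda>x. indicator half_ball x * (G x \<bullet> g x))"
    proof -
      have "integrable lborel (\<lambda>x. indicator (ball 0 1) x * ((indicator half_ball x *\<^sub>R G x) \<bullet> g x))"
      proof (rule integrable_on_ball)
        show "\<bar>(indicator half_ball x *\<^sub>R G x) \<bullet> g x\<bar> \<le> M * \<bar>a\<bar>" for x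
        proof (cases "x \<in> K")
          case True
          then have "x \<in> half_ball" using K by auto
          then have "norm (G x) \<le> M" by (rule ub(2)[OF subsetD[OF hK(2)]])
          moreover have "norm (g x) \<le> \<bar>a\<bar>" using ab True by force
          ultimately have "norm (G x) * norm (g x) \<le> M * \<bar>a\<bar>" using M by (intro mult_mono) auto
          then show ?thesis using Cauchy_Schwarz_ineq2[of "G x" "g x"] \<open>x \<in> half_ball\<close> by simp
        next
          case False
          then show ?thesis using g0 M by simp
        qed
      qed measurable
      then show ?thesis unfolding e2 .
    qed
    have e3: "indicator (ball 0 1) x * (indicator half_ball x * (f0 x * \<phi> x)) = indicator half_ball x * (f0 x * \<phi> x)" for x
      using hK(1) by (auto simp: indicator_def)
    have i2: "integrable lborel (\<lambda>x. indicator half_ball x * (f0 x * \<phi> x))"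
    proof -
      have "integrable lborel (\<lambda>x. indicator (ball 0 1) x * (indicator half_ball x * (f0 x * \<phi> x)))"
      proof (rule integrable_on_ball)
        show "\<bar>indicator half_ball x * (f0 x * \<phi> x)\<bar> \<le> M * \<bar>b\<bar>" for x
        proof (cases "x \<in> K")
          case True
          then have x: "x \<in> half_ball" using K by auto
          then have "M * norm x ^ (k - 1) \<le> M * 1" using M hK by (intro mult_left_mono power_le_one) auto
          then have "\<bar>f0 x\<bar> \<le> M" using f0(2)[of x] by simp
          moreover have "\<bar>\<phi> x\<bar> \<le> \<bar>b\<bar>" using ab True by force
          ultimately have "\<bar>f0 x\<bar> * \<bar>\<phi> x\<bar> \<le> M * \<bar>b\<bar>" using M by (intro mult_mono) auto
          then show ?thesis using x by (simp add: abs_mult)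
        next
          case False
          then show ?thesis using supp M by simp
        qed
        show "(\<lambda>x. indicator half_ball x * (f0 x * \<phi> x)) \<in> borel_measurable borel" using hb by measurable
      qed
      then show ?thesis unfolding e3 .
    qed
    have "(LINT x:half_ball|lebesgue. gradient u x \<bullet> gradient \<phi> x) = - (LINT x:half_ball|lebesgue. f x * \<phi> x)"
      using f(1) test by (simp add: weak_laplacian_def)
    moreover have "(LINT x:half_ball|lebesgue. gradient u x \<bullet> gradient \<phi> x) =
        (\<integral>x. indicator half_ball x * (G x \<bullet> g x) \<partial>lborel)"
    proof -
      have "(LINT x:half_ball|lebesgue. gradient u x \<bullet> gradient \<phi> x) =
          (\<integral>x. indicator half_ball x * (G x \<bullet> g x) \<partial>lebesgue)"
        unfolding set_lebesgue_integral_def gr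
        by (rule Bochner_Integration.integral_cong) (use hu in \<open>auto simp: G_def upper_gradient_def indicator_def\<close>)
      also have "\<dots> = (\<integral>x. indicator half_ball x * (G x \<bullet> g x) \<partial>lborel)"
        by (rule integral_completion) (use i1 in \<open>auto dest: borel_measurable_integrable\<close>)
      finally show ?thesis .
    qed
    moreover have "(LINT x:half_ball|lebesgue. f x * \<phi> x) = (\<integral>x. indicator half_ball x * (f0 x * \<phi> x) \<partial>lborel)"
    proof -
      have "(LINT x:half_ball|lebesgue. f x * \<phi> x) = (\<integral>x. indicator half_ball x * (f0 x * \<phi> x) \<partial>lebesgue)"
        unfolding set_lebesgue_integral_def
      proof (rule Bochner_Integration.integral_cong_AE)
        have "(\<lambda>x. (indicator half_ball x * f x) * \<phi> x) \<in> borel_measurable lebesgue"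
          using c\<phi> by (intro borel_measurable_times[OF f0(4)])
            (auto intro: measurable_completion borel_measurable_continuous_onI)
        then show "(\<lambda>x. indicator half_ball x *\<^sub>R (f x * \<phi> x)) \<in> borel_measurable lebesgue"
          by (simp add: mult.assoc)
        show "(\<lambda>x. indicator half_ball x * (f0 x * \<phi> x)) \<in> borel_measurable lebesgue"
          using i2 by (intro measurable_completion) (auto dest: borel_measurable_integrable)
        show "AE x in lebesgue. indicator half_ball x *\<^sub>R (f x * \<phi> x) = indicator half_ball x * (f0 x * \<phi> x)"
          using f0(3) unfolding AE_completion_iff by eventually_elim (auto simp: indicator_def)
      qed
      also have "\<dots> = (\<integral>x. indicator half_ball x * (f0 x * \<phi> x) \<partial>lborel)"
        by (rule integral_completion) (use i2 in \<open>auto dest: borel_measurable_integrable\<close>)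
      finally show ?thesis .
    qed
    ultimately show ?thesis using i1 i2 by (simp add: distrib_left)
  qed
  then have "weak_solution u f0 G k M"
    using M cu cG dG f0(1,2) ub thin u0 by unfold_locales auto
  then show ?thesis unfolding G_def by blast
qed

context weak_solution begin

section \<open>The frequency and the Weiss functional in terms of ht, dir and err\<close>

lemma height_eq:
  assumes "0 \<le> r" "r < 1"
  shows "height u r = r ^ (DIM('m space) - 1) * ht r"
proof -
  have e: "even_ext u x = U x" if "norm x < 1" for x
    using that by (simp add: U_def even_ext_def up_def)
  have "continuous_on (sphere 0 r) (\<lambda>x. U x * U x)"
    by (intro continuous_intros continuous_on_subset[OF lift_continuous(1)]) (use assms in auto)
  then have "continuous_on (sphere 0 r) (\<lambda>x. (even_ext u x)\<^sup>2)"
    by (rule continuous_on_eq) (use assms e in \<open>auto simp: power2_eq_square\<close>)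
  then have "height u r = r ^ (DIM('m space) - 1) * sph r (\<lambda>x. (even_ext u x)\<^sup>2)"
    unfolding height_def using assms(1) by (rule sphere_integral_eq_sph)
  also have "sph r (\<lambda>x. (even_ext u x)\<^sup>2) = ht r"
    unfolding ht_def by (rule sph_cong) (use assms e in \<open>auto simp: power2_eq_square\<close>)
  finally show ?thesis .
qed

text \<open>In the lower half ball the gradient of the even extension is the reflection of
  \<open>V\<close>, hence of the same length; the hyperplane, where the extension may fail to be
  differentiable, is a null set.\<close>

lemma dirichlet_eq:
  assumes "0 < r" "r < 1"
  shows "(LINT x:ball 0 r|lebesgue. (norm (gradient (even_ext u) x))\<^sup>2) = D r"
proof -
  have ng: "(norm (gradient (even_ext u) x))\<^sup>2 = V x \<bullet> V x" if x: "norm x < 1" "snd x \<noteq> 0" for x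
  proof (cases "0 < snd x")
    case True
    then have xh: "x \<in> half_ball" "up x = x" using x by (auto simp: half_ball_def upper_def up_def)
    have "FDERIV u x :> (\<lambda>h. h \<bullet> G x)" using GDERIV_u[OF xh(1)] by (simp add: gderiv_def)
    then have "FDERIV (even_ext u) x :> (\<lambda>h. h \<bullet> G x)"
    proof (rule has_derivative_transform_within_open[OF _ open_upper])
      show "x \<in> upper" using True by (simp add: upper_def)
      show "u y = even_ext u y" if "y \<in> upper" for y using that by (simp add: even_ext_def upper_def)
    qed
    then have "gradient (even_ext u) x = G x" by (intro gradient_eqI) (simp add: gderiv_def)
    then show ?thesis using x xh by (simp add: V_def dot_square_norm)
  next
    case False
    then have xh: "mirror x \<in> half_ball" "up x = mirror x"
      using x by (auto simp: half_ball_def upper_def up_def mirror_def norm_prod_def)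
    have 1: "FDERIV u (mirror x) :> (\<lambda>h. h \<bullet> G (mirror x))" using GDERIV_u[OF xh(1)] by (simp add: gderiv_def)
    have 2: "(mirror has_derivative mirror) (at x)"
      unfolding mirror_def[abs_def] by (auto intro!: derivative_eq_intros)
    have "FDERIV (\<lambda>y. u (mirror y)) x :> (\<lambda>h. mirror h \<bullet> G (mirror x))"
      by (rule has_derivative_compose[OF 2 1])
    then have "FDERIV (even_ext u) x :> (\<lambda>h. mirror h \<bullet> G (mirror x))"
    proof (rule has_derivative_transform_within_open)
      show "open {x :: 'm space. snd x < 0}" by (intro open_Collect_less continuous_intros)
      show "x \<in> {x. snd x < 0}" using False x by simp
      show "u (mirror y) = even_ext u y" if "y \<in> {x. snd x < 0}" for y
        using that by (simp add: even_ext_def mirror_def)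
    qed
    then have "GDERIV (even_ext u) x :> mirror (G (mirror x))"
      by (simp add: gderiv_def mirror_def inner_prod_def)
    then have "gradient (even_ext u) x = mirror (G (mirror x))" by (rule gradient_eqI)
    then show ?thesis using x xh by (simp add: V_def dot_square_norm mirror_def norm_prod_def)
  qed
  have m: "(\<lambda>x. indicator (ball 0 r) x * (V x \<bullet> V x)) \<in> borel_measurable borel" by measurable
  have "AE x in lborel. indicator (ball 0 r) x * (V x \<bullet> V x) =
      indicator (ball 0 r) x *\<^sub>R (norm (gradient (even_ext u) x))\<^sup>2"
    using AE_snd_neq_0 by eventually_elim (use ng assms in \<open>auto simp: indicator_def\<close>)
  then have ae: "AE x in lebesgue. indicator (ball 0 r) x * (V x \<bullet> V x) =
      indicator (ball 0 r) x *\<^sub>R (norm (gradient (even_ext u) x))\<^sup>2"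
    by (rule AE_completion)
  have "(\<lambda>x. indicator (ball 0 r) x * (V x \<bullet> V x)) \<in> borel_measurable lebesgue"
    using m by (intro measurable_completion) simp
  moreover from borel_measurable_AE[OF this ae]
  have "(\<lambda>x. indicator (ball 0 r) x *\<^sub>R (norm (gradient (even_ext u) x))\<^sup>2) \<in> borel_measurable lebesgue" .
  ultimately have "(LINT x:ball 0 r|lebesgue. (norm (gradient (even_ext u) x))\<^sup>2) =
      (\<integral>x. indicator (ball 0 r) x * (V x \<bullet> V x) \<partial>lebesgue)"
    unfolding set_lebesgue_integral_def using ae
    by (intro Bochner_Integration.integral_cong_AE) (auto elim: eventually_mono)
  also have "\<dots> = (\<integral>x. indicator (ball 0 r) x * (V x \<bullet> V x) \<partial>lborel)"
    by (rule integral_completion) (use m in simp)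
  finally show ?thesis by (simp add: D_def ball_int_def)
qed

lemma weiss_eq:
  assumes r: "0 < r" "r < 1"
  shows "weiss \<kappa> u r = r powr (- 2 * \<kappa>) * (dir r - \<kappa> * ht r)"
proof -
  define n where "n = DIM('m space)"
  have n: "2 \<le> n" unfolding n_def by (rule DIM_ge_2)
  have p: "r powr (real n) = r ^ n" using r by (simp add: powr_realpow)
  have p1: "r powr (real n - 1) = r ^ (n - 1)"
    using powr_realpow[OF r(1), of "n - 1"] n by (simp add: of_nat_diff)
  have p2: "r powr (real n - 2) = r ^ n / r\<^sup>2"
    using r by (simp add: powr_diff p)
  have "1 / r powr (real n - 2 + 2 * \<kappa>) * D r = r powr (- 2 * \<kappa>) * dir r"
    unfolding dir_def scl_def n_def[symmetric] powr_add p2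
    using r by (simp add: powr_minus_divide)
  moreover have "\<kappa> / r powr (real n - 1 + 2 * \<kappa>) * height u r = r powr (- 2 * \<kappa>) * (\<kappa> * ht r)"
    unfolding powr_add p1 using height_eq[of r] r by (simp add: powr_minus_divide n_def)
  ultimately show ?thesis
    unfolding weiss_def dirichlet_eq[OF r] height_def[symmetric] n_def[symmetric]
    by (simp add: right_diff_distrib)
qed

text \<open>The strict inequality persists near \<open>s\<close>, so there the maximum is the
  height, and its logarithm is \<open>(n - 1) * ln t + ln (ht t)\<close>.\<close>

lemma frequency_above:
  assumes s: "0 < s" "s < 1" and h: "s ^ (2 * k) < ht s"
  shows "frequency k C u s = (1 + C * s) * (real DIM('m space) - 1 + 2 * ((dir s + err s) / ht s))"
proof -
  define n where "n = DIM('m space)"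
  have n: "2 \<le> n" unfolding n_def by (rule DIM_ge_2)
  have dh: "(ht has_real_derivative 2 * (dir s + err s) / s) (at s)"
    unfolding dir_plus_err[OF s] ht_def[abs_def] by (rule DERIV_height[OF s])
  have h0: "0 < ht s" using h s by (smt (verit) zero_less_power)
  have "isCont (\<lambda>t. ht t - t ^ (2 * k)) s"
    using DERIV_isCont[OF dh] by (intro continuous_intros)
  then have "\<forall>\<^sub>F t in at s. 0 < ht t - t ^ (2 * k)"
    unfolding isCont_def by (rule order_tendstoD) (use h in simp)
  then have "\<forall>\<^sub>F t in nhds s. 0 < ht t - t ^ (2 * k)"
    unfolding eventually_nhds_conv_at using h by simp
  moreover have "\<forall>\<^sub>F t in nhds s. 0 < t \<and> t < 1"
    by (intro eventually_conj order_tendstoD[OF filterlim_ident]) (use s in auto)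
  ultimately have ev: "\<forall>\<^sub>F t in nhds s. ln (max (height u t) (t ^ (DIM('m space) - 1 + 2 * k)))
      = real (n - 1) * ln t + ln (ht t)"
  proof eventually_elim
    case (elim t)
    have "t ^ (DIM('m space) - 1 + 2 * k) \<le> height u t"
      unfolding height_eq[OF less_imp_le[OF conjunct1[OF elim(2)]] conjunct2[OF elim(2)]] power_add
      using elim by (intro mult_left_mono) auto
    moreover have "0 < ht t" using elim by (smt (verit) zero_less_power)
    ultimately show ?case
      using elim by (simp add: max_def height_eq ln_mult ln_realpow n_def)
  qed
  have "((\<lambda>t. real (n - 1) * ln t + ln (ht t)) has_real_derivative
      real (n - 1) * (1 / s) + 1 / ht s * (2 * (dir s + err s) / s)) (at s)"
    by (intro DERIV_add DERIV_cmult DERIV_chain2[OF DERIV_ln_divide[OF h0] dh] DERIV_ln_divide s)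
  then have deriv: "deriv (\<lambda>t. ln (max (height u t) (t ^ (DIM('m space) - 1 + 2 * k)))) s
      = real (n - 1) * (1 / s) + 1 / ht s * (2 * (dir s + err s) / s)"
    by (intro DERIV_imp_deriv) (simp only: DERIV_cong_ev[OF refl ev refl])
  have "(s + C * s\<^sup>2) * (A * (1 / s) + 1 / ht s * (2 * g / s)) = (1 + C * s) * (A + 2 * (g / ht s))" for A g
    using s h0 by (simp add: power2_eq_square field_simps)
  moreover have "real (n - 1) = real DIM('m space) - 1" using n by (simp add: n_def of_nat_diff)
  ultimately show ?thesis unfolding frequency_def deriv by (simp only:)
qed

text \<open>The inequality is assumed on a whole interval because its validity at the single radius
  \<open>s\<close> does not determine the derivative of the maximum there.\<close>

lemma frequency_below:
  assumes \<rho>: "\<rho> \<le> 1" and below: "\<And>t. 0 < t \<Longrightarrow> t < \<rho> \<Longrightarrow> ht t \<le> t ^ (2 * k)"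
    and s: "0 < s" "s < \<rho>"
  shows "frequency k C u s = (1 + C * s) * (real DIM('m space) - 1 + 2 * real k)"
proof -
  define N where "N = DIM('m space) - 1 + 2 * k"
  have "\<forall>\<^sub>F t in nhds s. 0 < t \<and> t < \<rho>"
    by (intro eventually_conj order_tendstoD[OF filterlim_ident]) (use s in auto)
  then have ev: "\<forall>\<^sub>F t in nhds s. ln (max (height u t) (t ^ N)) = real N * ln t"
  proof eventually_elim
    case (elim t)
    have "height u t = t ^ (DIM('m space) - 1) * ht t" by (rule height_eq) (use elim \<rho> in auto)
    also have "\<dots> \<le> t ^ N" unfolding N_def power_add using elim below by (intro mult_left_mono) auto
    finally have "max (height u t) (t ^ N) = t ^ N" by simp
    then show ?case using elim by (simp add: ln_realpow)
  qed
  have "((\<lambda>t. real N * ln t) has_real_derivative real N * (1 / s)) (at s)"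
    by (intro DERIV_cmult DERIV_ln_divide s)
  then have "deriv (\<lambda>t. ln (max (height u t) (t ^ N))) s = real N * (1 / s)"
    by (intro DERIV_imp_deriv) (simp only: DERIV_cong_ev[OF refl ev refl])
  moreover have "real N = real DIM('m space) - 1 + 2 * real k"
    unfolding N_def using DIM_ge_2 by (simp add: of_nat_diff)
  ultimately show ?thesis
    unfolding frequency_def N_def[symmetric] using s
    by (simp add: power2_eq_square field_simps)
qed

text \<open>If \<open>ht\<close> exceeds the threshold somewhere near 0, it does so on a nonempty
  open set; this is not contained in the exceptional null set, and \<open>frequency_above\<close>
  gives the quotient at a remaining point. Otherwise the frequency is explicit near 0 and its limit
  forces \<open>\<kappa> = k\<close>.\<close>

lemma frequency_alternative:
  assumes \<Gamma>: "origin_in_Gamma k \<kappa> u" and \<eta>: "0 < \<eta>" and \<rho>: "0 < \<rho>"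
  shows "(\<exists>s. 0 < s \<and> s < \<rho> \<and> s ^ (2 * k) < ht s \<and> \<bar>(dir s + err s) / ht s - \<kappa>\<bar> \<le> \<eta>) \<or>
        (\<kappa> = real k \<and> (\<exists>s. 0 < s \<and> s < \<rho> \<and> ht s \<le> s ^ (2 * k)))"
proof -
  define n where "n = real DIM('m space)"
  obtain C where C: "0 < C" and "ess_right_limit (frequency k C u) 0 (n - 1 + 2 * \<kappa>)"
    using \<Gamma> by (auto simp: origin_in_Gamma_def n_def)
  then obtain N where N: "negligible N"
    and lim: "(frequency k C u \<longlongrightarrow> n - 1 + 2 * \<kappa>) (at 0 within ({0<..} - N))"
    by (auto simp: ess_right_limit_def)
  define F where "F = at (0::real) within ({0<..} - N)"
  have open_meets: "\<exists>s\<in>S. s \<notin> N" if "open S" "S \<noteq> {}" for S :: "real set"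
    using open_not_negligible[OF that] N negligible_subset by blast
  \<comment> \<open>The complement of a null set is dense, so the limit off \<open>N\<close> is
    unique.\<close>
  have nb: "F \<noteq> bot" unfolding F_def trivial_limit_within islimpt_approachable
  proof (intro notI, elim notE, intro allI impI)
    fix e :: real assume "0 < e"
    then have "\<exists>s\<in>{0<..<e}. s \<notin> N" by (intro open_meets) auto
    then show "\<exists>x'\<in>{0<..} - N. x' \<noteq> 0 \<and> dist x' 0 < e" by force
  qed
  \<comment> \<open>Dividing by a factor that tends to 1 removes the constant \<open>C\<close>,
    which may depend on \<open>u\<close>.\<close>
  have "((\<lambda>s. frequency k C u s / (1 + C * s)) \<longlongrightarrow> (n - 1 + 2 * \<kappa>) / (1 + C * 0)) F"
    unfolding F_def by (intro tendsto_intros lim) auto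
  then have L: "((\<lambda>s. frequency k C u s / (1 + C * s)) \<longlongrightarrow> n - 1 + 2 * \<kappa>) F" by simp
  have Cs: "1 + C * s \<noteq> 0" if "0 < s" for s using C that by (smt (verit) mult_pos_pos)
  have "\<forall>\<^sub>F s in F. dist (frequency k C u s / (1 + C * s)) (n - 1 + 2 * \<kappa>) < 2 * \<eta>"
    using L \<eta> by (intro tendstoD) auto
  then obtain \<delta> where \<delta>: "0 < \<delta>"
    "\<And>s. 0 < s \<Longrightarrow> s \<notin> N \<Longrightarrow> s < \<delta> \<Longrightarrow> \<bar>frequency k C u s / (1 + C * s) - (n - 1 + 2 * \<kappa>)\<bar> < 2 * \<eta>"
    unfolding F_def eventually_at by (auto simp: dist_real_def)
  define \<rho>' where "\<rho>' = min \<rho> (min \<delta> 1)"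
  have \<rho>': "0 < \<rho>'" "\<rho>' \<le> \<rho>" "\<rho>' \<le> \<delta>" "\<rho>' \<le> 1" using \<rho> \<delta> by (auto simp: \<rho>'_def)
  show ?thesis
  proof (cases "\<exists>s. 0 < s \<and> s < \<rho>' \<and> s ^ (2 * k) < ht s")
    case True
    define S where "S = {s \<in> {0<..<\<rho>'}. 0 < ht s - s ^ (2 * k)}"
    have "continuous_on {0<..<\<rho>'} ht"
    proof (rule continuous_on_subset)
      show "continuous_on {0..<1} ht" unfolding ht_def[abs_def]
        by (rule continuous_on_sph[OF _ product_bounds(1)]) (measurable, intro continuous_intros lift_continuous)
    qed (use \<rho>' in auto)
    then have "continuous_on {0<..<\<rho>'} (\<lambda>s. ht s - s ^ (2 * k))" by (intro continuous_intros)
    then have "open ({0<..<\<rho>'} \<inter> (\<lambda>s. ht s - s ^ (2 * k)) -` {0<..})"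
      by (intro continuous_open_preimage) auto
    also have "{0<..<\<rho>'} \<inter> (\<lambda>s. ht s - s ^ (2 * k)) -` {0<..} = S" by (auto simp: S_def)
    finally have "\<exists>s\<in>S. s \<notin> N" by (rule open_meets) (use True in \<open>auto simp: S_def\<close>)
    then obtain s where s: "0 < s" "s < \<rho>'" "s ^ (2 * k) < ht s" "s \<notin> N" by (auto simp: S_def)
    have "frequency k C u s / (1 + C * s) = n - 1 + 2 * ((dir s + err s) / ht s)"
      using frequency_above[of s C] s \<rho>' Cs[of s] by (simp add: n_def)
    moreover have "\<bar>frequency k C u s / (1 + C * s) - (n - 1 + 2 * \<kappa>)\<bar> < 2 * \<eta>"
      by (rule \<delta>(2)) (use s \<rho>' in auto)
    ultimately have "\<bar>(dir s + err s) / ht s - \<kappa>\<bar> \<le> \<eta>" by linarith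
    then show ?thesis using s \<rho>' by (intro disjI1 exI[of _ s]) auto
  next
    case False
    then have below: "ht t \<le> t ^ (2 * k)" if "0 < t" "t < \<rho>'" for t
      using False that by (meson not_le)
    have "\<forall>\<^sub>F s in F. frequency k C u s / (1 + C * s) = n - 1 + 2 * real k"
      unfolding F_def eventually_at
      using frequency_below[OF \<rho>'(4) below] Cs \<rho>'(1)
      by (intro exI[of _ \<rho>']) (auto simp: dist_real_def n_def)
    then have "((\<lambda>s. frequency k C u s / (1 + C * s)) \<longlongrightarrow> n - 1 + 2 * real k) F"
      by (rule tendsto_eventually)
    from tendsto_unique[OF nb L this] have "\<kappa> = real k" by simp
    moreover have "\<exists>s. 0 < s \<and> s < \<rho> \<and> ht s \<le> s ^ (2 * k)"
      using below[of "\<rho>' / 2"] \<rho>' by (intro exI[of _ "\<rho>' / 2"]) auto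
    ultimately show ?thesis by blast
  qed
qed

end

theorem theorem2p7p1:
  fixes k :: nat and M :: real
  assumes "1 \<le> k" and "0 < M"
  shows "\<exists>r\<^sub>M C\<^sub>M. 0 < r\<^sub>M \<and> 0 \<le> C\<^sub>M \<and>
           (\<forall>\<kappa>. \<forall>u :: ('m::finite) space \<Rightarrow> real.
              u \<in> solution_class k M \<longrightarrow> origin_in_Gamma k \<kappa> u \<longrightarrow> \<kappa> \<le> real k \<longrightarrow>
              (\<forall>r. 0 < r \<and> r < r\<^sub>M \<longrightarrow>
                 (\<exists>D. (weiss \<kappa> u has_real_derivative D) (at r) \<and> - C\<^sub>M \<le> D)))"
proof -
  define c where "c = weak_solution.cst TYPE('m) M"
  \<comment> \<open>Positivity of \<open>r1\<close> is available only inside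
    \<open>frequency_system\<close>, that is, once a solution is at hand. The case distinction here
    and the absolute value in \<open>C\<close> make both constants admissible before one is
    chosen.\<close>
  define R where "R = (if 0 < frequency_system.r1 c then frequency_system.r1 c / 2 else 1)"
  define C where "C = \<bar>frequency_system.C4 k c\<bar>"
  have main: "\<exists>D. (weiss \<kappa> u has_real_derivative D) (at r) \<and> - C \<le> D"
    if u: "u \<in> solution_class k M" and \<Gamma>: "origin_in_Gamma k \<kappa> u" and \<kappa>: "\<kappa> \<le> real k"
      and rR: "0 < r" "r < R" for \<kappa> r and u :: "'m space \<Rightarrow> real"
  proof -
    obtain f where f: "weak_solution u f (upper_gradient u) k M"
      using solution_weak_solution[OF u assms(2)] by blast
    interpret w: weak_solution u f "upper_gradient u" k M by (rule f)
    interpret s: frequency_system w.ht w.dir w.dir' w.err w.rad k c \<kappa>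
      unfolding c_def by (rule w.frequency_system[OF assms(1) \<kappa> w.frequency_alternative[OF \<Gamma>]])
    have r: "0 < r" "r < s.r1 / 2" using rR s.r1 by (simp_all add: R_def)
    obtain D where D: "((\<lambda>r. r powr (- 2 * \<kappa>) * (w.dir r - \<kappa> * w.ht r)) has_real_derivative D) (at r)"
        "- s.C4 \<le> D"
      using s.weiss_derivative[OF r] by blast
    have "r < 1" using r s.r1 by simp
    then have "\<forall>\<^sub>F t in nhds r. 0 < t \<and> t < 1"
      using r by (intro eventually_conj order_tendstoD[OF filterlim_ident]) auto
    then have ev: "\<forall>\<^sub>F t in nhds r. weiss \<kappa> u t = t powr (- 2 * \<kappa>) * (w.dir t - \<kappa> * w.ht t)"
      by eventually_elim (simp add: w.weiss_eq)
    have "(weiss \<kappa> u has_real_derivative D) (at r)"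
      unfolding DERIV_cong_ev[OF refl ev refl] by (rule D(1))
    moreover have "- C \<le> D" using D(2) by (simp add: C_def)
    ultimately show ?thesis by blast
  qed
  have "0 < R" "0 \<le> C" by (auto simp: R_def C_def)
  with main show ?thesis by blast
qed

end
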